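(* Let $G_0$ be a finite abelian group, let $G\leq G_0$ be a subgroup, let $\gamma,\delta\in G_0$, let $n\geq |G|$ be an integer, let $A\subseteq\mathbb Z$ be nonempty with $\gcd(A)=1$, and let $W$ be a finite sequence of integers with $\mathrm{supp}(W)=A$. Let $S$ be a sequence over $G_0$ all of whose terms lie in the coset $\gamma+G$, such that $A\cdot s\subseteq \delta+G$ for every $s\in\mathrm{supp}(S)$, and such that $|S|\geq n+\mathsf D_A(G)-1$. Then there exist a subgroup $H\leq G$, elements $\alpha\in\gamma+G$ and $\beta\in\delta+G$, and subsequences $S'\mid S$, $S''\mid S'$ and $S_0\mid S$ such that: (1) all terms of $S'$ and of $S''$ lie in $\alpha+H$, and $A\cdot s\subseteq \beta+H$ for all $s\in\mathrm{supp}(S')$; (2) $|S'|\geq \min\{|S|,\ |S|-(|G/H|-2)\}$; (3) $|S''|=|H|+\mathsf D_A(H)-1$; (4) $|H|\beta+H=\Sigma_{|H|}(W^{|H|},S'')$; (5) $\Sigma_n(W^n,S)=(n-|H|-r)\beta+\Sigma_{|H|+r}(W^{|H|+r},S_0)$, and this set is $H$-periodic (a union of $H$-cosets) and contains $n\beta$; (6) $S S'^{-1}S''\mid S_0$ and $|S_0|=|H|+r+\mathsf D_A(H)+\mathsf D_A(G/H)-2\leq |H|+r+\mathsf D_A(G)-1$, where $r=|SS'^{-1}|$ (the number of terms of $S$ not in $S'$) satisfies $r\leq\max\{0,\ |G/H|-2\}$.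
   Context: Sequences are finite multisets (elements of the free abelian monoid over a set), written multiplicatively; $|S|$ is the length, $\mathrm{supp}(S)$ the set of distinct terms, $T\mid S$ means $T$ is a subsequence (sub-multiset) of $S$, $ST^{-1}$ denotes $S$ with the terms of $T$ removed, and $T_1T_2$ denotes concatenation. For $A\subseteq\mathbb Z$ and a group element $g$, $A\cdot g=\{ag: a\in A\}$. For a sequence $W$ of integers with support $A$ and a sequence $S$ over an abelian group, $\Sigma_k(W^k,S)$ is the set of all sums $\sum_{i=1}^k a_is_i$ where $s_1\cdots s_k$ is a subsequence of $S$ of length $k$ and $a_1,\dots,a_k\in A$ (each $a_i$ chosen freely from $A$); similarly $\Sigma(W^{|S|},S)$ is the set of all such sums $\sum_{i=1}^r a_is_i$ over nontrivial (nonempty) subsequences $s_1\cdots s_r$ of $S$ with $a_i\in A$. For a finite abelian group $G$, $\mathsf D_A(G)$ is the least integer $\ell$ such that every sequence over $G$ of length $\ell$ has a nontrivial subsequence $s_1\cdots s_r$ with $\sum_{i=1}^r a_is_i=0$ for some $a_i\in A$ (i.e. $0\in\Sigma(W^{\ell},S)$); $\mathsf D_A(G/H)$ is defined likewise for the quotient group. For $k\in\mathbb Z$ and $g$ a group element, $kg+H$ is the coset; a set $X$ is $H$-periodic if $X+H=X$. *)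

theory Defs
  imports "HOL-Algebra.Coset" "HOL-Algebra.FiniteProduct" "HOL-Library.Multiset"
begin

text \<open>
  Abelian groups are written multiplicatively, so a weighted sum
  \<open>a\<^sub>1 s\<^sub>1 + \<dots> + a\<^sub>k s\<^sub>k\<close> becomes the product of the integer powers
  \<open>s\<^sub>i [^] a\<^sub>i\<close>, and a coset \<open>g + H\<close> becomes \<open>g <# H\<close>. Sequences are multisets.
\<close>

text \<open>
  \<open>wsums_of_length G A k S\<close> is \<open>\<Sigma>\<^sub>k(W\<^sup>k, S)\<close> for any integer sequence \<open>W\<close> with support \<open>A\<close>:
  in \<open>W\<^sup>k\<close> every element of \<open>A\<close> has multiplicity at least \<open>k\<close>, so each weight is chosen freely.
\<close>

definition wsums_of_length ::
    "('a, 'b) monoid_scheme \<Rightarrow> int set \<Rightarrow> nat \<Rightarrow> 'a multiset \<Rightarrow> 'a set" where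
  "wsums_of_length G A k S =
     {finprod G (\<lambda>i. s i [^]\<^bsub>G\<^esub> a i) {1..k} | (s :: nat \<Rightarrow> 'a) (a :: nat \<Rightarrow> int).
        image_mset s (mset_set {1..k}) \<subseteq># S \<and> (\<forall>i\<in>{1..k}. a i \<in> A)}"

definition wsums :: "('a, 'b) monoid_scheme \<Rightarrow> int set \<Rightarrow> 'a multiset \<Rightarrow> 'a set" where
  "wsums G A S = (\<Union>r\<in>{1..size S}. wsums_of_length G A r S)"

definition davenport :: "('a, 'b) monoid_scheme \<Rightarrow> int set \<Rightarrow> nat" where
  "davenport G A =
     (LEAST l. \<forall>S. set_mset S \<subseteq> carrier G \<and> size S = l \<longrightarrow> \<one>\<^bsub>G\<^esub> \<in> wsums G A S)"

end

theory Submission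
  imports Defs "HOL-Library.Set_Algebras" "HOL-Library.Function_Algebras"
    "HOL-Computational_Algebra.Group_Closure"
begin

text \<open>
  All groups that occur are quotients \<open>G/K\<close> of additive subgroups \<open>K \<subseteq> G\<close> of one commutative
  ring, and a group \<open>G\<^sub>0\<close> enters as a quotient of \<open>\<int>\<close>-valued functions. Passing to a quotient
  then only enlarges \<open>K\<close>, so that an induction on the index \<open>|G/K|\<close> can use subgroups and
  quotients alike.

  Write \<open>f s = A \<cdot> s - \<beta>\<close>. Weighted sums of length \<open>n\<close> are sums of \<open>n\<close> of the sets \<open>f s\<close>,
  translated by \<open>n \<beta>\<close>. Suppose that few terms \<open>s\<close> have \<open>f s\<close> outside \<open>H\<close> and that sums of
  \<open>|H/K|\<close> terms inside fill \<open>H\<close>. The Davenport constants provide zero sums modulo \<open>H\<close> that pad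
  every representation to the right length, so the sums of length \<open>n\<close> are, up to translation,
  all sums of terms outside \<open>H\<close>, plus \<open>H\<close>.

  Such an \<open>H\<close> and \<open>\<beta>\<close> exist by induction on \<open>|G/K|\<close>. Two facts about sumsets are used. First, if
  for every proper subgroup \<open>L\<close> at least \<open>|G/L| - 1\<close> members of a family of sets containing \<open>0\<close> are
  not contained in \<open>L\<close>, then their sum is \<open>G\<close>. Second, the Scherk--Kemperman inequality. If for
  some \<open>\<beta>\<close> at least \<open>D\<^sub>A(G/K)\<close> of the sets \<open>f s\<close> lie in \<open>K\<close>, let \<open>H\<close> be the smallest subgroup
  with at most \<open>|G/H| - 2\<close> sets outside. If many sets \<open>A \<cdot> s\<close> lie in one coset of some \<open>L \<supset> K\<close>
  but not of \<open>K\<close>, a few of them sum to a full coset of \<open>L\<close>, and the other terms are treated modulo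
  \<open>L\<close>. Otherwise every element of \<open>G\<close> is a sum of sets \<open>f s\<close>, for the \<open>\<beta>\<close> with most sets in \<open>K\<close>,
  and a representation that is too long can be shortened by a few terms, since the
  Scherk--Kemperman inequality leaves no room for zero to be represented uniquely.
\<close>

subsection \<open>Subgroups and cosets\<close>

locale add_subgroup =
  fixes K :: "'v::ab_group_add set"
  assumes zero_mem: "0 \<in> K" and diff_mem: "x \<in> K \<Longrightarrow> y \<in> K \<Longrightarrow> x - y \<in> K"
begin

lemma minus_mem: "x \<in> K \<Longrightarrow> - x \<in> K"
  using diff_mem[of 0 x] zero_mem by simp

lemma add_mem: "x \<in> K \<Longrightarrow> y \<in> K \<Longrightarrow> x + y \<in> K"
  using diff_mem[of x "- y"] minus_mem by simp

lemma diff_mem_commute: "x - y \<in> K \<longleftrightarrow> y - x \<in> K"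
  by (metis minus_mem minus_diff_eq)

lemma diff_mem_trans: "x - y \<in> K \<Longrightarrow> y - z \<in> K \<Longrightarrow> x - z \<in> K"
  using add_mem[of "x - y" "y - z"] by simp

lemma coset_eq_iff: "x +o K = y +o K \<longleftrightarrow> x - y \<in> K"
proof
  assume "x +o K = y +o K"
  then have "x \<in> y +o K" using set_plus_intro2[OF zero_mem, of x] by simp
  then show "x - y \<in> K" by (simp add: set_minus_plus)
next
  assume "x - y \<in> K"
  then have "z - x \<in> K \<longleftrightarrow> z - y \<in> K" for z
    using diff_mem_trans diff_mem_commute by blast
  then show "x +o K = y +o K" by (simp add: set_eq_iff flip: set_minus_plus)
qed

lemma elt_plus_absorb: "x \<in> K \<Longrightarrow> x +o K = K"
  using coset_eq_iff[of x 0] by simp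

lemma elt_plus_subset_iff:
  assumes "x \<in> K"
  shows "x +o X \<subseteq> K \<longleftrightarrow> X \<subseteq> K"
proof -
  have "x + y \<in> K \<longleftrightarrow> y \<in> K" for y
    using assms add_mem[of x y] diff_mem[of "x + y" x] by auto
  then show ?thesis by (auto simp: elt_set_plus_def)
qed

lemma plus_subset: "X \<subseteq> K \<Longrightarrow> Y \<subseteq> K \<Longrightarrow> X + Y \<subseteq> K"
  using add_mem by (auto elim!: set_plus_elim)

lemma subset_plus: "X \<subseteq> X + K"
  using set_zero_plus2[OF zero_mem] by (subst add.commute)

lemma plus_absorb: "X \<subseteq> K \<Longrightarrow> X \<noteq> {} \<Longrightarrow> X + K = K"
proof
  assume "X \<subseteq> K" "X \<noteq> {}"
  then obtain x where "x \<in> X" "x \<in> K" by blast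
  then show "K \<subseteq> X + K" using elt_plus_absorb[of x] set_plus_mono3[of x X K] by simp
qed (simp add: plus_subset)

lemma absorb_plus: "X \<subseteq> K \<Longrightarrow> X \<noteq> {} \<Longrightarrow> K + X = K"
  by (subst add.commute) (rule plus_absorb)

lemma plus_self: "K + K = K"
  using plus_absorb zero_mem by blast

lemma periodic_plus: "(X + K) + K = X + K"
  by (simp add: add.assoc plus_self)

end

lemma mem_set_plus_iff: "z \<in> X + Y \<longleftrightarrow> (\<exists>x\<in>X. z - x \<in> Y)" for z :: "'v::ab_group_add"
proof
  assume "\<exists>x\<in>X. z - x \<in> Y"
  then obtain x where "x \<in> X" "z - x \<in> Y" by blast
  then show "z \<in> X + Y" using set_plus_intro[of x X "z - x" Y] by simp
qed (force elim!: set_plus_elim)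

lemma elt_plus_inject: "x +o X = x +o Y \<longleftrightarrow> X = Y" for x :: "'v::ab_group_add"
  by (metis set_plus_rearrange2 left_minus set_zero_plus)

definition cosets :: "'v::ab_group_add set \<Rightarrow> 'v set \<Rightarrow> 'v set set" where
  "cosets K X = (\<lambda>x. x +o K) ` X"

text \<open>As a cardinality, \<open>ncosets K X\<close> is \<open>0\<close> if \<open>X\<close> meets infinitely many cosets.\<close>

definition ncosets :: "'v::ab_group_add set \<Rightarrow> 'v set \<Rightarrow> nat" where
  "ncosets K X = card (cosets K X)"

lemma cosets_mono: "X \<subseteq> Y \<Longrightarrow> cosets K X \<subseteq> cosets K Y"
  by (auto simp: cosets_def)

lemma cosets_elt_plus: "cosets K (x +o X) = (+o) x ` cosets K X" for x :: "'v::ab_group_add"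
  by (auto simp: cosets_def elt_set_plus_def[of x X] image_iff set_plus_rearrange2)

lemma ncosets_elt_plus: "ncosets K (x +o X) = ncosets K X" for x :: "'v::ab_group_add"
  by (simp add: ncosets_def cosets_elt_plus card_image inj_on_def elt_plus_inject)

lemma coset_representatives:
  obtains U where "U \<subseteq> X" "inj_on (\<lambda>x. x +o K) U" "cosets K U = cosets K X"
  using subset_image_inj[of "cosets K X" "\<lambda>x. x +o K" X] unfolding cosets_def by auto

context add_subgroup
begin

lemma cosets_plus: "cosets K (X + K) = cosets K X"
proof
  show "cosets K (X + K) \<subseteq> cosets K X"
    by (auto simp: cosets_def mem_set_plus_iff image_iff coset_eq_iff)
qed (intro cosets_mono subset_plus)

lemma ncosets_plus: "ncosets K (X + K) = ncosets K X"
  by (simp add: ncosets_def cosets_plus)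

lemma ncosets_self: "ncosets K K = 1"
proof -
  have "cosets K K = {K}" using elt_plus_absorb zero_mem by (force simp: cosets_def)
  then show ?thesis by (simp add: ncosets_def)
qed

lemma periodic_mem: "X + K = X \<Longrightarrow> x \<in> X \<Longrightarrow> y - x \<in> K \<Longrightarrow> y \<in> X"
  using mem_set_plus_iff by blast

lemma periodic_superset:
  assumes "cosets K X \<subseteq> cosets K Y" "Y + K = Y"
  shows "X \<subseteq> Y"
proof
  fix x assume "x \<in> X"
  then obtain y where "y \<in> Y" "x - y \<in> K"
    using assms(1) by (auto simp: cosets_def image_subset_iff image_iff coset_eq_iff)
  then show "x \<in> Y" using periodic_mem[OF assms(2)] by blast
qed

lemma periodic_eqI:
  assumes "X \<subseteq> Y" "X + K = X" "finite (cosets K Y)" "ncosets K Y \<le> ncosets K X"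
  shows "X = Y"
proof -
  have "cosets K X = cosets K Y"
    using assms by (intro card_seteq cosets_mono) (simp_all add: ncosets_def)
  then show ?thesis using periodic_superset[of Y X] assms(1,2) by blast
qed

end

subsection \<open>Finite quotients of subgroups\<close>

definition intermediate :: "'v::ab_group_add set \<Rightarrow> 'v set \<Rightarrow> 'v set \<Rightarrow> bool" where
  "intermediate K H G \<longleftrightarrow> add_subgroup H \<and> K \<subseteq> H \<and> H \<subseteq> G"

locale subquotient = lower: add_subgroup K + upper: add_subgroup G
  for K G :: "'v::ab_group_add set" +
  assumes lower_subset_upper: "K \<subseteq> G" and finite_quotient: "finite (cosets K G)"
begin

lemma intermediate_lower: "intermediate K K G"
  and intermediate_upper: "intermediate K G G"
  using lower_subset_upper lower.add_subgroup_axioms upper.add_subgroup_axioms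
  by (simp_all add: intermediate_def)

lemma finite_cosets: "X \<subseteq> G \<Longrightarrow> finite (cosets K X)"
  by (rule finite_subset[OF cosets_mono finite_quotient])

lemma ncosets_mono: "X \<subseteq> Y \<Longrightarrow> Y \<subseteq> G \<Longrightarrow> ncosets K X \<le> ncosets K Y"
  unfolding ncosets_def by (intro card_mono finite_cosets cosets_mono)

lemma ncosets_pos: "X \<subseteq> G \<Longrightarrow> X \<noteq> {} \<Longrightarrow> 1 \<le> ncosets K X"
  using finite_cosets by (simp add: ncosets_def cosets_def Suc_le_eq card_gt_0_iff)

lemma index_pos: "1 \<le> ncosets K G"
  using ncosets_pos upper.zero_mem by blast

lemma index_ge_2:
  assumes "K \<noteq> G"
  shows "2 \<le> ncosets K G"
proof -
  have "ncosets K K \<noteq> ncosets K G"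
    using lower.periodic_eqI[OF lower_subset_upper lower.plus_self finite_quotient] assms
    by (metis order_refl)
  then show ?thesis using lower.ncosets_self index_pos by linarith
qed

lemma subquotient_below:
  assumes "intermediate K H G"
  shows "subquotient K H"
proof -
  interpret H: add_subgroup H using assms by (simp add: intermediate_def)
  show ?thesis using assms finite_cosets by unfold_locales (auto simp: intermediate_def)
qed

lemma subquotient_above:
  assumes "intermediate K H G"
  shows "subquotient H G"
proof -
  interpret H: add_subgroup H using assms by (simp add: intermediate_def)
  have "K + H = H" using assms lower.zero_mem H.plus_absorb[of K] by (auto simp: intermediate_def)
  then have "cosets H G = (\<lambda>C. C + H) ` cosets K G"
    by (simp add: cosets_def image_image set_plus_rearrange3)
  then show ?thesis using assms finite_quotient by unfold_locales (auto simp: intermediate_def)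
qed

lemma ncosets_tower:
  assumes H: "intermediate K H G" and X: "X + H = X" "X \<subseteq> G"
  shows "ncosets K X = ncosets K H * ncosets H X"
proof -
  interpret H: add_subgroup H using H by (simp add: intermediate_def)
  interpret HG: subquotient H G by (rule subquotient_above[OF H])
  have union: "cosets K X = \<Union> (cosets K ` cosets H X)"
  proof -
    have "X + H = \<Union> (cosets H X)"
      by (auto simp: cosets_def set_plus_def elt_set_plus_def)
    then have "cosets K X = cosets K (\<Union> (cosets H X))" using X(1) by simp
    then show ?thesis by (simp add: cosets_def image_Union)
  qed
  have disjoint: "C = D"
    if "C \<in> cosets H X" "D \<in> cosets H X" and meet: "cosets K C \<inter> cosets K D \<noteq> {}" for C D
  proof -
    from that obtain x y where xy: "C = x +o H" "D = y +o H" by (auto simp: cosets_def)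
    from meet obtain c d where "c \<in> C" "d \<in> D" "c +o K = d +o K" unfolding cosets_def by blast
    then have "c - x \<in> H" "d - y \<in> H" "c - d \<in> K"
      by (simp_all add: xy set_minus_plus lower.coset_eq_iff)
    then have "x - c \<in> H" "c - d \<in> H" "d - y \<in> H"
      using H H.diff_mem_commute[of c x] by (auto simp: intermediate_def)
    then have "x - y \<in> H" by (metis H.diff_mem_trans)
    then show "C = D" unfolding xy by (simp add: H.coset_eq_iff)
  qed
  have card: "card (cosets K C) = ncosets K H" if "C \<in> cosets H X" for C
    using that ncosets_elt_plus[of K _ H] by (auto simp: cosets_def[of H] ncosets_def)
  have "finite (cosets K C)" if "C \<in> cosets H X" for C
    using finite_cosets[OF X(2)] that unfolding union by (meson Sup_upper finite_subset imageI)
  then have "ncosets K X = (\<Sum>C\<in>cosets H X. card (cosets K C))"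
    unfolding ncosets_def union using HG.finite_cosets[OF X(2)] disjoint
    by (intro card_UN_disjoint ballI impI) blast+
  then show ?thesis using card by (simp add: ncosets_def[of H])
qed

lemma index_tower:
  assumes "intermediate K H G"
  shows "ncosets K G = ncosets K H * ncosets H G"
proof (rule ncosets_tower[OF assms])
  show "G + H = G"
    using assms upper.absorb_plus[of H] add_subgroup.zero_mem[of H]
    by (auto simp: intermediate_def)
qed simp

lemma index_strict_mono:
  assumes "intermediate K H G" "H \<noteq> G"
  shows "ncosets K H < ncosets K G"
proof (rule ccontr)
  assume "\<not> ncosets K H < ncosets K G"
  moreover have "H + K = H"
    using assms add_subgroup.absorb_plus[of H K] lower.zero_mem by (auto simp: intermediate_def)
  ultimately show False
    using assms lower.periodic_eqI[of H G] finite_quotient by (simp add: intermediate_def)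
qed

lemma index_add_le:
  assumes "intermediate K H G"
  shows "ncosets K H + ncosets H G \<le> ncosets K G + 1"
proof -
  have "1 \<le> ncosets K H" "1 \<le> ncosets H G"
    using assms subquotient_below subquotient_above subquotient.index_pos by blast+
  then obtain a b where "ncosets K H = a + 1" "ncosets H G = b + 1"
    by (metis add.commute le_Suc_ex plus_1_eq_Suc)
  then show ?thesis using index_tower[OF assms] by simp
qed

end

subsection \<open>Sums of families of sets\<close>

lemma submultiset_of_size_between:
  assumes "M \<subseteq># S" "size M \<le> n" "n \<le> size S"
  obtains T where "M \<subseteq># T" "T \<subseteq># S" "size T = n"
proof -
  obtain xs where xs: "mset xs = S - M" using ex_mset by blast
  let ?T = "mset (take (n - size M) xs)"
  have "size ?T = n - size M"
    using xs assms by (metis diff_le_mono length_take min_absorb2 size_Diff_submset size_mset)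
  moreover have "?T \<subseteq># S - M"
    by (metis append_take_drop_id mset_append mset_subset_eq_add_left xs)
  ultimately show thesis
    using that[of "M + ?T"] assms(1,2) subset_mset.le_diff_conv2[of M S ?T]
    by (simp add: add.commute)
qed

lemma submultiset_of_size:
  assumes "n \<le> size S"
  obtains T where "T \<subseteq># S" "size T = n"
  using submultiset_of_size_between[of "{#}" S n] assms by auto

definition subsums :: "('i \<Rightarrow> 'v::ab_group_add set) \<Rightarrow> 'i multiset \<Rightarrow> 'v set" where
  "subsums f R = (\<Sum>s\<in>#R. insert 0 (f s))"

definition inside :: "('i \<Rightarrow> 'v set) \<Rightarrow> 'v set \<Rightarrow> 'i multiset \<Rightarrow> 'i multiset" where
  "inside f L R = {#s \<in># R. f s \<subseteq> L#}"

definition outside :: "('i \<Rightarrow> 'v set) \<Rightarrow> 'v set \<Rightarrow> 'i multiset \<Rightarrow> 'i multiset" where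
  "outside f L R = {#s \<in># R. \<not> f s \<subseteq> L#}"

lemma outside_plus_inside: "outside f L R + inside f L R = R"
  unfolding inside_def outside_def by (metis add.commute multiset_partition)

lemma size_outside_inside: "size (outside f L R) + size (inside f L R) = size R"
  by (metis outside_plus_inside size_union)

lemma inside_subset: "inside f L R \<subseteq># R" and outside_subset: "outside f L R \<subseteq># R"
  by (simp_all add: inside_def outside_def)

lemma subset_filter_msetI:
  assumes "J \<subseteq># R" "\<forall>s\<in>#J. P s"
  shows "J \<subseteq># filter_mset P R"
proof -
  have "J = filter_mset P J" using assms(2) by (simp add: filter_mset_cong)
  also have "\<dots> \<subseteq># filter_mset P R" by (rule multiset_filter_mono[OF assms(1)])
  finally show ?thesis .
qed

lemma subset_insideI: "J \<subseteq># R \<Longrightarrow> \<forall>s\<in>#J. f s \<subseteq> L \<Longrightarrow> J \<subseteq># inside f L R"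
  and subset_outsideI: "J \<subseteq># R \<Longrightarrow> \<forall>s\<in>#J. \<not> f s \<subseteq> L \<Longrightarrow> J \<subseteq># outside f L R"
  by (simp_all add: inside_def outside_def subset_filter_msetI)

lemma outside_outside: "L \<subseteq> M \<Longrightarrow> outside f M (outside f L R) = outside f M R"
  by (auto simp: outside_def filter_filter_mset intro!: filter_mset_cong)

lemma inside_inside: "L \<subseteq> M \<Longrightarrow> inside f L (inside f M R) = inside f L R"
  by (auto simp: inside_def filter_filter_mset intro!: filter_mset_cong)

lemma outside_split: "L \<subseteq> M \<Longrightarrow> outside f L R = outside f M R + outside f L (inside f M R)"
  by (auto simp: multiset_eq_iff outside_def inside_def)

lemma sumset_nonempty: "\<forall>s\<in>#R. f s \<noteq> {} \<Longrightarrow> (\<Sum>s\<in>#R. f s) \<noteq> ({} :: 'v::ab_group_add set)"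
proof (induction R)
  case (add s R)
  then obtain x y where "x \<in> f s" "y \<in> (\<Sum>s\<in>#R. f s)" by auto
  then have "x + y \<in> f s + (\<Sum>s\<in>#R. f s)" by blast
  then show ?case by auto
qed simp

lemma zero_mem_sumset: "\<forall>s\<in>#R. 0 \<in> f s \<Longrightarrow> (0 :: 'v::ab_group_add) \<in> (\<Sum>s\<in>#R. f s)"
proof (induction R)
  case (add s R)
  then have "0 + 0 \<in> f s + (\<Sum>s\<in>#R. f s)" by (intro set_plus_intro) auto
  then show ?case by simp
qed simp

lemma sum_mset_mem_sumset: "\<forall>s\<in>#R. c s \<in> f s \<Longrightarrow> (\<Sum>s\<in>#R. c s) \<in> (\<Sum>s\<in>#R. f s)"
  for c :: "'i \<Rightarrow> 'v::ab_group_add"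
  by (induction R) auto

lemma sumset_elt_plus: "(\<Sum>s\<in>#R. c s +o f s) = (\<Sum>s\<in>#R. c s) +o (\<Sum>s\<in>#R. f s)"
  for c :: "'i \<Rightarrow> 'v::ab_group_add"
  by (induction R) (simp_all add: set_plus_rearrange)

lemma sumset_stable: "\<forall>s\<in>#R. f s + X = X \<Longrightarrow> (\<Sum>s\<in>#R. f s) + X = X"
  for X :: "'v::ab_group_add set"
  by (induction R) (simp_all add: add.assoc)

lemma mem_subsums_iff: "z \<in> subsums f R \<longleftrightarrow> (\<exists>T. T \<subseteq># R \<and> z \<in> (\<Sum>s\<in>#T. f s))"
proof
  show "z \<in> subsums f R \<Longrightarrow> \<exists>T. T \<subseteq># R \<and> z \<in> (\<Sum>s\<in>#T. f s)"
  proof (induction R arbitrary: z)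
    case (add s R)
    then obtain x y where z: "z = x + y" "x \<in> insert 0 (f s)" "y \<in> subsums f R"
      by (auto simp: subsums_def elim!: set_plus_elim)
    with add.IH obtain T where T: "T \<subseteq># R" "y \<in> (\<Sum>s\<in>#T. f s)" by blast
    show ?case
    proof (cases "x = 0")
      case True
      then show ?thesis using T z by (intro exI[of _ T]) (auto intro: subset_mset.order_trans)
    next
      case False
      then show ?thesis using T z by (intro exI[of _ "add_mset s T"]) auto
    qed
  qed (simp add: subsums_def)
next
  have "z \<in> (\<Sum>s\<in>#T. f s) \<Longrightarrow> z \<in> subsums f (T + U)" for T U
  proof (induction T arbitrary: z)
    case empty
    then show ?case using zero_mem_sumset[of U "\<lambda>s. insert 0 (f s)"] by (simp add: subsums_def)
  next
    case (add s T)
    then show ?case by (auto simp: subsums_def elim!: set_plus_elim)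
  qed
  then show "\<exists>T. T \<subseteq># R \<and> z \<in> (\<Sum>s\<in>#T. f s) \<Longrightarrow> z \<in> subsums f R"
    by (metis subset_mset.add_diff_inverse)
qed

lemma subsums_mono: "R \<subseteq># R' \<Longrightarrow> subsums f R \<subseteq> subsums f R'"
  by (meson mem_subsums_iff subset_mset.order_trans subsetI)

lemma zero_mem_subsums: "0 \<in> subsums f R"
  by (simp add: subsums_def zero_mem_sumset)

context add_subgroup
begin

lemma sumset_subset: "\<forall>s\<in>#R. f s \<subseteq> K \<Longrightarrow> (\<Sum>s\<in>#R. f s) \<subseteq> K"
  by (induction R) (simp_all add: zero_mem plus_subset)

lemma subsums_subset: "\<forall>s\<in>#R. f s \<subseteq> K \<Longrightarrow> subsums f R \<subseteq> K"
  unfolding subsums_def by (intro sumset_subset) (simp add: zero_mem)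

end

definition stabilizer :: "'v::ab_group_add set \<Rightarrow> 'v set \<Rightarrow> 'v set" where
  "stabilizer G Z = {x \<in> G. x +o Z = Z}"

context subquotient
begin

lemma intermediate_stabilizer:
  assumes "Z + K = Z"
  shows "intermediate K (stabilizer G Z) G"
proof -
  have "x +o Z = Z" if "x \<in> K" for x
    using assms set_plus_rearrange4[of Z x K] lower.elt_plus_absorb[OF that] by simp
  moreover have "(x - y) +o Z = Z" if "x +o Z = Z" "y +o Z = Z" for x y
    by (metis that diff_add_cancel set_plus_rearrange2)
  ultimately show ?thesis
    using lower_subset_upper upper.zero_mem upper.diff_mem
    by (auto simp: intermediate_def stabilizer_def add_subgroup_def)
qed

lemma plus_stabilizer: "Z + stabilizer G Z = Z"
proof
  show "Z + stabilizer G Z \<subseteq> Z"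
  proof
    fix z assume "z \<in> Z + stabilizer G Z"
    then obtain w x where "w \<in> Z" "x +o Z = Z" "z = w + x"
      by (auto simp: stabilizer_def elim!: set_plus_elim)
    then show "z \<in> Z" using set_plus_intro2[of w Z x] by (simp add: add.commute)
  qed
  show "Z \<subseteq> Z + stabilizer G Z"
    using set_zero_plus2[of "stabilizer G Z" Z] upper.zero_mem
    by (subst add.commute) (simp add: stabilizer_def)
qed

lemma sumset_greedy:
  assumes f: "\<forall>s\<in>#R. 0 \<in> f s \<and> f s \<subseteq> G"
  obtains R' where "R' \<subseteq># R" "size R' + 1 \<le> ncosets K (\<Sum>s\<in>#R'. f s)"
    "\<forall>s\<in>#R - R'. f s + ((\<Sum>s\<in>#R'. f s) + K) = (\<Sum>s\<in>#R'. f s) + K"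
proof -
  let ?P = "\<lambda>R'. R' \<subseteq># R \<and> size R' + 1 \<le> ncosets K (\<Sum>s\<in>#R'. f s)"
  have "?P {#}" using ncosets_pos[of "{0}"] upper.zero_mem by simp
  then obtain R' where R': "?P R'" and maximal: "\<And>M. ?P M \<Longrightarrow> size M \<le> size R'"
    using ex_has_greatest_nat[of ?P "{#}" size "Suc (size R)"]
    by (auto simp: less_Suc_eq_le dest: size_mset_mono)
  define X where "X = (\<Sum>s\<in>#R'. f s) + K"
  have "f s + X = X" if s: "s \<in># R - R'" for s
  proof (rule lower.periodic_eqI[symmetric])
    have M: "add_mset s R' \<subseteq># R"
      using R' s subset_mset.le_diff_conv2[of R' R "{#s#}"] by simp
    then have fM: "\<forall>t\<in>#add_mset s R'. 0 \<in> f t \<and> f t \<subseteq> G" using f set_mset_mono[OF M] by blast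
    show "X \<subseteq> f s + X" using fM by (simp add: set_zero_plus2)
    have "f s + X = (\<Sum>t\<in>#add_mset s R'. f t) + K" by (simp add: X_def add.assoc)
    also have "\<dots> \<subseteq> G"
      using fM by (intro upper.plus_subset upper.sumset_subset lower_subset_upper) blast
    finally show "finite (cosets K (f s + X))" by (rule finite_cosets)
    have "ncosets K (\<Sum>t\<in>#add_mset s R'. f t) \<le> size R' + 1"
      using maximal[of "add_mset s R'"] M by fastforce
    also have "ncosets K (\<Sum>t\<in>#add_mset s R'. f t) = ncosets K (f s + X)"
      using lower.ncosets_plus[of "f s + (\<Sum>s\<in>#R'. f s)"] by (simp add: X_def add.assoc)
    finally show "ncosets K (f s + X) \<le> ncosets K X"
      using R' lower.ncosets_plus by (simp add: X_def)
  qed (simp add: X_def lower.periodic_plus)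
  then show thesis using that R' unfolding X_def by blast
qed

lemma sumset_prune:
  assumes "\<forall>s\<in>#R. 0 \<in> f s \<and> f s \<subseteq> G"
  obtains R' where "R' \<subseteq># R" "size R' + 1 \<le> ncosets K (\<Sum>s\<in>#R. f s)"
    "(\<Sum>s\<in>#R'. f s) + K = (\<Sum>s\<in>#R. f s) + K"
    "\<forall>s\<in>#R - R'. f s + ((\<Sum>s\<in>#R. f s) + K) = (\<Sum>s\<in>#R. f s) + K"
proof -
  obtain R' where R': "R' \<subseteq># R" "size R' + 1 \<le> ncosets K (\<Sum>s\<in>#R'. f s)"
    and stable: "\<forall>s\<in>#R - R'. f s + ((\<Sum>s\<in>#R'. f s) + K) = (\<Sum>s\<in>#R'. f s) + K"
    using sumset_greedy[OF assms] by blast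
  have "R = (R - R') + R'" using R'(1) by simp
  then have "(\<Sum>s\<in>#R. f s) = (\<Sum>s\<in>#R - R'. f s) + (\<Sum>s\<in>#R'. f s)"
    by (metis image_mset_union sum_mset.union)
  then have "(\<Sum>s\<in>#R. f s) + K = (\<Sum>s\<in>#R - R'. f s) + ((\<Sum>s\<in>#R'. f s) + K)"
    by (simp only: add.assoc)
  also have "\<dots> = (\<Sum>s\<in>#R'. f s) + K" by (rule sumset_stable[OF stable])
  finally have "(\<Sum>s\<in>#R. f s) + K = (\<Sum>s\<in>#R'. f s) + K" .
  then show thesis using that R' stable by (metis lower.ncosets_plus)
qed

lemma sumset_plus_subset: "\<forall>s\<in>#R. f s \<subseteq> G \<Longrightarrow> (\<Sum>s\<in>#R. f s) + K \<subseteq> G"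
  by (intro upper.plus_subset upper.sumset_subset lower_subset_upper)

theorem sumset_period:
  assumes f: "\<forall>s\<in>#R. 0 \<in> f s \<and> f s \<subseteq> G"
  obtains L where "intermediate K L G" "((\<Sum>s\<in>#R. f s) + K) + L = (\<Sum>s\<in>#R. f s) + K"
    "size (outside f L R) + 1 \<le> ncosets L ((\<Sum>s\<in>#R. f s) + K)"
proof -
  define Z where "Z = (\<Sum>s\<in>#R. f s) + K"
  define L where "L = stabilizer G Z"
  have L: "intermediate K L G"
    unfolding L_def by (rule intermediate_stabilizer) (simp add: Z_def lower.periodic_plus)
  interpret L: subquotient L G by (rule subquotient_above[OF L])
  have ZL: "Z + L = Z" unfolding L_def by (rule plus_stabilizer)
  have "K + L = L"
    using L lower.zero_mem L.lower.plus_absorb[of K] by (auto simp: intermediate_def)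
  then have Z: "Z = (\<Sum>s\<in>#R. f s) + L" using ZL by (metis Z_def add.assoc)
  obtain R' where R': "R' \<subseteq># R" "size R' + 1 \<le> ncosets L (\<Sum>s\<in>#R. f s)"
    and stable: "\<forall>s\<in>#R - R'. f s + Z = Z"
    using L.sumset_prune[OF f] unfolding Z[symmetric] by metis
  have ZG: "Z \<subseteq> G" unfolding Z_def using f by (intro sumset_plus_subset) blast
  have "f s \<subseteq> L" if s: "s \<in># R - R'" for s
  proof
    fix x assume x: "x \<in> f s"
    have "x +o Z \<subseteq> Z" using stable s set_plus_mono3[OF x, of Z] by metis
    moreover have "(x +o Z) + L = x +o Z" by (simp only: set_plus_rearrange3 ZL)
    ultimately have "x +o Z = Z"
      using L.lower.periodic_eqI L.finite_cosets[OF ZG] ncosets_elt_plus[of L x Z] by simp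
    then show "x \<in> L" using f x in_diffD[OF s] by (auto simp: L_def stabilizer_def)
  qed
  then have "outside f L (R - R') = {#}"
    by (simp only: outside_def filter_mset_eq_mempty_iff) blast
  then have "outside f L R = outside f L R'"
    unfolding outside_def
    by (metis R'(1) add_cancel_right_right filter_union_mset subset_mset.add_diff_inverse)
  then have "size (outside f L R) \<le> size R'" using size_mset_mono[OF outside_subset] by simp
  moreover have "ncosets L Z = ncosets L (\<Sum>s\<in>#R. f s)" using L.lower.ncosets_plus Z by metis
  ultimately have "size (outside f L R) + 1 \<le> ncosets L Z" using R'(2) by simp
  then show thesis using that L ZL unfolding Z_def by blast
qed

theorem sumset_full:
  assumes f: "\<forall>s\<in>#R. 0 \<in> f s \<and> f s \<subseteq> G"
    and outside: "\<And>L. intermediate K L G \<Longrightarrow> L \<noteq> G \<Longrightarrow> ncosets L G \<le> size (outside f L R) + 1"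
  shows "(\<Sum>s\<in>#R. f s) + K = G"
proof -
  define Z where "Z = (\<Sum>s\<in>#R. f s) + K"
  obtain L where L: "intermediate K L G" and ZL: "Z + L = Z"
    and size: "size (outside f L R) + 1 \<le> ncosets L Z"
    unfolding Z_def by (rule sumset_period[OF f])
  interpret L: subquotient L G by (rule subquotient_above[OF L])
  have ZG: "Z \<subseteq> G" unfolding Z_def using f by (intro sumset_plus_subset) blast
  show ?thesis
  proof (cases "L = G")
    case True
    have "0 \<in> Z" using zero_mem_sumset[of R f] f lower.subset_plus by (auto simp: Z_def)
    then have "Z + G = G" using ZG upper.plus_absorb by blast
    then show ?thesis using True ZL Z_def by simp
  next
    case False
    then have "ncosets L G \<le> ncosets L Z" using outside[OF L] size by linarith
    then have "Z = G" using L.lower.periodic_eqI ZG ZL L.finite_quotient by blast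
    then show ?thesis by (simp add: Z_def)
  qed
qed

theorem subsums_full:
  assumes f: "\<forall>s\<in>#R. f s \<subseteq> G"
    and outside: "\<And>L. intermediate K L G \<Longrightarrow> L \<noteq> G \<Longrightarrow> ncosets L G \<le> size (outside f L R) + 1"
  obtains R' where "R' \<subseteq># outside f K R" "size R' + 1 \<le> ncosets K G" "subsums f R' + K = G"
proof -
  let ?R = "outside f K R" and ?f = "\<lambda>s. insert 0 (f s)"
  have f': "\<forall>s\<in>#?R. 0 \<in> ?f s \<and> ?f s \<subseteq> G" using f upper.zero_mem by (auto simp: outside_def)
  have full: "(\<Sum>s\<in>#?R. ?f s) + K = G"
  proof (rule sumset_full[OF f'])
    fix L assume L: "intermediate K L G" "L \<noteq> G"
    then have "0 \<in> L" "K \<subseteq> L" by (auto simp: intermediate_def add_subgroup.zero_mem)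
    then have "outside ?f L ?R = outside f L R"
      using outside_outside[of K L f R] by (simp add: outside_def)
    then show "ncosets L G \<le> size (outside ?f L ?R) + 1" using outside[OF L] by simp
  qed
  then show thesis
    using sumset_prune[OF f'] that lower.ncosets_plus unfolding subsums_def by metis
qed

lemma minimal_absorbing_subgroup:
  assumes f: "\<forall>s\<in>#S. f s \<subseteq> G"
  obtains M where "intermediate K M G" "size (outside f M S) \<le> ncosets M G - 2"
    "\<And>L. intermediate K L M \<Longrightarrow> L \<noteq> M \<Longrightarrow> ncosets L M \<le> size (outside f L (inside f M S)) + 1"
proof -
  let ?P = "\<lambda>M. intermediate K M G \<and> size (outside f M S) \<le> ncosets M G - 2"
  have "outside f G S = {#}" using f by (simp add: outside_def)
  then have "?P G" using intermediate_upper by simp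
  then obtain M where M: "?P M" and minimal: "\<And>L. ?P L \<Longrightarrow> ncosets K M \<le> ncosets K L"
    using ex_has_least_nat[of ?P G "ncosets K"] by blast
  have "ncosets L M \<le> size (outside f L (inside f M S)) + 1" if L: "intermediate K L M" "L \<noteq> M"
    for L
  proof -
    interpret KM: subquotient K M using M subquotient_below by blast
    interpret LM: subquotient L M by (rule KM.subquotient_above[OF L(1)])
    have LG: "intermediate K L G" "intermediate L M G" using L M by (auto simp: intermediate_def)
    interpret LG: subquotient L G by (rule subquotient_above[OF LG(1)])
    interpret MG: subquotient M G by (rule LG.subquotient_above[OF LG(2)])
    have "\<not> ?P L" using minimal[of L] KM.index_strict_mono[OF L] by linarith
    then have "ncosets L G - 2 < size (outside f M S) + size (outside f L (inside f M S))"
      using LG L(1) outside_split[of L M f S] by (auto simp: intermediate_def)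
    moreover have "ncosets L M + ncosets M G \<le> ncosets L G + 1" by (rule LG.index_add_le[OF LG(2)])
    moreover have "ncosets L G = ncosets L M * ncosets M G" by (rule LG.index_tower[OF LG(2)])
    moreover have "2 \<le> ncosets L M" by (rule LM.index_ge_2[OF L(2)])
    ultimately show ?thesis using M MG.index_pos by (cases "ncosets M G = 1") auto
  qed
  then show thesis using that M by blast
qed

end

subsection \<open>Families of sets that are not contained in cosets\<close>

definition in_coset :: "'v::ab_group_add set \<Rightarrow> 'v set \<Rightarrow> bool" where
  "in_coset L B \<longleftrightarrow> (\<exists>x. B \<subseteq> x +o L)"

lemma elt_plus_subset_swap: "(- x) +o X \<subseteq> Y \<longleftrightarrow> X \<subseteq> x +o Y" for x :: "'v::ab_group_add"
proof -
  have "x +o ((- x) +o X) = X" "(- x) +o (x +o Y) = Y" by (simp_all add: set_plus_rearrange2)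
  then show ?thesis using set_plus_mono[of "(- x) +o X" Y x] set_plus_mono[of X "x +o Y" "- x"]
    by auto
qed

lemma (in add_subgroup) in_coset_iff:
  assumes "x \<in> B"
  shows "in_coset K B \<longleftrightarrow> (- x) +o B \<subseteq> K"
proof
  assume "in_coset K B"
  then obtain y where y: "B \<subseteq> y +o K" by (auto simp: in_coset_def)
  then have "x - y \<in> K" using assms by (auto simp: set_minus_plus)
  then show "(- x) +o B \<subseteq> K" using y by (simp add: elt_plus_subset_swap flip: coset_eq_iff)
qed (auto simp: in_coset_def elt_plus_subset_swap)

lemma (in add_subgroup) in_coset_subset:
  "in_coset K B \<Longrightarrow> x \<in> B \<Longrightarrow> B \<subseteq> x +o K"
  by (simp add: in_coset_iff flip: elt_plus_subset_swap)

lemma in_coset_elt_plus: "in_coset L (x +o B) \<longleftrightarrow> in_coset L B"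
proof -
  have shift: "in_coset L (x +o B)" if "in_coset L B" for x B
    using that unfolding in_coset_def by (metis set_plus_mono set_plus_rearrange2)
  have "(- x) +o (x +o B) = B" by (simp add: set_plus_rearrange2)
  then show ?thesis using shift[of B x] shift[of "x +o B" "- x"] by metis
qed

lemma recentre:
  assumes "\<forall>s\<in>#R. f s \<noteq> ({} :: 'v::ab_group_add set)"
  obtains c where "\<forall>s\<in>#R. 0 \<in> (- c s) +o f s"
    "\<forall>s\<in>#R. \<forall>L. add_subgroup L \<longrightarrow> in_coset L (f s) \<longleftrightarrow> (- c s) +o f s \<subseteq> L"
    "(\<Sum>s\<in>#R. f s) = (\<Sum>s\<in>#R. c s) +o (\<Sum>s\<in>#R. (- c s) +o f s)"
proof -
  have "\<forall>s\<in>#R. \<exists>x. x \<in> f s" using assms by blast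
  from bchoice[OF this] obtain c where c: "\<forall>s\<in>#R. c s \<in> f s" by blast
  have "(\<Sum>s\<in>#R. f s) = (\<Sum>s\<in>#R. c s +o ((- c s) +o f s))" by (simp add: set_plus_rearrange2)
  then have "(\<Sum>s\<in>#R. f s) = (\<Sum>s\<in>#R. c s) +o (\<Sum>s\<in>#R. (- c s) +o f s)" by (simp only: sumset_elt_plus)
  moreover have "\<forall>s\<in>#R. 0 \<in> (- c s) +o f s" using c by (simp flip: set_minus_plus)
  ultimately show thesis using that c add_subgroup.in_coset_iff by blast
qed

context subquotient
begin

theorem ncosets_sumset_crossing:
  assumes f: "\<forall>t\<in>#T. f t \<noteq> {} \<and> in_coset G (f t) \<and> \<not> in_coset K (f t)"
    and few: "\<And>L. intermediate K L G \<Longrightarrow> L \<noteq> K \<Longrightarrow>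
      size {#t \<in># T. in_coset L (f t)#} + 2 \<le> ncosets K L"
  shows "size T + 1 \<le> ncosets K (\<Sum>t\<in>#T. f t)"
proof -
  have nonempty: "\<forall>t\<in>#T. f t \<noteq> {}" using f by blast
  obtain c where zero: "\<forall>t\<in>#T. 0 \<in> (- c t) +o f t"
    and coset: "\<forall>t\<in>#T. \<forall>L. add_subgroup L \<longrightarrow> in_coset L (f t) \<longleftrightarrow> (- c t) +o f t \<subseteq> L"
    and sum: "(\<Sum>t\<in>#T. f t) = (\<Sum>t\<in>#T. c t) +o (\<Sum>t\<in>#T. (- c t) +o f t)"
    by (rule recentre[OF nonempty])
  let ?f = "\<lambda>t. (- c t) +o f t"
  have f': "\<forall>t\<in>#T. 0 \<in> ?f t \<and> ?f t \<subseteq> G" using zero coset f upper.add_subgroup_axioms by blast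
  define Z where "Z = (\<Sum>t\<in>#T. ?f t) + K"
  obtain L where L: "intermediate K L G" and ZL: "Z + L = Z"
    and size: "size (outside ?f L T) + 1 \<le> ncosets L Z"
    unfolding Z_def by (rule sumset_period[OF f'])
  have "Z \<subseteq> G" unfolding Z_def using f' by (intro sumset_plus_subset) blast
  then have "ncosets K Z = ncosets K L * ncosets L Z" by (rule ncosets_tower[OF L ZL])
  moreover have "ncosets K (\<Sum>t\<in>#T. f t) = ncosets K Z"
    by (simp add: sum ncosets_elt_plus Z_def lower.ncosets_plus)
  ultimately have bound: "ncosets K L * (size (outside ?f L T) + 1) \<le> ncosets K (\<Sum>t\<in>#T. f t)"
    using size by (metis mult_le_mono2)
  have inside: "inside ?f L T = {#t \<in># T. in_coset L (f t)#}"
    using coset L by (auto simp: inside_def intermediate_def intro!: filter_mset_cong)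
  note split = size_outside_inside[of ?f L T]
  show ?thesis
  proof (cases "L = K")
    case True
    then have "inside ?f L T = {#}" using f unfolding inside by simp
    then show ?thesis using bound split True lower.ncosets_self by simp
  next
    case False
    then have "size (inside ?f L T) + 2 \<le> ncosets K L" using few[OF L] unfolding inside by blast
    then obtain d where d: "ncosets K L = size (inside ?f L T) + 2 + d" using le_Suc_ex by blast
    show ?thesis using bound split unfolding d by (simp add: algebra_simps)
  qed
qed

lemma minimal_crossing_subgroup:
  assumes "intermediate K M G" "M \<noteq> K"
    and "ncosets K M \<le> size {#t \<in># S. \<not> in_coset K (f t) \<and> in_coset M (f t)#} + 1"
  obtains L where "intermediate K L G" "L \<noteq> K"
    "ncosets K L \<le> size {#t \<in># S. \<not> in_coset K (f t) \<and> in_coset L (f t)#} + 1"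
    "\<And>N. \<lbrakk>intermediate K N L; N \<noteq> L; N \<noteq> K\<rbrakk> \<Longrightarrow>
      size {#t \<in># S. \<not> in_coset K (f t) \<and> in_coset N (f t)#} + 1 < ncosets K N"
proof -
  let ?F = "\<lambda>L. {#t \<in># S. \<not> in_coset K (f t) \<and> in_coset L (f t)#}"
  let ?P = "\<lambda>L. intermediate K L G \<and> L \<noteq> K \<and> ncosets K L \<le> size (?F L) + 1"
  obtain L where L: "?P L" and minimal: "\<And>N. ?P N \<Longrightarrow> ncosets K L \<le> ncosets K N"
    using ex_has_least_nat[of ?P M "ncosets K"] assms by blast
  interpret KL: subquotient K L using L subquotient_below by blast
  have "size (?F N) + 1 < ncosets K N" if N: "intermediate K N L" "N \<noteq> L" "N \<noteq> K" for N
  proof -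
    have "intermediate K N G" using N L by (auto simp: intermediate_def)
    then show ?thesis using minimal[of N] N(3) KL.index_strict_mono[OF N(1,2)] by linarith
  qed
  then show thesis using that L by blast
qed

theorem crossing_sets_fill_coset:
  assumes nonempty: "\<forall>t\<in>#S. f t \<noteq> {}" and M: "intermediate K M G" "M \<noteq> K"
    "ncosets K M \<le> size {#t \<in># S. \<not> in_coset K (f t) \<and> in_coset M (f t)#} + 1"
  obtains L Z z where "intermediate K L G" "L \<noteq> K" "Z \<subseteq># S" "size Z + 1 = ncosets K L"
    "(\<Sum>t\<in>#Z. f t) + K = z +o L"
proof -
  let ?F = "\<lambda>L. {#t \<in># S. \<not> in_coset K (f t) \<and> in_coset L (f t)#}"
  obtain L where L: "intermediate K L G" "L \<noteq> K" and many: "ncosets K L \<le> size (?F L) + 1"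
    and minimal: "\<And>N. \<lbrakk>intermediate K N L; N \<noteq> L; N \<noteq> K\<rbrakk> \<Longrightarrow> size (?F N) + 1 < ncosets K N"
    using minimal_crossing_subgroup[OF M] by blast
  interpret KL: subquotient K L by (rule subquotient_below[OF L(1)])
  obtain Z where ZF: "Z \<subseteq># ?F L" and size_Z: "size Z = ncosets K L - 1"
    using submultiset_of_size[OF many[folded le_diff_conv]] by blast
  have ZS: "Z \<subseteq># S" using ZF by (rule subset_mset.order_trans) simp
  have Z: "f t \<noteq> {} \<and> \<not> in_coset K (f t) \<and> in_coset L (f t)" if "t \<in># Z" for t
    using mset_subset_eqD[OF ZF that] nonempty by simp
  then have Z_nonempty: "\<forall>t\<in>#Z. f t \<noteq> {}" by blast
  obtain c where zero: "\<forall>t\<in>#Z. 0 \<in> (- c t) +o f t"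
    and coset: "\<forall>t\<in>#Z. \<forall>L. add_subgroup L \<longrightarrow> in_coset L (f t) \<longleftrightarrow> (- c t) +o f t \<subseteq> L"
    and sum: "(\<Sum>t\<in>#Z. f t) = (\<Sum>t\<in>#Z. c t) +o (\<Sum>t\<in>#Z. (- c t) +o f t)"
    by (rule recentre[OF Z_nonempty])
  let ?f = "\<lambda>t. (- c t) +o f t"
  have "(\<Sum>t\<in>#Z. ?f t) + K = L"
  proof (rule KL.sumset_full)
    show "\<forall>t\<in>#Z. 0 \<in> ?f t \<and> ?f t \<subseteq> L" using zero coset Z KL.upper.add_subgroup_axioms by blast
    fix N assume N: "intermediate K N L" "N \<noteq> L"
    then have inside: "inside ?f N Z = {#t \<in># Z. \<not> in_coset K (f t) \<and> in_coset N (f t)#}"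
      using coset Z by (auto simp: inside_def intermediate_def intro!: filter_mset_cong)
    note split = size_outside_inside[of ?f N Z]
    show "ncosets N L \<le> size (outside ?f N Z) + 1"
    proof (cases "N = K")
      case True
      then have "size (inside ?f N Z) = 0" unfolding inside by simp
      then show ?thesis using split size_Z True by simp
    next
      case False
      have "size (inside ?f N Z) \<le> size (?F N)"
        unfolding inside by (intro size_mset_mono multiset_filter_mono ZS)
      then show ?thesis using minimal[OF N False] KL.index_add_le[OF N(1)] split size_Z by linarith
    qed
  qed
  then have "(\<Sum>t\<in>#Z. f t) + K = (\<Sum>t\<in>#Z. c t) +o L" by (simp add: sum set_plus_rearrange3)
  then show thesis using that[OF L ZS] size_Z KL.index_pos by simp
qed

end

subsection \<open>The Scherk--Kemperman inequality\<close>

definition dyson_left :: "'v::ab_group_add \<Rightarrow> 'v set \<Rightarrow> 'v set \<Rightarrow> 'v set" where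
  "dyson_left e X Y = X \<union> (e +o Y)"

definition dyson_right :: "'v::ab_group_add \<Rightarrow> 'v set \<Rightarrow> 'v set \<Rightarrow> 'v set" where
  "dyson_right e X Y = Y \<inter> ((- e) +o X)"

lemma mem_dyson_right_iff: "y \<in> dyson_right e X Y \<longleftrightarrow> y \<in> Y \<and> e + y \<in> X"
  by (simp add: dyson_right_def add.commute flip: set_minus_plus)

lemma elt_plus_dyson_right: "e +o dyson_right e X Y = (e +o Y) \<inter> X"
  by (auto simp: mem_dyson_right_iff simp flip: set_minus_plus)

lemma dyson_sum_subset: "dyson_left e X Y + dyson_right e X Y \<subseteq> X + Y"
proof
  fix z assume "z \<in> dyson_left e X Y + dyson_right e X Y"
  then obtain x y where z: "z = x + y" "x \<in> dyson_left e X Y" "y \<in> dyson_right e X Y"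
    by (rule set_plus_elim)
  then consider "x \<in> X" "y \<in> Y" | "e + y \<in> X" "x - e \<in> Y"
    by (auto simp: dyson_left_def mem_dyson_right_iff set_minus_plus)
  then show "z \<in> X + Y"
  proof cases
    case 2
    then have "(e + y) + (x - e) \<in> X + Y" by (rule set_plus_intro)
    then show ?thesis using z by (simp add: add.commute)
  qed (simp add: z set_plus_intro)
qed

context subquotient
begin

definition periodic_with_zero :: "'v set \<Rightarrow> bool" where
  "periodic_with_zero X \<longleftrightarrow> X + K = X \<and> X \<subseteq> G \<and> 0 \<in> X"

definition zero_sums_trivial :: "'v set \<Rightarrow> 'v set \<Rightarrow> bool" where
  "zero_sums_trivial X Y \<longleftrightarrow> (\<forall>x\<in>X. \<forall>y\<in>Y. x + y \<in> K \<longrightarrow> y \<in> K)"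

lemma ncosets_Un_Int:
  assumes "X \<subseteq> G" and "Y + K = Y" "Y \<subseteq> G"
  shows "ncosets K (X \<union> Y) + ncosets K (X \<inter> Y) = ncosets K X + ncosets K Y"
proof -
  have "cosets K (X \<inter> Y) = cosets K X \<inter> cosets K Y"
  proof
    show "cosets K X \<inter> cosets K Y \<subseteq> cosets K (X \<inter> Y)"
    proof
      fix C assume "C \<in> cosets K X \<inter> cosets K Y"
      then obtain x y where xy: "x \<in> X" "y \<in> Y" "C = x +o K" "x +o K = y +o K"
        by (auto simp: cosets_def)
      then have "x \<in> Y" using lower.periodic_mem[OF assms(2) xy(2)] lower.coset_eq_iff by blast
      then show "C \<in> cosets K (X \<inter> Y)" using xy by (auto simp: cosets_def)
    qed
  qed (auto simp: cosets_def)
  moreover have "cosets K (X \<union> Y) = cosets K X \<union> cosets K Y" by (simp add: cosets_def image_Un)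
  ultimately show ?thesis
    using card_Un_Int[OF finite_cosets[OF assms(1)] finite_cosets[OF assms(3)]]
    by (simp add: ncosets_def)
qed

lemma dyson_periodic_with_zero:
  assumes X: "periodic_with_zero X" and Y: "periodic_with_zero Y" and e: "e \<in> X"
  shows "periodic_with_zero (dyson_left e X Y)" "periodic_with_zero (dyson_right e X Y)"
proof -
  have "e \<in> G" using X e by (auto simp: periodic_with_zero_def)
  then have "e +o Y \<subseteq> G" using Y upper.elt_plus_subset_iff by (simp add: periodic_with_zero_def)
  moreover have "(e +o Y) + K = e +o Y"
    using Y by (simp add: periodic_with_zero_def set_plus_rearrange3)
  ultimately show "periodic_with_zero (dyson_left e X Y)"
    using X by (simp add: periodic_with_zero_def dyson_left_def Un_set_plus)
  have "dyson_right e X Y + K \<subseteq> dyson_right e X Y"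
  proof
    fix z assume "z \<in> dyson_right e X Y + K"
    then obtain y where y: "y \<in> dyson_right e X Y" "z - y \<in> K" by (auto simp: mem_set_plus_iff)
    then have "z \<in> Y" "e + z \<in> X"
      using X Y lower.periodic_mem[of Y y z] lower.periodic_mem[of X "e + y" "e + z"]
      by (simp_all add: periodic_with_zero_def mem_dyson_right_iff)
    then show "z \<in> dyson_right e X Y" by (simp add: mem_dyson_right_iff)
  qed
  then show "periodic_with_zero (dyson_right e X Y)"
    using Y e lower.subset_plus[of "dyson_right e X Y"]
    by (auto simp: periodic_with_zero_def mem_dyson_right_iff)
qed

lemma dyson_zero_sums_trivial:
  assumes triv: "zero_sums_trivial X Y" and e: "e \<in> X"
  shows "zero_sums_trivial (dyson_left e X Y) (dyson_right e X Y)"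
  unfolding zero_sums_trivial_def
proof (intro ballI impI)
  fix x y assume x: "x \<in> dyson_left e X Y" and y: "y \<in> dyson_right e X Y" and xy: "x + y \<in> K"
  have y': "y \<in> Y" "e + y \<in> X" using y by (simp_all add: mem_dyson_right_iff)
  show "y \<in> K"
  proof (cases "x \<in> X")
    case True
    then show ?thesis using triv y'(1) xy by (auto simp: zero_sums_trivial_def)
  next
    case False
    then have "x - e \<in> Y" using x by (auto simp: dyson_left_def set_minus_plus)
    moreover have "(e + y) + (x - e) \<in> K" using xy by (simp add: add.commute)
    ultimately have "x - e \<in> K" using triv y'(2) unfolding zero_sums_trivial_def by blast
    then have "(x + y) - (x - e) \<in> K" by (rule lower.diff_mem[OF xy])
    then have "e + y \<in> K" by (simp add: add.commute)
    then show ?thesis using triv e y'(1) by (auto simp: zero_sums_trivial_def)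
  qed
qed

lemma ncosets_dyson:
  assumes "periodic_with_zero X" "periodic_with_zero Y" "e \<in> X"
  shows "ncosets K (dyson_left e X Y) + ncosets K (dyson_right e X Y) = ncosets K X + ncosets K Y"
proof -
  have "e \<in> G" "Y \<subseteq> G" using assms by (auto simp: periodic_with_zero_def)
  then have "e +o Y \<subseteq> G" by (simp add: upper.elt_plus_subset_iff)
  moreover have "X + K = X" "X \<subseteq> G" using assms by (simp_all add: periodic_with_zero_def)
  ultimately have
    "ncosets K ((e +o Y) \<union> X) + ncosets K ((e +o Y) \<inter> X) = ncosets K (e +o Y) + ncosets K X"
    by (intro ncosets_Un_Int)
  then show ?thesis
    unfolding dyson_left_def using ncosets_elt_plus[of K e] elt_plus_dyson_right[of e X Y]
    by (metis Un_commute add.commute)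
qed

lemma zero_sums_trivial_absorbed:
  assumes X: "periodic_with_zero X" and absorbed: "\<forall>e\<in>X. e +o Y \<subseteq> X"
    and triv: "zero_sums_trivial X Y"
  shows "Y \<subseteq> K"
proof
  fix y assume y: "y \<in> Y"
  have "y +o X \<subseteq> X"
  proof
    fix z assume "z \<in> y +o X"
    then obtain e where "e \<in> X" "z = e + y" by (auto simp: elt_set_plus_def add.commute)
    then show "z \<in> X" using absorbed set_plus_intro2[OF y, of e] by blast
  qed
  moreover have "(y +o X) + K = y +o X"
    using X by (simp add: periodic_with_zero_def set_plus_rearrange3)
  ultimately have "y +o X = X"
    using X finite_cosets lower.periodic_eqI[of "y +o X" X] ncosets_elt_plus[of K y X]
    by (simp add: periodic_with_zero_def)
  then have "0 \<in> y +o X" using X by (simp add: periodic_with_zero_def)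
  then have "- y \<in> X" by (simp flip: set_minus_plus)
  then show "y \<in> K" using triv y lower.zero_mem by (force simp: zero_sums_trivial_def)
qed

theorem scherk_kemperman:
  assumes "periodic_with_zero X" "periodic_with_zero Y" "zero_sums_trivial X Y"
  shows "ncosets K X + ncosets K Y \<le> ncosets K (X + Y) + 1"
  using assms
proof (induction "ncosets K Y" arbitrary: X Y rule: less_induct)
  case less
  then have X: "X + K = X" "X \<subseteq> G" and Y: "Y + K = Y" "Y \<subseteq> G" "0 \<in> Y"
    by (simp_all add: periodic_with_zero_def)
  show ?case
  proof (cases "\<forall>e\<in>X. e +o Y \<subseteq> X")
    case True
    then have "Y \<subseteq> K" using zero_sums_trivial_absorbed less.prems by blast
    then have "Y = K" using Y lower.plus_absorb[of Y] by auto
    then show ?thesis using X(1) lower.ncosets_self by simp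
  next
    case False
    then obtain e where e: "e \<in> X" "\<not> e +o Y \<subseteq> X" by blast
    let ?X = "dyson_left e X Y" and ?Y = "dyson_right e X Y"
    note dyson = dyson_periodic_with_zero[OF less.prems(1,2) e(1)]
    have "?Y \<subseteq> Y" by (simp add: dyson_right_def)
    moreover have "?Y \<noteq> Y" using e(2) elt_plus_dyson_right[of e X Y] by auto
    ultimately have "ncosets K ?Y < ncosets K Y"
      using lower.periodic_eqI[of ?Y Y] dyson(2) finite_cosets[OF Y(2)]
      by (metis not_le periodic_with_zero_def)
    then have "ncosets K ?X + ncosets K ?Y \<le> ncosets K (?X + ?Y) + 1"
      using less.hyps dyson dyson_zero_sums_trivial[OF less.prems(3) e(1)] by blast
    also have "ncosets K (?X + ?Y) \<le> ncosets K (X + Y)"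
      by (intro ncosets_mono dyson_sum_subset upper.plus_subset X Y)
    finally show ?thesis using ncosets_dyson[OF less.prems(1,2) e(1)] by simp
  qed
qed

lemma ncosets_insert_zero_transversal:
  assumes "inj_on (\<lambda>x. x +o K) P" "P \<subseteq> G - K" "finite P"
  shows "ncosets K (insert 0 P) = card P + 1"
proof -
  have "0 +o K \<noteq> x +o K" if "x \<in> P" for x
    using that assms(2) lower.coset_eq_iff[of x 0] by auto
  then have "inj_on (\<lambda>x. x +o K) (insert 0 P)" using assms(1) by (auto simp: inj_on_insert)
  moreover have "0 \<notin> P" using assms(2) lower.zero_mem by auto
  ultimately show ?thesis
    using assms(3) card_image[of "\<lambda>x. x +o K" "insert 0 P"] by (simp add: ncosets_def cosets_def)
qed

lemma plus_transversal:
  assumes D: "periodic_with_zero D"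
    and P: "inj_on (\<lambda>x. x +o K) P" "P \<subseteq> G - K" "finite P"
    and free: "\<forall>d\<in>D. \<forall>p\<in>P. d + p \<notin> K"
  shows "periodic_with_zero (D + insert 0 P)"
    and "ncosets K D + card P \<le> ncosets K (D + insert 0 P)"
proof -
  define Y where "Y = insert 0 P + K"
  have "D + Y = (D + K) + insert 0 P" by (simp only: Y_def ac_simps)
  then have DY: "D + Y = D + insert 0 P" using D by (simp add: periodic_with_zero_def)
  have "insert 0 P \<subseteq> G" using P(2) upper.zero_mem by blast
  then have Y: "periodic_with_zero Y"
    using lower.subset_plus[of "insert 0 P"] upper.plus_subset lower_subset_upper
      lower.periodic_plus
    by (simp add: periodic_with_zero_def Y_def)
  have "0 + 0 \<in> D + Y" using D Y unfolding periodic_with_zero_def by (intro set_plus_intro) blast+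
  then show "periodic_with_zero (D + insert 0 P)"
    using D Y upper.plus_subset unfolding DY[symmetric]
    by (simp add: periodic_with_zero_def add.assoc)
  have "zero_sums_trivial D Y"
    unfolding zero_sums_trivial_def
  proof (intro ballI impI)
    fix d y assume d: "d \<in> D" "d + y \<in> K" and "y \<in> Y"
    then obtain c where c: "c \<in> insert 0 P" "y - c \<in> K" unfolding Y_def mem_set_plus_iff by blast
    have "d + c \<in> K" using lower.diff_mem[OF d(2) c(2)] by simp
    then have "c = 0" using c(1) d(1) free by blast
    then show "y \<in> K" using c(2) by simp
  qed
  then have "ncosets K D + ncosets K Y \<le> ncosets K (D + Y) + 1" by (rule scherk_kemperman[OF D Y])
  then show "ncosets K D + card P \<le> ncosets K (D + insert 0 P)"
    using ncosets_insert_zero_transversal[OF P]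
    by (simp add: DY) (simp add: Y_def lower.ncosets_plus)
qed

end

context add_subgroup
begin

lemma multiset_transversal:
  obtains P M' where "M = mset_set P + M'" "finite P" "inj_on (\<lambda>x. x +o K) P"
    "cosets K P = cosets K (set_mset M)"
proof -
  obtain P where P: "P \<subseteq> set_mset M" "inj_on (\<lambda>x. x +o K) P" "cosets K P = cosets K (set_mset M)"
    by (rule coset_representatives)
  have "mset_set P \<subseteq># M"
    using subset_imp_msubset_mset_set[OF P(1)] mset_set_set_mset_msubset[of M]
    by (simp add: subset_mset.order_trans)
  then have "M = mset_set P + (M - mset_set P)" by simp
  moreover have "finite P" using P(1) finite_subset by blast
  ultimately show thesis using that P(2,3) by blast
qed

lemma multiplicity_minus_transversal:
  assumes M: "M = mset_set P + M'" "finite P" "cosets K P = cosets K (set_mset M)"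
    and "size {#y \<in># M. y - x \<in> K#} \<le> Suc h"
  shows "size {#y \<in># M'. y - x \<in> K#} \<le> h"
proof (cases "\<exists>y\<in>#M. y - x \<in> K")
  case True
  then obtain y where y: "y \<in># M" "y - x \<in> K" by blast
  then have "y +o K \<in> cosets K P" unfolding M(3) by (simp add: cosets_def)
  then obtain p where p: "p \<in> P" "p - y \<in> K"
    by (auto simp: cosets_def coset_eq_iff diff_mem_commute)
  have "p - x \<in> K" using diff_mem_trans[OF p(2) y(2)] .
  then have "card {y \<in> P. y - x \<in> K} \<noteq> 0" using p(1) M(2) by auto
  then have "1 \<le> size {#y \<in># mset_set P. y - x \<in> K#}"
    using M(2) by (simp only: filter_mset_mset_set size_mset_set)
  then show ?thesis using assms(4) by (simp add: M(1))
next
  case False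
  then have "{#y \<in># M'. y - x \<in> K#} = {#}" by (simp add: M(1))
  then show ?thesis by (simp only: size_empty zero_le)
qed

end

text \<open>A full set of representatives of the classes in \<open>M\<close> enlarges \<open>D\<close> by its own size, or else
  one of its elements cancels an element of \<open>D\<close>.\<close>

theorem (in subquotient) short_zero_sum:
  assumes "\<forall>x\<in>#M. x \<in> G - K" "\<And>x. size {#y \<in># M. y - x \<in> K#} \<le> h"
    and "periodic_with_zero D" "ncosets K G < size M + ncosets K D"
  shows "\<exists>N d. N \<subseteq># M \<and> N \<noteq> {#} \<and> size N \<le> h \<and> d \<in> D \<and> d + \<Sum>\<^sub># N \<in> K"
  using assms
proof (induction h arbitrary: M D)
  case 0
  have "x \<notin># M" for x using 0(2)[of x] lower.zero_mem by (auto simp: filter_mset_eq_mempty_iff)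
  then have "M = {#}" by (simp add: multiset_eqI not_in_iff)
  then show ?case using 0(3,4) ncosets_mono[of D G] by (simp add: periodic_with_zero_def)
next
  case (Suc h)
  obtain P M' where M: "M = mset_set P + M'" and P: "finite P" "inj_on (\<lambda>x. x +o K) P"
    and cosets: "cosets K P = cosets K (set_mset M)"
    by (rule lower.multiset_transversal)
  show ?case
  proof (cases "\<exists>d\<in>D. \<exists>p\<in>P. d + p \<in> K")
    case True
    then obtain d p where "d \<in> D" "p \<in> P" "d + p \<in> K" by blast
    then show ?thesis using P(1) by (intro exI[of _ "{#p#}"] exI[of _ d]) (auto simp: M)
  next
    case False
    then have free: "\<forall>d\<in>D. \<forall>p\<in>P. d + p \<notin> K" by blast
    have "P \<subseteq> G - K" using Suc.prems(1) P(1) by (auto simp: M)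
    note D = plus_transversal[OF Suc.prems(3) P(2) this P(1) free]
    have "\<exists>N d. N \<subseteq># M' \<and> N \<noteq> {#} \<and> size N \<le> h \<and> d \<in> D + insert 0 P \<and> d + \<Sum>\<^sub># N \<in> K"
    proof (rule Suc.IH[OF _ _ D(1)])
      show "\<forall>x\<in>#M'. x \<in> G - K" using Suc.prems(1) by (simp add: M)
      show "size {#y \<in># M'. y - x \<in> K#} \<le> h" for x
        by (rule lower.multiplicity_minus_transversal[OF M P(1) cosets Suc.prems(2)])
      show "ncosets K G < size M' + ncosets K (D + insert 0 P)"
        using D(2) Suc.prems(4) by (simp add: M)
    qed
    then obtain N d c where N: "N \<subseteq># M'" "N \<noteq> {#}" "size N \<le> h"
      and dc: "d \<in> D" "c \<in> insert 0 P" "d + c + \<Sum>\<^sub># N \<in> K"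
      by (metis set_plus_elim)
    define C where "C = (if c = 0 then {#} else {#c#})"
    have "C + N \<subseteq># M" unfolding M C_def using dc(2) P(1) N(1) by (intro subset_mset.add_mono) auto
    moreover have "C + N \<noteq> {#}" "size (C + N) \<le> Suc h" using N by (simp_all add: C_def)
    moreover have "d + \<Sum>\<^sub># (C + N) \<in> K" using dc(3)
      by (cases "c = 0") (simp_all add: C_def add.assoc)
    ultimately show ?thesis using dc(1) by blast
  qed
qed

subsection \<open>Sums of prescribed length\<close>

definition sums_of_length :: "('i \<Rightarrow> 'v::ab_group_add set) \<Rightarrow> nat \<Rightarrow> 'i multiset \<Rightarrow> 'v set" where
  "sums_of_length f n S = (\<Union>T\<in>{T. T \<subseteq># S \<and> size T = n}. \<Sum>s\<in>#T. f s)"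

lemma mem_sums_of_length_iff:
  "x \<in> sums_of_length f n S \<longleftrightarrow> (\<exists>T. T \<subseteq># S \<and> size T = n \<and> x \<in> (\<Sum>s\<in>#T. f s))"
  by (auto simp: sums_of_length_def)

definition zero_sum_bound ::
    "'v::ab_group_add set \<Rightarrow> ('i \<Rightarrow> 'v set) \<Rightarrow> 'i set \<Rightarrow> nat \<Rightarrow> bool" where
  "zero_sum_bound K f I d \<longleftrightarrow>
     (\<forall>T. set_mset T \<subseteq> I \<and> size T = d \<longrightarrow> (\<exists>Z. Z \<subseteq># T \<and> Z \<noteq> {#} \<and> (\<Sum>s\<in>#Z. f s) \<inter> K \<noteq> {}))"

lemma zero_sum_boundE:
  assumes "zero_sum_bound K f I d" "set_mset T \<subseteq> I" "d \<le> size T"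
  obtains Z z where "Z \<subseteq># T" "Z \<noteq> {#}" "z \<in> (\<Sum>s\<in>#Z. f s)" "z \<in> K"
proof -
  obtain U where U: "U \<subseteq># T" "size U = d" by (rule submultiset_of_size[OF assms(3)])
  then have "set_mset U \<subseteq> I" using assms(2) set_mset_mono by blast
  then obtain Z where "Z \<subseteq># U" "Z \<noteq> {#}" "(\<Sum>s\<in>#Z. f s) \<inter> K \<noteq> {}"
    using assms(1) U(2) unfolding zero_sum_bound_def by blast
  then show thesis using that U(1) subset_mset.order_trans by blast
qed

lemma zero_sum_bound_subset: "zero_sum_bound K f I d \<Longrightarrow> J \<subseteq> I \<Longrightarrow> zero_sum_bound K f J d"
  unfolding zero_sum_bound_def by blast

lemma submultiset_plusE:
  assumes "U \<subseteq># R + S"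
  obtains T V where "U = T + V" "T \<subseteq># R" "V \<subseteq># S"
proof (rule that[of "U \<inter># R" "U - R"])
  show "U = U \<inter># R + (U - R)" by (auto simp: multiset_eq_iff min_def)
  show "U - R \<subseteq># S" using assms by (simp add: subset_eq_diff_conv add.commute)
qed simp

lemma sums_of_length_plusI:
  assumes "x \<in> (\<Sum>s\<in>#T. f s)" "y \<in> sums_of_length f m J" "T + J \<subseteq># S"
  shows "x + y \<in> sums_of_length f (size T + m) S"
proof -
  obtain U where U: "U \<subseteq># J" "size U = m" "y \<in> (\<Sum>s\<in>#U. f s)"
    using assms(2) unfolding mem_sums_of_length_iff by blast
  have "T + U \<subseteq># S" using U(1) assms(3) by (meson subset_mset.add_left_mono subset_mset.order_trans)
  moreover have "x + y \<in> (\<Sum>s\<in>#T + U. f s)" using assms(1) U(3) by auto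
  ultimately show ?thesis unfolding mem_sums_of_length_iff using U(2)
    by (intro exI[of _ "T + U"]) simp
qed

lemma sums_of_length_elt_plus:
  "sums_of_length (\<lambda>s. c +o f s) n S = (of_nat n * c) +o sums_of_length f n S"
  for c :: "'v::comm_ring_1"
proof -
  have "(\<Sum>s\<in>#T. c +o f s) = (of_nat n * c) +o (\<Sum>s\<in>#T. f s)" if "size T = n" for T
    using that by (simp add: sumset_elt_plus sum_mset_constant)
  then show ?thesis by (auto simp: sums_of_length_def elt_set_plus_def)
qed

context add_subgroup
begin

lemma sums_of_length_subset: "\<forall>s\<in>#S. f s \<subseteq> K \<Longrightarrow> sums_of_length f n S \<subseteq> K"
proof
  fix x assume f: "\<forall>s\<in>#S. f s \<subseteq> K" and "x \<in> sums_of_length f n S"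
  then obtain T where T: "T \<subseteq># S" "x \<in> (\<Sum>s\<in>#T. f s)" unfolding mem_sums_of_length_iff by blast
  have "\<forall>s\<in>#T. f s \<subseteq> K" using f set_mset_mono[OF T(1)] by blast
  then show "x \<in> K" using sumset_subset T(2) by blast
qed

lemma sumset_subset_coset:
  "\<forall>s\<in>#R. f s \<subseteq> c s +o K \<Longrightarrow> (\<Sum>s\<in>#R. f s) \<subseteq> (\<Sum>s\<in>#R. c s) +o K"
proof (induction R)
  case (add s R)
  then have "f s + (\<Sum>s\<in>#R. f s) \<subseteq> (c s +o K) + ((\<Sum>s\<in>#R. c s) +o K)" by (intro set_plus_mono2) auto
  then show ?case by (simp add: set_plus_rearrange plus_self)
qed (simp add: zero_mem)

lemma sumset_subset_plus:
  assumes "\<And>s. f s \<subseteq> g s + K"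
  shows "(\<Sum>s\<in>#R. f s) \<subseteq> (\<Sum>s\<in>#R. g s) + K"
proof (induction R)
  case (add s R)
  then have "f s + (\<Sum>s\<in>#R. f s) \<subseteq> (g s + K) + ((\<Sum>s\<in>#R. g s) + K)" using assms
    by (intro set_plus_mono2)
  also have "\<dots> = g s + (\<Sum>s\<in>#R. g s) + (K + K)" by (simp only: ac_simps)
  finally show ?case by (simp add: plus_self)
qed (simp add: zero_mem)

lemma extend_by_zero_sums:
  assumes bound: "zero_sum_bound K f (set_mset R) d" and T: "T \<subseteq># R" "w \<in> (\<Sum>s\<in>#T. f s)"
  obtains T' w' where "T' \<subseteq># R" "w' \<in> (\<Sum>s\<in>#T'. f s)" "size T \<le> size T'" "size R < size T' + d"
    "w' - w \<in> K"
proof -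
  let ?P = "\<lambda>T'. T' \<subseteq># R \<and> size T \<le> size T' \<and> (\<exists>w'\<in>\<Sum>s\<in>#T'. f s. w' - w \<in> K)"
  have "?P T" using T zero_mem by (auto intro!: bexI[of _ w])
  then obtain T' where T': "T' \<subseteq># R" "size T \<le> size T'" "\<exists>w'\<in>\<Sum>s\<in>#T'. f s. w' - w \<in> K"
    and maximal: "\<And>U. ?P U \<Longrightarrow> size U \<le> size T'"
    using ex_has_greatest_nat[of ?P T size "Suc (size R)"]
    by (auto simp: less_Suc_eq_le dest: size_mset_mono)
  then obtain w' where w': "w' \<in> (\<Sum>s\<in>#T'. f s)" "w' - w \<in> K" by blast
  have "size R < size T' + d"
  proof (rule ccontr)
    assume "\<not> size R < size T' + d"
    then have "d \<le> size (R - T')" using T'(1) by (simp add: size_Diff_submset)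
    moreover have "set_mset (R - T') \<subseteq> set_mset R" by (auto dest: in_diffD)
    ultimately obtain Z z where Z: "Z \<subseteq># R - T'" "Z \<noteq> {#}" and z: "z \<in> (\<Sum>s\<in>#Z. f s)" "z \<in> K"
      using zero_sum_boundE[OF bound] by blast
    have "Z + T' \<subseteq># R" using Z(1) subset_mset.le_diff_conv2[OF T'(1)] by simp
    moreover have "z + w' \<in> (\<Sum>s\<in>#Z + T'. f s)" using z w' by auto
    moreover have "(z + w') - w \<in> K" using add_mem[OF z(2) w'(2)] by (simp add: add_diff_eq)
    ultimately have "size (Z + T') \<le> size T'" using maximal[of "Z + T'"] T'(2) by auto
    then show False using Z(2) by simp
  qed
  then show thesis using that T' w' by blast
qed

lemma sum_of_size_in_subgroup:
  assumes "\<forall>s\<in>#I. f s \<noteq> {} \<and> f s \<subseteq> K" "n \<le> size I"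
  obtains V v where "V \<subseteq># I" "size V = n" "v \<in> (\<Sum>s\<in>#V. f s)" "v \<in> K"
proof -
  obtain V where V: "V \<subseteq># I" "size V = n" by (rule submultiset_of_size[OF assms(2)])
  then have f: "\<forall>s\<in>#V. f s \<noteq> {}" "\<forall>s\<in>#V. f s \<subseteq> K" using assms(1) set_mset_mono[OF V(1)] by blast+
  then show thesis using that[OF V] sumset_nonempty[OF f(1)] sumset_subset[OF f(2)] by blast
qed

lemma sums_of_length_subset_subsums:
  assumes "\<forall>s\<in>#I. f s \<subseteq> K"
  shows "sums_of_length f n (R + I) \<subseteq> subsums f R + K"
proof
  fix x assume "x \<in> sums_of_length f n (R + I)"
  then obtain U where U: "U \<subseteq># R + I" "x \<in> (\<Sum>s\<in>#U. f s)" unfolding mem_sums_of_length_iff by blast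
  then obtain T V where TV: "U = T + V" "T \<subseteq># R" "V \<subseteq># I" by (rule_tac submultiset_plusE)
  have "(\<Sum>s\<in>#V. f s) \<subseteq> K" using assms set_mset_mono[OF TV(3)] by (intro sumset_subset) blast
  moreover have "(\<Sum>s\<in>#T. f s) \<subseteq> subsums f R" using TV(2) mem_subsums_iff by blast
  ultimately have "(\<Sum>s\<in>#U. f s) \<subseteq> subsums f R + K" by (simp add: TV(1) set_plus_mono2)
  then show "x \<in> subsums f R + K" using U(2) by blast
qed

end

text \<open>Where fewer than \<open>d\<close> terms of \<open>R\<close> are left over, enough terms of \<open>I\<close> remain to reach
  length \<open>n\<close>; otherwise some of the left-over terms have a sum in \<open>H\<close> and can be added for
  free.\<close>

theorem sums_of_length_padded:
  assumes K: "add_subgroup K" and H: "add_subgroup H" and KH: "K \<subseteq> H"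
    and bound: "zero_sum_bound H f (set_mset R) d"
    and I: "\<forall>s\<in>#I. f s \<noteq> {} \<and> f s \<subseteq> H" and J: "J \<subseteq># I" and full: "sums_of_length f m J + K = H"
    and short: "m + size R \<le> n" and long: "n + size J + d \<le> size R + size I + m + 1"
  shows "sums_of_length f n (R + I) + K = subsums f R + H"
proof
  interpret K: add_subgroup K by fact
  interpret H: add_subgroup H by fact
  have "sums_of_length f n (R + I) + K \<subseteq> (subsums f R + H) + H"
    using I by (intro set_plus_mono2 H.sums_of_length_subset_subsums KH) blast
  then show "sums_of_length f n (R + I) + K \<subseteq> subsums f R + H" by (simp only: H.periodic_plus)
  show "subsums f R + H \<subseteq> sums_of_length f n (R + I) + K"
  proof
    fix x assume "x \<in> subsums f R + H"
    then obtain w where w: "w \<in> subsums f R" "x - w \<in> H" unfolding mem_set_plus_iff by blast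
    then obtain T where T: "T \<subseteq># R" "w \<in> (\<Sum>s\<in>#T. f s)" unfolding mem_subsums_iff by blast
    obtain T' w' where T': "T' \<subseteq># R" "w' \<in> (\<Sum>s\<in>#T'. f s)" "size R < size T' + d" "w' - w \<in> H"
      by (rule H.extend_by_zero_sums[OF bound T(1,2)])
    have "size T' \<le> size R" using T'(1) by (rule size_mset_mono)
    then have "n - size T' - m \<le> size (I - J)" and length: "size T' + m \<le> n"
      using short long T'(3) by (simp_all add: size_Diff_submset[OF J])
    moreover have "\<forall>s\<in>#I - J. f s \<noteq> {} \<and> f s \<subseteq> H" using I in_diffD by metis
    ultimately obtain V v where V: "V \<subseteq># I - J" "size V = n - size T' - m"
      and v: "v \<in> (\<Sum>s\<in>#V. f s)" "v \<in> H"
      using H.sum_of_size_in_subgroup by metis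
    have VJ: "V + J \<subseteq># I" using V(1) subset_mset.le_diff_conv2[OF J] by simp
    have "(x - w) - (w' - w) - v \<in> H" using H.diff_mem[OF H.diff_mem[OF w(2) T'(4)] v(2)] .
    then have "x - w' - v \<in> sums_of_length f m J + K" using full by simp
    then obtain y where y: "y \<in> sums_of_length f m J" "x - w' - v - y \<in> K"
      unfolding mem_set_plus_iff by blast
    have "(T' + V) + J \<subseteq># R + I" using subset_mset.add_mono[OF T'(1) VJ] by (simp only: add.assoc)
    then have "(w' + v) + y \<in> sums_of_length f (size (T' + V) + m) (R + I)"
      using T'(2) v(1) y(1) by (intro sums_of_length_plusI) auto
    moreover have "size (T' + V) + m = n" using V(2) length by simp
    moreover have "x - ((w' + v) + y) \<in> K" using y(2) by (simp add: algebra_simps)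
    ultimately show "x \<in> sums_of_length f n (R + I) + K" unfolding mem_set_plus_iff by metis
  qed
qed

context subquotient
begin

text \<open>The terms of \<open>Z\<close> and \<open>J\<close> fill a coset of \<open>L\<close> and \<open>G / L\<close>; any further terms adjust the
  length.\<close>

lemma sums_of_length_full_if_quotient_full:
  assumes f: "\<forall>s\<in>#S. f s \<noteq> {} \<and> f s \<subseteq> G" and ZJ: "Z + J \<subseteq># S"
    and Z: "(\<Sum>t\<in>#Z. f t) + K = z +o L" and J: "sums_of_length f m J + L = G" and "0 \<in> L"
    and n: "size Z + m \<le> n" "n + size J \<le> size S + m"
  shows "sums_of_length f n S + K = G"
proof
  have fS: "\<forall>s\<in>#S. f s \<subseteq> G" using f by blast
  then show "sums_of_length f n S + K \<subseteq> G"
    by (intro upper.plus_subset upper.sums_of_length_subset lower_subset_upper)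
  have "\<forall>s\<in>#S - (Z + J). f s \<noteq> {} \<and> f s \<subseteq> G" using f in_diffD by metis
  moreover have "n - size Z - m \<le> size (S - (Z + J))" using n
    by (simp add: size_Diff_submset[OF ZJ])
  ultimately obtain V v where V: "V \<subseteq># S - (Z + J)" "size V = n - size Z - m"
    and v: "v \<in> (\<Sum>s\<in>#V. f s)" "v \<in> G"
    using upper.sum_of_size_in_subgroup by metis
  have VZJ: "(V + Z) + J \<subseteq># S" using V(1) subset_mset.le_diff_conv2[OF ZJ, of V]
    by (simp add: add.assoc)
  have "\<forall>t\<in>#Z. f t \<subseteq> G" using fS set_mset_mono[OF ZJ] by auto
  then have "z +o L \<subseteq> G" unfolding Z[symmetric] by (rule sumset_plus_subset)
  then have "z \<in> G" using set_plus_intro2[OF \<open>0 \<in> L\<close>, of z] by auto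
  show "G \<subseteq> sums_of_length f n S + K"
  proof
    fix g assume "g \<in> G"
    then have "g - v - z \<in> sums_of_length f m J + L"
      unfolding J using upper.diff_mem v(2) \<open>z \<in> G\<close> by blast
    then obtain u where u: "u \<in> sums_of_length f m J" "g - v - z - u \<in> L"
      unfolding mem_set_plus_iff by blast
    have "g - v - u \<in> z +o L" using u(2) by (simp add: algebra_simps flip: set_minus_plus)
    then obtain x where x: "x \<in> (\<Sum>t\<in>#Z. f t)" "g - v - u - x \<in> K"
      unfolding Z[symmetric] mem_set_plus_iff by blast
    have "v + x \<in> (\<Sum>t\<in>#V + Z. f t)" using v(1) x(1) by (simp add: set_plus_intro)
    then have "(v + x) + u \<in> sums_of_length f (size (V + Z) + m) S"
      by (rule sums_of_length_plusI[OF _ u(1) VZJ])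
    moreover have "size (V + Z) + m = n" using V(2) n(1) by simp
    moreover have "g - ((v + x) + u) \<in> K" using x(2) by (simp add: algebra_simps)
    ultimately show "g \<in> sums_of_length f n S + K" unfolding mem_set_plus_iff by metis
  qed
qed

end

subsection \<open>Shortening representations\<close>

lemma submultiset_image_msetE:
  assumes "N \<subseteq># image_mset f M"
  obtains M' where "M' \<subseteq># M" "N = image_mset f M'"
proof -
  obtain P where "image_mset f M = N + P" using assms by (metis subset_mset.add_diff_inverse)
  then obtain M' M'' where "M = M' + M''" "N = image_mset f M'" by (metis image_mset_eq_plusD)
  then show thesis using that[of M'] by simp
qed

context subquotient
begin

lemma zero_sum_bound_index:
  fixes f :: "'i \<Rightarrow> 'v set"
  assumes f: "\<forall>t\<in>I. f t \<noteq> {} \<and> f t \<subseteq> G"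
  shows "zero_sum_bound K f I (ncosets K G)"
  unfolding zero_sum_bound_def
proof (intro allI impI)
  fix T :: "'i multiset" assume T: "set_mset T \<subseteq> I \<and> size T = ncosets K G"
  then have "\<forall>t\<in>#T. \<exists>x. x \<in> f t \<and> x \<in> G" using f by blast
  from bchoice[OF this] obtain c where c: "\<forall>t\<in>#T. c t \<in> f t \<and> c t \<in> G" by blast
  show "\<exists>Z. Z \<subseteq># T \<and> Z \<noteq> {#} \<and> (\<Sum>s\<in>#Z. f s) \<inter> K \<noteq> {}"
  proof (cases "\<exists>t\<in>#T. c t \<in> K")
    case True
    then obtain t where "t \<in># T" "c t \<in> K" by blast
    then show ?thesis using c by (intro exI[of _ "{#t#}"]) auto
  next
    case False
    have K: "periodic_with_zero K"
      using lower_subset_upper lower.plus_self lower.zero_mem by (simp add: periodic_with_zero_def)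
    have "size {#y \<in># image_mset c T. y - x \<in> K#} \<le> size (image_mset c T)" for x
      by (rule size_filter_mset_lesseq)
    then obtain N d where N: "N \<subseteq># image_mset c T" "N \<noteq> {#}" and d: "d \<in> K" "d + \<Sum>\<^sub># N \<in> K"
      using short_zero_sum[of "image_mset c T" "size (image_mset c T)" K] K c False T
        lower.ncosets_self by auto
    obtain Z where Z: "Z \<subseteq># T" "N = image_mset c Z" using N(1) by (rule submultiset_image_msetE)
    have "\<forall>t\<in>#Z. c t \<in> f t" using c set_mset_mono[OF Z(1)] by blast
    then have "(\<Sum>t\<in>#Z. c t) \<in> (\<Sum>t\<in>#Z. f t)" by (rule sum_mset_mem_sumset)
    moreover have "(\<Sum>t\<in>#Z. c t) \<in> K" using lower.diff_mem[OF d(2,1)] Z(2) by simp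
    ultimately show ?thesis using Z N(2) by (intro exI[of _ Z]) auto
  qed
qed

lemma short_zero_sum_of_family:
  assumes f: "\<forall>t\<in>#Y. in_coset K (f t) \<and> f t \<subseteq> G \<and> \<not> f t \<subseteq> K" and c: "\<forall>t\<in>#Y. c t \<in> f t"
    and multiplicity: "\<And>x. size {#t \<in># Y. f t \<subseteq> x +o K#} \<le> h"
    and D: "periodic_with_zero D" and large: "ncosets K G < size Y + ncosets K D"
  obtains N d where "N \<subseteq># Y" "N \<noteq> {#}" "size N \<le> h" "d \<in> D" "d - (\<Sum>t\<in>#N. c t) \<in> K"
proof -
  have coset: "f t \<subseteq> c t +o K" if "t \<in># Y" for t
    using lower.in_coset_subset f c that by blast
  let ?M = "image_mset (\<lambda>t. - c t) Y"
  have "\<exists>N d. N \<subseteq># ?M \<and> N \<noteq> {#} \<and> size N \<le> h \<and> d \<in> D \<and> d + \<Sum>\<^sub># N \<in> K"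
  proof (rule short_zero_sum[OF _ _ D])
    show "\<forall>x\<in>#?M. x \<in> G - K"
    proof
      fix x assume "x \<in># ?M"
      then obtain t where t: "t \<in># Y" "x = - c t" by auto
      have "c t \<notin> K" using f t(1) coset[OF t(1)] lower.elt_plus_absorb[of "c t"] by auto
      then have "x \<notin> K" using t(2) lower.minus_mem[of x] by auto
      moreover have "x \<in> G" using t f c upper.minus_mem by blast
      ultimately show "x \<in> G - K" by blast
    qed
    show "size {#y \<in># ?M. y - x \<in> K#} \<le> h" for x
    proof -
      have "f t \<subseteq> (- x) +o K" if "t \<in># Y" "- c t - x \<in> K" for t
      proof -
        have "c t - (- x) \<in> K" using lower.minus_mem[OF that(2)] by (simp add: add.commute)
        then have "c t +o K = (- x) +o K" by (simp only: lower.coset_eq_iff)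
        then show ?thesis using coset[OF that(1)] by simp
      qed
      then have "{#t \<in># Y. - c t - x \<in> K#} \<subseteq># {#t \<in># Y. f t \<subseteq> (- x) +o K#}"
        by (intro filter_mset_mono_strong) auto
      then have "size {#t \<in># Y. - c t - x \<in> K#} \<le> h"
        using multiplicity[of "- x"] size_mset_mono by (metis order_trans)
      then show ?thesis by (simp add: filter_mset_image_mset)
    qed
  qed (simp add: large)
  then obtain N d where N: "N \<subseteq># ?M" "N \<noteq> {#}" "size N \<le> h" and d: "d \<in> D" "d + \<Sum>\<^sub># N \<in> K" by blast
  obtain N' where N': "N' \<subseteq># Y" "N = image_mset (\<lambda>t. - c t) N'" using N(1)
    by (rule submultiset_image_msetE)
  have "\<Sum>\<^sub># N = - (\<Sum>t\<in>#N'. c t)" unfolding N'(2) by (induction N') simp_all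
  then show thesis using that[OF N'(1) _ _ d(1)] N d(2) N'(2) by simp
qed

lemma periodic_with_zero_recentred:
  assumes "X \<subseteq> G" "v \<in> X"
  shows "periodic_with_zero ((- v) +o (X + K))"
  unfolding periodic_with_zero_def
proof (intro conjI)
  have "- v \<in> G" using assms upper.minus_mem by blast
  then show "(- v) +o (X + K) \<subseteq> G"
    using assms(1) upper.elt_plus_subset_iff upper.plus_subset lower_subset_upper by simp
  have "v \<in> X + K" using assms(2) lower.subset_plus by blast
  then show "0 \<in> (- v) +o (X + K)" by (simp flip: set_minus_plus)
qed (simp add: set_plus_rearrange3 lower.periodic_plus)

lemma ncosets_sumset_not_in_coset:
  assumes f: "\<forall>t\<in>#T. f t \<noteq> {} \<and> f t \<subseteq> G"
    and few: "\<And>L. intermediate K L G \<Longrightarrow> L \<noteq> K \<Longrightarrow>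
      size {#t \<in># T. \<not> in_coset K (f t) \<and> in_coset L (f t)#} + 2 \<le> ncosets K L"
  shows "size {#t \<in># T. \<not> in_coset K (f t)#} + 1
    \<le> ncosets K (\<Sum>t\<in>#{#t \<in># T. \<not> in_coset K (f t)#}. f t)"
proof (rule ncosets_sumset_crossing)
  have "in_coset G (f t)" if "f t \<subseteq> G" for t
    unfolding in_coset_def using that by (intro exI[of _ 0]) simp
  then show "\<forall>t\<in>#{#t \<in># T. \<not> in_coset K (f t)#}. f t \<noteq> {} \<and> in_coset G (f t) \<and> \<not> in_coset K (f t)"
    using f by simp
  fix L assume "intermediate K L G" "L \<noteq> K"
  then show "size {#t \<in># {#t \<in># T. \<not> in_coset K (f t)#}. in_coset L (f t)#} + 2 \<le> ncosets K L"
    using few[of L] by (simp add: filter_filter_mset)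
qed

lemma shorten_sum:
  assumes f: "\<forall>t\<in>#T. f t \<noteq> {} \<and> f t \<subseteq> G \<and> \<not> f t \<subseteq> K"
    and multiplicity: "\<And>x. size {#t \<in># T. f t \<subseteq> x +o K#} \<le> h"
    and few: "\<And>L. intermediate K L G \<Longrightarrow> L \<noteq> K \<Longrightarrow>
      size {#t \<in># T. \<not> in_coset K (f t) \<and> in_coset L (f t)#} + 2 \<le> ncosets K L"
    and long: "ncosets K G < size T" and w: "w \<in> (\<Sum>t\<in>#T. f t)"
  obtains T' w' where "T' \<subseteq># T" "size T' < size T" "size T \<le> size T' + h"
    "w' \<in> (\<Sum>t\<in>#T'. f t)" "w - w' \<in> K"
proof -
  define Y where "Y = {#t \<in># T. in_coset K (f t)#}"
  define Z where "Z = {#t \<in># T. \<not> in_coset K (f t)#}"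
  have T: "T = Y + Z" unfolding Y_def Z_def by (rule multiset_partition)
  obtain u v where uv: "w = u + v" "u \<in> (\<Sum>t\<in>#Y. f t)" "v \<in> (\<Sum>t\<in>#Z. f t)"
    using w unfolding T by (auto elim: set_plus_elim)
  define D where "D = (- v) +o ((\<Sum>t\<in>#Z. f t) + K)"
  have "\<forall>t\<in>#Z. f t \<subseteq> G" using f by (simp add: Z_def)
  then have D: "periodic_with_zero D"
    unfolding D_def by (intro periodic_with_zero_recentred upper.sumset_subset uv(3))
  have "size Z + 1 \<le> ncosets K (\<Sum>t\<in>#Z. f t)"
    unfolding Z_def using f by (intro ncosets_sumset_not_in_coset few) auto
  then have large: "ncosets K G < size Y + ncosets K D"
    using long T by (simp add: D_def ncosets_elt_plus lower.ncosets_plus)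
  have fY: "\<forall>t\<in>#Y. in_coset K (f t) \<and> f t \<subseteq> G \<and> \<not> f t \<subseteq> K" using f by (simp add: Y_def)
  have "\<forall>t\<in>#Y. \<exists>x. x \<in> f t" using f by (auto simp: Y_def)
  from bchoice[OF this] obtain c where c: "\<forall>t\<in>#Y. c t \<in> f t" by blast
  have "size {#t \<in># Y. f t \<subseteq> x +o K#} \<le> h" for x using multiplicity[of x] by (simp add: T)
  then obtain N d where N: "N \<subseteq># Y" "N \<noteq> {#}" "size N \<le> h"
    and d: "d \<in> D" "d - (\<Sum>t\<in>#N. c t) \<in> K"
    using short_zero_sum_of_family[OF fY c _ D large] by metis
  obtain v' where v': "v' \<in> (\<Sum>t\<in>#Z. f t)" "(d + v) - v' \<in> K"
    using d(1) unfolding D_def mem_set_plus_iff[of _ _ K] set_minus_plus[symmetric] by auto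
  define Y' where "Y' = Y - N"
  have Y: "Y = N + Y'" using N(1) by (simp add: Y'_def)
  have "(\<Sum>t\<in>#Y. f t) \<subseteq> (\<Sum>t\<in>#Y. c t) +o K"
    using lower.in_coset_subset fY c by (intro lower.sumset_subset_coset) blast
  then have "u - (\<Sum>t\<in>#Y. c t) \<in> K" using uv(2) by (simp only: set_minus_plus subsetD)
  then have "(u - (\<Sum>t\<in>#Y. c t)) + ((d + v) - v') - (d - (\<Sum>t\<in>#N. c t)) \<in> K"
    using lower.diff_mem[OF lower.add_mem[OF _ v'(2)] d(2)] by blast
  then have "w - ((\<Sum>t\<in>#Y'. c t) + v') \<in> K" by (simp add: uv(1) Y algebra_simps)
  moreover have "(\<Sum>t\<in>#Y'. c t) \<in> (\<Sum>t\<in>#Y'. f t)" using c by (intro sum_mset_mem_sumset) (simp add: Y)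
  then have "(\<Sum>t\<in>#Y'. c t) + v' \<in> (\<Sum>t\<in>#Y' + Z. f t)" using v'(1) by auto
  ultimately show thesis using that[of "Y' + Z"] N(2,3) by (simp add: T Y nonempty_has_size)
qed

lemma moderate_length_sum:
  assumes f: "\<forall>t\<in>#R. f t \<noteq> {} \<and> f t \<subseteq> G \<and> \<not> f t \<subseteq> K"
    and multiplicity: "\<And>x. size {#t \<in># R. f t \<subseteq> x +o K#} \<le> h"
    and few: "\<And>L. intermediate K L G \<Longrightarrow> L \<noteq> K \<Longrightarrow>
      size {#t \<in># R. \<not> in_coset K (f t) \<and> in_coset L (f t)#} + 2 \<le> ncosets K L"
    and T: "T \<subseteq># R" "w \<in> (\<Sum>t\<in>#T. f t)" "ncosets K G \<le> size T + h"
  obtains T' w' where "T' \<subseteq># R" "w' \<in> (\<Sum>t\<in>#T'. f t)" "size T' \<le> ncosets K G"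
    "ncosets K G \<le> size T' + h" "w - w' \<in> K"
proof -
  let ?P = "\<lambda>T'. T' \<subseteq># R \<and> ncosets K G \<le> size T' + h \<and> (\<exists>w'\<in>\<Sum>t\<in>#T'. f t. w - w' \<in> K)"
  have "?P T" using T lower.zero_mem by (auto intro!: bexI[of _ w])
  then obtain T' w' where T': "T' \<subseteq># R" "ncosets K G \<le> size T' + h"
    and w': "w' \<in> (\<Sum>t\<in>#T'. f t)" "w - w' \<in> K" and minimal: "\<And>U. ?P U \<Longrightarrow> size T' \<le> size U"
    using ex_has_least_nat[of ?P T size] by blast
  have "size T' \<le> ncosets K G"
  proof (rule ccontr)
    assume long: "\<not> size T' \<le> ncosets K G"
    have "size {#t \<in># T'. P t#} \<le> size {#t \<in># R. P t#}" for P
      by (intro size_mset_mono multiset_filter_mono T'(1))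
    note bounds = order_trans[OF this multiplicity] order_trans[OF add_right_mono[OF this] few]
    have fT': "\<forall>t\<in>#T'. f t \<noteq> {} \<and> f t \<subseteq> G \<and> \<not> f t \<subseteq> K" using f set_mset_mono[OF T'(1)] by blast
    obtain U u where U: "U \<subseteq># T'" "size U < size T'" "size T' \<le> size U + h" "u \<in> (\<Sum>t\<in>#U. f t)"
      "w' - u \<in> K"
      using shorten_sum[OF fT' bounds _ w'(1)] long by auto
    have "U \<subseteq># R" using U(1) T'(1) by (rule subset_mset.order_trans)
    moreover have "w - u \<in> K" using lower.diff_mem_trans[OF w'(2) U(5)] .
    ultimately have "size T' \<le> size U" using minimal[of U] U(3,4) long by auto
    then show False using U(2) by simp
  qed
  then show thesis using that T' w' by blast
qed

lemma sums_of_index_length_full: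
  assumes f: "\<forall>s\<in>#S. f s \<noteq> {} \<and> f s \<subseteq> G" and full: "subsums f (outside f K S) + K = G"
    and multiplicity: "\<And>x. size {#t \<in># S. f t \<subseteq> x +o K#} \<le> size (inside f K S)"
    and few: "\<And>L. intermediate K L G \<Longrightarrow> L \<noteq> K \<Longrightarrow>
      size {#t \<in># S. \<not> in_coset K (f t) \<and> in_coset L (f t)#} + 2 \<le> ncosets K L"
    and bound: "zero_sum_bound K f (set_mset S) d" and size: "size S + 1 = ncosets K G + d"
  shows "sums_of_length f (ncosets K G) S + K = G"
proof
  define n where "n = ncosets K G"
  define R where "R = outside f K S"
  define I where "I = inside f K S"
  have S: "S = R + I" by (simp add: R_def I_def outside_plus_inside)
  show "sums_of_length f n S + K \<subseteq> G"
    using f by (intro upper.plus_subset upper.sums_of_length_subset lower_subset_upper) blast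
  show "G \<subseteq> sums_of_length f n S + K"
  proof
    fix g assume "g \<in> G"
    then obtain w where w: "w \<in> subsums f R" "g - w \<in> K"
      unfolding full[symmetric] mem_set_plus_iff R_def by blast
    then obtain T where T: "T \<subseteq># R" "w \<in> (\<Sum>s\<in>#T. f s)" unfolding mem_subsums_iff by blast
    have RS: "R \<subseteq># S" by (simp add: S)
    have boundR: "zero_sum_bound K f (set_mset R) d"
      using zero_sum_bound_subset[OF bound set_mset_mono[OF RS]] .
    obtain T' w' where T': "T' \<subseteq># R" "w' \<in> (\<Sum>s\<in>#T'. f s)" "size R < size T' + d" "w' - w \<in> K"
      by (rule lower.extend_by_zero_sums[OF boundR T(1,2)])
    have "size {#t \<in># R. P t#} \<le> size {#t \<in># S. P t#}" for P
      by (intro size_mset_mono multiset_filter_mono RS)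
    note bounds = order_trans[OF this multiplicity] order_trans[OF add_right_mono[OF this] few]
    have fR: "\<forall>t\<in>#R. f t \<noteq> {} \<and> f t \<subseteq> G \<and> \<not> f t \<subseteq> K" using f by (simp add: R_def outside_def)
    have "ncosets K G \<le> size T' + size I" using T'(3) size by (simp add: S)
    then obtain U u where U: "U \<subseteq># R" "u \<in> (\<Sum>s\<in>#U. f s)" "size U \<le> n" "n \<le> size U + size I"
      "w' - u \<in> K"
      using moderate_length_sum[OF fR bounds T'(1,2)] unfolding n_def I_def by blast
    have "\<forall>s\<in>#I. f s \<noteq> {} \<and> f s \<subseteq> K" using f by (simp add: I_def inside_def)
    moreover have "n - size U \<le> size I" using U(4) by simp
    ultimately obtain V v where V: "V \<subseteq># I" "size V = n - size U" and v: "v \<in> (\<Sum>s\<in>#V. f s)" "v \<in> K"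
      using lower.sum_of_size_in_subgroup by metis
    have "(g - w) - (w' - w) + (w' - u) - v \<in> K"
      using lower.diff_mem[OF lower.add_mem[OF lower.diff_mem[OF w(2) T'(4)] U(5)] v(2)] .
    then have "g - (u + v) \<in> K" by (simp add: algebra_simps)
    moreover have "u + v \<in> sums_of_length f n S"
      unfolding mem_sums_of_length_iff using U V v(1) subset_mset.add_mono[OF U(1) V(1)]
      by (intro exI[of _ "U + V"]) (auto simp: S)
    ultimately show "g \<in> sums_of_length f n S + K" unfolding mem_set_plus_iff by blast
  qed
qed

theorem sums_of_index_length_full_subfamily:
  assumes f: "\<forall>s\<in>#S. f s \<noteq> {} \<and> f s \<subseteq> G"
    and outside: "\<And>L. intermediate K L G \<Longrightarrow> L \<noteq> G \<Longrightarrow> ncosets L G \<le> size (outside f L S) + 1"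
    and multiplicity: "\<And>x. size {#t \<in># S. f t \<subseteq> x +o K#} \<le> size (inside f K S)"
    and few: "\<And>L. intermediate K L G \<Longrightarrow> L \<noteq> K \<Longrightarrow>
      size {#t \<in># S. \<not> in_coset K (f t) \<and> in_coset L (f t)#} + 2 \<le> ncosets K L"
    and bound: "zero_sum_bound K f (set_mset S) d" and few_inside: "size (inside f K S) < d"
    and size: "ncosets K G + d \<le> size S + 1"
  obtains S' where "S' \<subseteq># S" "size S' + 1 = ncosets K G + d"
    "sums_of_length f (ncosets K G) S' + K = G"
proof -
  define I where "I = inside f K S"
  have fG: "\<forall>s\<in>#S. f s \<subseteq> G" using f by blast
  obtain R where R: "R \<subseteq># outside f K S" "size R + 1 \<le> ncosets K G" "subsums f R + K = G"
    by (rule subsums_full[OF fG outside])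
  have RI: "R + I \<subseteq># S" using subset_mset.add_right_mono[OF R(1)] outside_plus_inside
    by (metis I_def)
  have "size (R + I) \<le> ncosets K G + d - 1" "ncosets K G + d - 1 \<le> size S"
    using R(2) few_inside size by (simp_all add: I_def)
  then obtain S' where S': "R + I \<subseteq># S'" "S' \<subseteq># S" "size S' = ncosets K G + d - 1"
    using submultiset_of_size_between[OF RI] by blast
  have mono: "size {#t \<in># S'. P t#} \<le> size {#t \<in># S. P t#}" for P
    by (intro size_mset_mono multiset_filter_mono S'(2))
  have "R \<subseteq># S'" "I \<subseteq># S'"
    using S'(1) mset_subset_eq_add_left mset_subset_eq_add_right subset_mset.order_trans by blast+
  then have "size I \<le> size (inside f K S')"
    by (intro size_mset_mono subset_insideI) (simp_all add: I_def inside_def)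
  then have mult': "size {#t \<in># S'. f t \<subseteq> x +o K#} \<le> size (inside f K S')" for x
    using order_trans[OF mono multiplicity] by (metis I_def order_trans)
  have "R \<subseteq># outside f K S'"
    using \<open>R \<subseteq># S'\<close> set_mset_mono[OF R(1)] by (intro subset_outsideI) (auto simp: outside_def)
  then have "subsums f R + K \<subseteq> subsums f (outside f K S') + K"
    by (intro set_plus_mono2 subsums_mono) auto
  moreover have fS': "\<forall>s\<in>#S'. f s \<noteq> {} \<and> f s \<subseteq> G" using f set_mset_mono[OF S'(2)] by blast
  then have "subsums f (outside f K S') + K \<subseteq> G"
    by (intro upper.plus_subset upper.subsums_subset lower_subset_upper) (simp add: outside_def)
  ultimately have full: "subsums f (outside f K S') + K = G" using R(3) by blast
  have size': "size S' + 1 = ncosets K G + d" using S'(3) index_pos by simp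
  have few': "size {#t \<in># S'. \<not> in_coset K (f t) \<and> in_coset L (f t)#} + 2 \<le> ncosets K L"
    if "intermediate K L G" "L \<noteq> K" for L
    using add_right_mono[OF mono] few[OF that] by (rule order_trans)
  have bound': "zero_sum_bound K f (set_mset S') d"
    by (rule zero_sum_bound_subset[OF bound set_mset_mono[OF S'(2)]])
  show thesis
    by (rule that[OF S'(2) size' sums_of_index_length_full[OF fS' full mult' few' bound' size']])
qed

end

subsection \<open>The weighted Davenport constant of a quotient\<close>

definition dilate :: "int set \<Rightarrow> 'v::comm_ring_1 \<Rightarrow> 'v set" where
  "dilate A s = (\<lambda>a. of_int a * s) ` A"

definition shifted_dilate :: "int set \<Rightarrow> 'v::comm_ring_1 \<Rightarrow> 'v \<Rightarrow> 'v set" where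
  "shifted_dilate A \<beta> s = (- \<beta>) +o dilate A s"

definition dav :: "int set \<Rightarrow> 'v::comm_ring_1 set \<Rightarrow> 'v set \<Rightarrow> nat" where
  "dav A K G = (LEAST d. zero_sum_bound K (dilate A) G d)"

lemma add_subgroup_group_closure:
  fixes x :: "'v::comm_ring_1"
  assumes "add_subgroup K" "\<forall>a\<in>A. of_int a * x \<in> K" and b: "b \<in> group_closure A"
  shows "of_int b * x \<in> K"
proof -
  interpret K: add_subgroup K by fact
  from b show ?thesis
  proof induction
    case (base a)
    then show ?case using assms(2) K.zero_mem by auto
  next
    case (diff a b)
    then show ?case using K.diff_mem by (simp add: left_diff_distrib)
  qed
qed

lemma add_subgroup_of_int:
  fixes x :: "'v::comm_ring_1"
  assumes "add_subgroup K" "x \<in> K"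
  shows "of_int b * x \<in> K"
  using add_subgroup_group_closure[of K "{1}" x b] assms by (simp add: group_closure_eq)

lemma add_subgroup_Gcd:
  fixes x :: "'v::comm_ring_1"
  assumes "add_subgroup K" "\<forall>a\<in>A. of_int a * x \<in> K"
  shows "of_int (Gcd A) * x \<in> K"
  using add_subgroup_group_closure[OF assms Gcd_in_group_closure] .

lemma dilate_subset: "add_subgroup K \<Longrightarrow> s \<in> K \<Longrightarrow> dilate A s \<subseteq> K"
  by (auto simp: dilate_def add_subgroup_of_int)

lemma shifted_dilate_subset_iff: "shifted_dilate A \<beta> s \<subseteq> L \<longleftrightarrow> (\<forall>a\<in>A. of_int a * s - \<beta> \<in> L)"
  by (auto simp: shifted_dilate_def dilate_def elt_set_plus_def)

lemma shifted_dilate_subset_cong: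
  assumes "add_subgroup L" "shifted_dilate A \<beta> \<alpha> \<subseteq> L" "shifted_dilate A \<beta>' \<alpha> \<subseteq> L" "A \<noteq> {}"
  shows "shifted_dilate A \<beta> s \<subseteq> L \<longleftrightarrow> shifted_dilate A \<beta>' s \<subseteq> L"
proof -
  interpret L: add_subgroup L by fact
  obtain a where "a \<in> A" using assms(4) by blast
  then have "of_int a * \<alpha> - \<beta> \<in> L" "of_int a * \<alpha> - \<beta>' \<in> L"
    using assms(2,3) by (simp_all add: shifted_dilate_subset_iff)
  then have "(of_int a * \<alpha> - \<beta>) - (of_int a * \<alpha> - \<beta>') \<in> L" by (rule L.diff_mem)
  then have "x - \<beta> \<in> L \<longleftrightarrow> x - \<beta>' \<in> L" for x
    using L.add_mem[of "x - \<beta>'" "\<beta>' - \<beta>"] L.diff_mem[of "x - \<beta>" "\<beta>' - \<beta>"] by auto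
  then show ?thesis by (simp add: shifted_dilate_subset_iff)
qed

locale weighted_subquotient = subquotient K G for K G :: "'v::comm_ring_1 set" +
  fixes A :: "int set"
  assumes Gcd_A: "Gcd A = 1"
begin

lemma weights_nonempty: "A \<noteq> {}"
  using Gcd_A by auto

lemma shifted_dilate_nonempty: "shifted_dilate A \<beta> s \<noteq> {}"
  using weights_nonempty by (auto simp: shifted_dilate_def dilate_def elt_set_plus_def)

lemma shifted_dilates_subset:
  assumes S: "\<forall>s\<in>#S. shifted_dilate A \<beta> s \<subseteq> G" and \<alpha>: "\<alpha> \<in># S" "shifted_dilate A \<beta>' \<alpha> \<subseteq> G"
  shows "\<forall>s\<in>#S. shifted_dilate A \<beta>' s \<subseteq> G"
  using shifted_dilate_subset_cong[OF upper.add_subgroup_axioms _ \<alpha>(2) weights_nonempty] S \<alpha>(1)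
  by blast

lemma below: "intermediate K H G \<Longrightarrow> weighted_subquotient K H A"
  and above: "intermediate K H G \<Longrightarrow> weighted_subquotient H G A"
  using subquotient_below subquotient_above Gcd_A
  by (simp_all add: weighted_subquotient_def weighted_subquotient_axioms_def)

lemma zero_sum_bound_dilate_index: "zero_sum_bound K (dilate A) G (ncosets K G)"
proof (rule zero_sum_bound_index)
  show "\<forall>t\<in>G. dilate A t \<noteq> {} \<and> dilate A t \<subseteq> G"
    using weights_nonempty dilate_subset[OF upper.add_subgroup_axioms] by (simp add: dilate_def)
qed

lemma zero_sum_bound_dav: "zero_sum_bound K (dilate A) G (dav A K G)"
  unfolding dav_def by (rule LeastI[of _ "ncosets K G"]) (rule zero_sum_bound_dilate_index)

lemma dav_le_index: "dav A K G \<le> ncosets K G"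
  unfolding dav_def by (rule Least_le) (rule zero_sum_bound_dilate_index)

lemma dav_witness:
  assumes "l < dav A K G"
  obtains S where "set_mset S \<subseteq> G" "size S = l"
    "\<And>T. T \<subseteq># S \<Longrightarrow> T \<noteq> {#} \<Longrightarrow> (\<Sum>s\<in>#T. dilate A s) \<inter> K = {}"
  using not_less_Least[OF assms[unfolded dav_def]] unfolding zero_sum_bound_def by blast

lemma dav_pos: "1 \<le> dav A K G"
proof (rule ccontr)
  assume "\<not> 1 \<le> dav A K G"
  then have "dav A K G \<le> size ({#} :: 'v multiset)" by simp
  then show False using zero_sum_boundE[OF zero_sum_bound_dav, of "{#}"] by auto
qed

lemma dav_tower:
  assumes H: "intermediate K H G"
  shows "dav A K H + dav A H G \<le> dav A K G + 1"
proof (rule ccontr)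
  interpret KH: weighted_subquotient K H A by (rule below[OF H])
  interpret HG: weighted_subquotient H G A by (rule above[OF H])
  assume "\<not> ?thesis"
  then have large: "dav A K G \<le> (dav A K H - 1) + (dav A H G - 1)"
    using KH.dav_pos HG.dav_pos by linarith
  obtain S where S: "set_mset S \<subseteq> H" "size S = dav A K H - 1"
    "\<And>T. T \<subseteq># S \<Longrightarrow> T \<noteq> {#} \<Longrightarrow> (\<Sum>s\<in>#T. dilate A s) \<inter> K = {}"
    using KH.dav_witness[of "dav A K H - 1"] KH.dav_pos by auto
  obtain R where R: "set_mset R \<subseteq> G" "size R = dav A H G - 1"
    "\<And>T. T \<subseteq># R \<Longrightarrow> T \<noteq> {#} \<Longrightarrow> (\<Sum>s\<in>#T. dilate A s) \<inter> H = {}"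
    using HG.dav_witness[of "dav A H G - 1"] HG.dav_pos by auto
  have RS: "set_mset (R + S) \<subseteq> G" "dav A K G \<le> size (R + S)"
    using R(1,2) S(1,2) HG.lower_subset_upper large by auto
  obtain U u where U: "U \<subseteq># R + S" "U \<noteq> {#}" "u \<in> (\<Sum>s\<in>#U. dilate A s)" "u \<in> K"
    by (rule zero_sum_boundE[OF zero_sum_bound_dav RS])
  obtain T V where TV: "U = T + V" "T \<subseteq># R" "V \<subseteq># S" using U(1) by (rule submultiset_plusE)
  obtain t v where tv: "t \<in> (\<Sum>s\<in>#T. dilate A s)" "v \<in> (\<Sum>s\<in>#V. dilate A s)" "u = t + v"
    using U(3) TV(1) by (auto elim: set_plus_elim)
  have "\<forall>s\<in>#V. dilate A s \<subseteq> H"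
    using S(1) set_mset_mono[OF TV(3)] dilate_subset KH.upper.add_subgroup_axioms by blast
  then have "v \<in> H" using KH.upper.sumset_subset tv(2) by (meson subsetD)
  then have "u - v \<in> H" using U(4) KH.lower_subset_upper by (intro KH.upper.diff_mem) auto
  then have "T = {#}" using R(3)[OF TV(2)] tv(1,3) by auto
  then show False using S(3)[OF TV(3)] U(2,4) TV(1) tv by auto
qed

lemma shifted_dilate_subset_iff_diff:
  assumes L: "add_subgroup L" and \<alpha>: "shifted_dilate A \<beta> \<alpha> \<subseteq> L"
  shows "shifted_dilate A \<beta> s \<subseteq> L \<longleftrightarrow> s - \<alpha> \<in> L"
proof -
  interpret L: add_subgroup L by fact
  have "of_int a * s - \<beta> \<in> L \<longleftrightarrow> of_int a * (s - \<alpha>) \<in> L" if "a \<in> A" for a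
  proof -
    have "of_int a * \<alpha> - \<beta> \<in> L" using \<alpha> that by (simp add: shifted_dilate_subset_iff)
    then show ?thesis
      using L.add_mem[of "of_int a * (s - \<alpha>)" "of_int a * \<alpha> - \<beta>"]
        L.diff_mem[of "of_int a * s - \<beta>" "of_int a * \<alpha> - \<beta>"]
      by (auto simp: right_diff_distrib)
  qed
  then have "shifted_dilate A \<beta> s \<subseteq> L \<longleftrightarrow> (\<forall>a\<in>A. of_int a * (s - \<alpha>) \<in> L)"
    by (simp add: shifted_dilate_subset_iff)
  also have "\<dots> \<longleftrightarrow> s - \<alpha> \<in> L"
    using add_subgroup_Gcd[OF L, of A "s - \<alpha>"] add_subgroup_of_int[OF L] Gcd_A by auto
  finally show ?thesis .
qed

text \<open>Subtracting \<open>\<alpha>\<close> from every term turns \<open>A \<cdot> (s - \<alpha>)\<close> into \<open>A \<cdot> s - \<beta>\<close> modulo \<open>K\<close>.\<close>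

lemma zero_sum_bound_shifted_dilate:
  assumes \<alpha>: "shifted_dilate A \<beta> \<alpha> \<subseteq> K"
  shows "zero_sum_bound K (shifted_dilate A \<beta>) {s. shifted_dilate A \<beta> s \<subseteq> G} (dav A K G)"
  unfolding zero_sum_bound_def
proof (intro allI impI)
  fix T assume T: "set_mset T \<subseteq> {s. shifted_dilate A \<beta> s \<subseteq> G} \<and> size T = dav A K G"
  have "shifted_dilate A \<beta> \<alpha> \<subseteq> G" using \<alpha> lower_subset_upper by blast
  note iff = shifted_dilate_subset_iff_diff[OF upper.add_subgroup_axioms this]
  let ?T = "image_mset (\<lambda>s. s - \<alpha>) T"
  have "set_mset ?T \<subseteq> G" "dav A K G \<le> size ?T" using T by (auto simp: iff)
  then obtain Z' z where Z': "Z' \<subseteq># ?T" "Z' \<noteq> {#}" "z \<in> (\<Sum>s\<in>#Z'. dilate A s)" "z \<in> K"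
    by (rule zero_sum_boundE[OF zero_sum_bound_dav])
  obtain Z where Z: "Z \<subseteq># T" "Z' = image_mset (\<lambda>s. s - \<alpha>) Z" using Z'(1)
    by (rule submultiset_image_msetE)
  have "dilate A (s - \<alpha>) \<subseteq> shifted_dilate A \<beta> s + K" for s
  proof
    fix x assume "x \<in> dilate A (s - \<alpha>)"
    then obtain a where a: "a \<in> A" "x = of_int a * (s - \<alpha>)" by (auto simp: dilate_def)
    have "x - (of_int a * s - \<beta>) = - (of_int a * \<alpha> - \<beta>)" using a(2) by (simp add: algebra_simps)
    also have "\<dots> \<in> K" using \<alpha> a(1) by (intro lower.minus_mem) (simp add: shifted_dilate_subset_iff)
    finally show "x \<in> shifted_dilate A \<beta> s + K"
      using a(1) unfolding mem_set_plus_iff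
      by (auto simp: shifted_dilate_def dilate_def elt_set_plus_def)
  qed
  then have "(\<Sum>s\<in>#Z. dilate A (s - \<alpha>)) \<subseteq> (\<Sum>s\<in>#Z. shifted_dilate A \<beta> s) + K"
    by (rule lower.sumset_subset_plus)
  then obtain y where "y \<in> (\<Sum>s\<in>#Z. shifted_dilate A \<beta> s)" "z - y \<in> K"
    using Z'(3) unfolding Z(2) mem_set_plus_iff subset_iff
    by (auto simp: multiset.map_comp comp_def)
  moreover have "y \<in> K" using lower.diff_mem[OF Z'(4) \<open>z - y \<in> K\<close>] by simp
  ultimately show "\<exists>Z. Z \<subseteq># T \<and> Z \<noteq> {#} \<and> (\<Sum>s\<in>#Z. shifted_dilate A \<beta> s) \<inter> K \<noteq> {}"
    using Z Z'(2) by (intro exI[of _ Z]) auto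
qed

end

subsection \<open>Sequences that fill a subgroup\<close>

definition fills :: "int set \<Rightarrow> 'v::comm_ring_1 set \<Rightarrow> 'v set \<Rightarrow> 'v \<Rightarrow> 'v multiset \<Rightarrow> bool" where
  "fills A K H \<beta> S \<longleftrightarrow> (\<forall>s\<in>#S. shifted_dilate A \<beta> s \<subseteq> H) \<and> size S + 1 = ncosets K H + dav A K H \<and>
     sums_of_length (shifted_dilate A \<beta>) (ncosets K H) S + K = H"

definition structured :: "int set \<Rightarrow> 'v::comm_ring_1 set \<Rightarrow> 'v set \<Rightarrow> 'v multiset \<Rightarrow> bool" where
  "structured A K G S \<longleftrightarrow> (\<exists>H \<beta> J. intermediate K H G \<and> J \<subseteq># S \<and> fills A K H \<beta> J \<and>
     size (outside (shifted_dilate A \<beta>) H S) \<le> ncosets H G - 2)"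

lemma extend_two_submultisets:
  assumes "M \<subseteq># S" "N \<subseteq># T" "size M + size N \<le> n" "n \<le> size S + size T"
  obtains M' N' where "M \<subseteq># M'" "M' \<subseteq># S" "N \<subseteq># N'" "N' \<subseteq># T" "size M' + size N' = n"
    "size M' = max (size M) (n - size T)"
proof -
  have "size M \<le> max (size M) (n - size T)" "max (size M) (n - size T) \<le> size S"
    using assms(4) size_mset_mono[OF assms(1)] by auto
  then obtain M' where M': "M \<subseteq># M'" "M' \<subseteq># S" "size M' = max (size M) (n - size T)"
    by (rule submultiset_of_size_between[OF assms(1)])
  have "size N \<le> n - size M'" "n - size M' \<le> size T"
    using assms(3) size_mset_mono[OF assms(2)] M'(3) by auto
  then obtain N' where "N \<subseteq># N'" "N' \<subseteq># T" "size N' = n - size M'"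
    by (rule submultiset_of_size_between[OF assms(2)])
  then show thesis using that[OF M'(1,2)] M'(3) assms(3) by auto
qed

lemma sums_of_length_singleton: "sums_of_length f 1 {#s#} = f s"
proof -
  have "T \<subseteq># {#s#} \<and> size T = 1 \<longleftrightarrow> T = {#s#}" for T
    by (metis less_irrefl mset_subset_size size_single subset_mset.le_less)
  then show ?thesis by (simp add: sums_of_length_def)
qed

context weighted_subquotient
begin

lemma dav_self: "dav A K K = 1"
proof -
  interpret KK: weighted_subquotient K K A by (rule below[OF intermediate_lower])
  show ?thesis using KK.dav_le_index KK.dav_pos by (simp add: lower.ncosets_self)
qed

lemma fills_singleton:
  assumes "shifted_dilate A \<beta> s \<subseteq> K"
  shows "fills A K K \<beta> {#s#}"
  using assms lower.plus_absorb[OF assms shifted_dilate_nonempty]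
    sums_of_length_singleton[of "shifted_dilate A \<beta>" s]
  by (simp add: fills_def lower.ncosets_self dav_self)

lemma fills_nonempty: "fills A K G \<beta> S \<Longrightarrow> S \<noteq> {#}"
  using index_pos dav_pos by (auto simp: fills_def)

lemma sums_of_length_if_fills:
  fixes \<beta> defines "f \<equiv> shifted_dilate A \<beta>"
  assumes H: "intermediate K H G" and J: "fills A K H \<beta> J" "J \<subseteq># I"
    and I: "\<forall>s\<in>#I. f s \<subseteq> H" and R: "\<forall>s\<in>#R. f s \<subseteq> G" and short: "ncosets K H + size R \<le> n"
    and long: "n + size J + dav A H G \<le> size R + size I + ncosets K H + 1"
  shows "sums_of_length f n (R + I) + K = subsums f R + H"
proof -
  interpret KH: weighted_subquotient K H A by (rule below[OF H])
  interpret HG: weighted_subquotient H G A by (rule above[OF H])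
  have full_J: "sums_of_length f (ncosets K H) J + K = H" using J(1) by (simp add: fills_def f_def)
  obtain \<alpha> where "\<alpha> \<in># J" using KH.fills_nonempty[OF J(1)] by blast
  then have "f \<alpha> \<subseteq> H" using I mset_subset_eqD[OF J(2)] by blast
  then have "zero_sum_bound H f {s. f s \<subseteq> G} (dav A H G)"
    unfolding f_def by (rule HG.zero_sum_bound_shifted_dilate)
  moreover have "set_mset R \<subseteq> {s. f s \<subseteq> G}" using R by blast
  ultimately have bound: "zero_sum_bound H f (set_mset R) (dav A H G)"
    by (rule zero_sum_bound_subset)
  have fI: "\<forall>s\<in>#I. f s \<noteq> {} \<and> f s \<subseteq> H" using I by (simp add: f_def shifted_dilate_nonempty)
  show ?thesis
    by (rule sums_of_length_padded[OF lower.add_subgroup_axioms KH.upper.add_subgroup_axioms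
          KH.lower_subset_upper bound fI J(2) full_J short long])
qed

lemma fills_extend:
  fixes \<beta> defines "f \<equiv> shifted_dilate A \<beta>"
  assumes H: "intermediate K H G" and J: "fills A K H \<beta> J" "J \<subseteq># S" and S: "\<forall>s\<in>#S. f s \<subseteq> G"
    and R: "R \<subseteq># outside f H S" "size R + 1 \<le> ncosets H G" "subsums f R + H = G"
    and many: "ncosets K H + dav A K G \<le> size (inside f H S) + 1"
    and long: "ncosets K G + dav A K G \<le> size S + 1"
  obtains S' where "S' \<subseteq># S" "fills A K G \<beta> S'"
proof -
  interpret HG: weighted_subquotient H G A by (rule above[OF H])
  have fJ: "\<forall>s\<in>#J. f s \<subseteq> H" and size_J: "size J + 1 = ncosets K H + dav A K H"
    using J(1) by (simp_all add: fills_def f_def)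
  have JI: "J \<subseteq># inside f H S" by (rule subset_insideI[OF J(2) fJ])
  note tower = dav_tower[OF H] and index = index_add_le[OF H]
  define N where "N = ncosets K G + dav A K G - 1"
  have "size R + size J \<le> N" using R(2) size_J tower index HG.dav_pos unfolding N_def by linarith
  moreover have "N \<le> size (outside f H S) + size (inside f H S)"
    using long size_outside_inside[of f H S] by (simp add: N_def)
  ultimately obtain R' I where R': "R \<subseteq># R'" "R' \<subseteq># outside f H S"
    and I: "J \<subseteq># I" "I \<subseteq># inside f H S" and size: "size R' + size I = N"
    and size_R': "size R' = max (size R) (N - size (inside f H S))"
    by (rule extend_two_submultisets[OF R(1) JI])
  have short: "ncosets K H + size R' \<le> ncosets K G"
    using R(2) index many dav_pos by (simp add: size_R' N_def)
  have RI: "R' + I \<subseteq># S" using subset_mset.add_mono[OF R'(2) I(2)]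
    by (simp add: outside_plus_inside)
  have fR': "\<forall>s\<in>#R'. f s \<subseteq> G" and fI: "\<forall>s\<in>#I. f s \<subseteq> H"
    using S set_mset_mono[OF R'(2)] set_mset_mono[OF I(2)] by (auto simp: outside_def inside_def)
  have "sums_of_length f (ncosets K G) (R' + I) + K = subsums f R' + H"
    using sums_of_length_if_fills[OF H J(1) I(1) _ _ short] fI fR' size size_J tower
    by (simp add: N_def f_def)
  also have "\<dots> = G"
  proof
    show "subsums f R' + H \<subseteq> G"
      by (intro upper.plus_subset upper.subsums_subset HG.lower_subset_upper fR')
    show "G \<subseteq> subsums f R' + H"
      using subsums_mono[OF R'(1), of f] R(3) by (metis order_refl set_plus_mono2)
  qed
  finally have "sums_of_length f (ncosets K G) (R' + I) + K = G" .
  moreover have "\<forall>s\<in>#R' + I. f s \<subseteq> G" using S set_mset_mono[OF RI] by blast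
  ultimately have "fills A K G \<beta> (R' + I)" using size dav_pos by (simp add: fills_def f_def N_def)
  then show thesis using that RI by blast
qed

lemma fills_shifted_dilates_subset:
  assumes "intermediate K H G" "fills A K H \<beta>' J" "J \<subseteq># S" "\<forall>s\<in>#S. shifted_dilate A \<beta> s \<subseteq> G"
  shows "\<forall>s\<in>#S. shifted_dilate A \<beta>' s \<subseteq> G"
proof -
  interpret KH: weighted_subquotient K H A by (rule below[OF assms(1)])
  obtain \<alpha> where "\<alpha> \<in># J" using KH.fills_nonempty[OF assms(2)] by blast
  then have "\<alpha> \<in># S" "shifted_dilate A \<beta>' \<alpha> \<subseteq> H"
    using assms(2) mset_subset_eqD[OF assms(3)] by (simp_all add: fills_def)
  then show ?thesis
    using shifted_dilates_subset[OF assms(4)] assms(1) unfolding intermediate_def by blast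
qed

subsection \<open>The inductive structure theorem\<close>

theorem structured_if_fills:
  fixes \<beta> defines "f \<equiv> shifted_dilate A \<beta>"
  assumes H: "intermediate K H G" and J: "fills A K H \<beta> J" "J \<subseteq># S" and S: "\<forall>s\<in>#S. f s \<subseteq> G"
    and many: "ncosets K H + dav A K G \<le> size (inside f H S) + 1"
    and long: "ncosets K G + dav A K G \<le> size S + 1"
  shows "structured A K G S"
proof -
  interpret HG: weighted_subquotient H G A by (rule above[OF H])
  obtain M where M: "intermediate H M G" and few: "size (outside f M S) \<le> ncosets M G - 2"
    and crossing:
      "\<And>L. intermediate H L M \<Longrightarrow> L \<noteq> M \<Longrightarrow> ncosets L M \<le> size (outside f L (inside f M S)) + 1"
    using HG.minimal_absorbing_subgroup[OF S] by blast
  have KMG: "intermediate K M G" and KHM: "intermediate K H M"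
    using M H by (auto simp: intermediate_def)
  interpret KM: weighted_subquotient K M A by (rule below[OF KMG])
  interpret MG: weighted_subquotient M G A by (rule above[OF KMG])
  interpret HM: weighted_subquotient H M A by (rule HG.below[OF M])
  have HM: "inside f H (inside f M S) = inside f H S"
    by (rule inside_inside[OF HM.lower_subset_upper])
  have fM: "\<forall>s\<in>#inside f M S. f s \<subseteq> M" by (simp add: inside_def)
  obtain R where R: "R \<subseteq># outside f H (inside f M S)" "size R + 1 \<le> ncosets H M"
    "subsums f R + H = M"
    by (rule HM.subsums_full[OF fM crossing])
  have "\<forall>s\<in>#J. f s \<subseteq> M" using J(1) HM.lower_subset_upper by (auto simp: fills_def f_def)
  then have JM: "J \<subseteq># inside f M S" by (rule subset_insideI[OF J(2)])
  have dav_le: "dav A K M \<le> dav A K G" using dav_tower[OF KMG] MG.dav_pos by linarith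
  have long_M: "ncosets K M + dav A K M \<le> size (inside f M S) + 1"
  proof (cases "ncosets M G = 1")
    case True
    then show ?thesis using few long dav_le index_tower[OF KMG] size_outside_inside[of f M S]
      by simp
  next
    case False
    then show ?thesis
      using few long dav_le index_add_le[OF KMG] size_outside_inside[of f M S] MG.index_pos
      by linarith
  qed
  have "ncosets K H + dav A K M \<le> size (inside f H (inside f M S)) + 1" using many dav_le HM by simp
  then obtain S' where "S' \<subseteq># inside f M S" "fills A K M \<beta> S'"
    using KM.fills_extend[OF KHM J(1) JM _ _ R(2) _ _ long_M] fM R unfolding f_def by metis
  then show ?thesis
    using KMG few inside_subset subset_mset.order_trans unfolding structured_def f_def by blast
qed

lemma structured_if_many_inside:
  assumes S: "\<forall>s\<in>#S. shifted_dilate A \<beta> s \<subseteq> G"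
    and many: "dav A K G \<le> size (inside (shifted_dilate A \<beta>') K S)"
    and long: "ncosets K G + dav A K G \<le> size S + 1"
  shows "structured A K G S"
proof -
  have "inside (shifted_dilate A \<beta>') K S \<noteq> {#}" using many dav_pos by auto
  then obtain s where s: "s \<in># S" "shifted_dilate A \<beta>' s \<subseteq> K" by (auto simp: inside_def)
  then have "\<forall>t\<in>#S. shifted_dilate A \<beta>' t \<subseteq> G"
    using shifted_dilates_subset[OF S] lower_subset_upper by blast
  then show ?thesis
    using structured_if_fills[OF intermediate_lower fills_singleton[OF s(2)]] s(1) many long
    by (simp add: lower.ncosets_self)
qed

lemma structured_if_structured_inside:
  fixes \<beta> defines "f \<equiv> shifted_dilate A \<beta>"
  assumes L: "intermediate K L G" "L \<noteq> G" and S: "\<forall>s\<in>#S. f s \<subseteq> G"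
    and structured:
      "ncosets K L + dav A K L \<le> size (inside f L S) + 1 \<Longrightarrow> structured A K L (inside f L S)"
    and few: "size (outside f L S) + 3 \<le> ncosets L G + ncosets K L"
    and long: "ncosets K G + dav A K G \<le> size S + 1"
  shows "structured A K G S"
proof -
  interpret KL: weighted_subquotient K L A by (rule below[OF L(1)])
  interpret LG: weighted_subquotient L G A by (rule above[OF L(1)])
  let ?l = "ncosets K L" and ?q = "ncosets L G"
  have dav_le: "dav A K L \<le> dav A K G" using dav_tower[OF L(1)] LG.dav_pos by linarith
  obtain q where q: "?q = q + 2" using LG.index_ge_2[OF L(2)] by (metis add.commute le_Suc_ex)
  have "1 * q \<le> ?l * q" using KL.index_pos by (rule mult_right_mono) simp
  moreover have "ncosets K G = ?l * q + 2 * ?l" using index_tower[OF L(1)] q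
    by (simp add: algebra_simps)
  ultimately have large: "?l + dav A K G \<le> size (inside f L S)"
    using long few size_outside_inside[of f L S] unfolding q by linarith
  then obtain H \<beta>' J where H: "intermediate K H L" and J: "J \<subseteq># inside f L S" "fills A K H \<beta>' J"
    and out: "size (outside (shifted_dilate A \<beta>') H (inside f L S)) \<le> ncosets H L - 2"
    using structured dav_le unfolding structured_def by auto
  let ?g = "shifted_dilate A \<beta>'"
  have KHG: "intermediate K H G" using H L(1) by (auto simp: intermediate_def)
  interpret KH: weighted_subquotient K H A by (rule below[OF KHG])
  interpret HL: weighted_subquotient H L A by (rule KL.above[OF H])
  obtain \<alpha> where "\<alpha> \<in># J" using KH.fills_nonempty[OF J(2)] by blast
  then have "\<alpha> \<in># inside f L S" "?g \<alpha> \<subseteq> H"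
    using mset_subset_eqD[OF J(1)] J(2) by (simp_all add: fills_def)
  then have \<alpha>: "f \<alpha> \<subseteq> L" "?g \<alpha> \<subseteq> L" using HL.lower_subset_upper by (auto simp: inside_def)
  have "f s \<subseteq> L \<longleftrightarrow> ?g s \<subseteq> L" for s
    using shifted_dilate_subset_cong[OF KL.upper.add_subgroup_axioms _ \<alpha>(2) weights_nonempty] \<alpha>(1)
    unfolding f_def by blast
  then have "inside f L S = inside ?g L S" by (simp add: inside_def)
  then have "inside ?g H (inside f L S) = inside ?g H S" using inside_inside HL.lower_subset_upper
    by metis
  then have "size (inside f L S) \<le> (ncosets H L - 2) + size (inside ?g H S)"
    using out size_outside_inside[of ?g H "inside f L S"] by simp
  then have "ncosets K H + dav A K G \<le> size (inside ?g H S) + 1"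
    using large KL.index_add_le[OF H] KL.index_tower[OF H] HL.index_pos
    by (cases "ncosets H L = 1") auto
  moreover have JS: "J \<subseteq># S" using J(1) inside_subset by (rule subset_mset.order_trans)
  moreover have "\<forall>s\<in>#S. ?g s \<subseteq> G"
    using fills_shifted_dilates_subset[OF KHG J(2) JS] S unfolding f_def by blast
  ultimately show ?thesis using structured_if_fills[OF KHG J(2)] long by blast
qed

lemma in_coset_shifted_dilate: "in_coset L (shifted_dilate A \<beta> s) \<longleftrightarrow> in_coset L (dilate A s)"
  by (simp add: shifted_dilate_def in_coset_elt_plus)

lemma structured_if_fills_group:
  assumes "\<forall>s\<in>#S. shifted_dilate A \<beta> s \<subseteq> G" "J \<subseteq># S" "fills A K G \<beta> J"
  shows "structured A K G S"
proof -
  have "outside (shifted_dilate A \<beta>) G S = {#}" using assms(1) by (simp add: outside_def)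
  then show ?thesis using assms(2,3) intermediate_upper unfolding structured_def by fastforce
qed

lemma fills_if_fills_quotient:
  assumes L: "intermediate K L G"
    and Z: "(\<Sum>t\<in>#Z. dilate A t) + K = z +o L" "size Z + 1 = ncosets K L"
    and J: "fills A L G \<beta> J" and ZJ: "Z + J \<subseteq># S" and S: "\<forall>s\<in>#S. shifted_dilate A \<beta> s \<subseteq> G"
    and long: "ncosets K G + dav A K G \<le> size S + 1"
  obtains S' where "S' \<subseteq># S" "fills A K G \<beta> S'"
proof -
  interpret KL: weighted_subquotient K L A by (rule below[OF L])
  let ?f = "shifted_dilate A \<beta>"
  have size_J: "size J + 1 = ncosets L G + dav A L G"
    and full_J: "sums_of_length ?f (ncosets L G) J + L = G"
    using J by (simp_all add: fills_def)
  have dav_le: "dav A L G \<le> dav A K G" using dav_tower[OF L] KL.dav_pos by linarith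
  note sizes = Z(2) size_J dav_le index_add_le[OF L] dav_pos
  have "size (Z + J) \<le> ncosets K G + dav A K G - 1" "ncosets K G + dav A K G - 1 \<le> size S"
    using sizes long by simp_all
  then obtain S' where S': "Z + J \<subseteq># S'" "S' \<subseteq># S" "size S' = ncosets K G + dav A K G - 1"
    by (rule submultiset_of_size_between[OF ZJ])
  have fS': "\<forall>s\<in>#S'. ?f s \<subseteq> G" using S set_mset_mono[OF S'(2)] by blast
  have "(\<Sum>t\<in>#Z. ?f t) + K = (\<Sum>t\<in>#Z. - \<beta>) +o (z +o L)"
    by (simp add: shifted_dilate_def sumset_elt_plus set_plus_rearrange3 Z(1))
  then have Z': "(\<Sum>t\<in>#Z. ?f t) + K = ((\<Sum>t\<in>#Z. - \<beta>) + z) +o L" by (simp only: set_plus_rearrange2)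
  have "sums_of_length ?f (ncosets K G) S' + K = G"
  proof (rule sums_of_length_full_if_quotient_full[OF _ S'(1) Z' full_J KL.upper.zero_mem])
    show "\<forall>s\<in>#S'. ?f s \<noteq> {} \<and> ?f s \<subseteq> G" using fS' shifted_dilate_nonempty by blast
    show "size Z + ncosets L G \<le> ncosets K G" "ncosets K G + size J \<le> size S' + ncosets L G"
      using sizes S'(3) by linarith+
  qed
  then have "fills A K G \<beta> S'" using fS' S'(3) dav_pos by (simp add: fills_def)
  then show thesis using that S'(2) by blast
qed

lemma structured_if_structured_quotient:
  assumes S: "\<forall>s\<in>#S. shifted_dilate A \<beta> s \<subseteq> G" and long: "ncosets K G + dav A K G \<le> size S + 1"
    and L: "intermediate K L G" and Z: "Z \<subseteq># S" "size Z + 1 = ncosets K L"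
    "(\<Sum>t\<in>#Z. dilate A t) + K = z +o L"
    and quotient: "structured A L G (S - Z)"
    and subgroups: "\<And>L \<beta>' S'. \<lbrakk>intermediate K L G; L \<noteq> G; \<forall>s\<in>#S'. shifted_dilate A \<beta>' s \<subseteq> L;
      ncosets K L + dav A K L \<le> size S' + 1\<rbrakk> \<Longrightarrow> structured A K L S'"
  shows "structured A K G S"
proof -
  interpret LG: weighted_subquotient L G A by (rule above[OF L])
  obtain H \<beta>' J where H: "intermediate L H G" and J: "J \<subseteq># S - Z" "fills A L H \<beta>' J"
    and out: "size (outside (shifted_dilate A \<beta>') H (S - Z)) \<le> ncosets H G - 2"
    using quotient unfolding structured_def by blast
  let ?g = "shifted_dilate A \<beta>'"
  have "J \<subseteq># S" using J(1) diff_subset_eq_self by (rule subset_mset.order_trans)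
  note gS = LG.fills_shifted_dilates_subset[OF H J(2) this S]
  show ?thesis
  proof (cases "H = G")
    case True
    have ZJ: "Z + J \<subseteq># S" using J(1) subset_mset.le_diff_conv2[OF Z(1), of J]
      by (simp add: add.commute)
    obtain S' where "S' \<subseteq># S" "fills A K G \<beta>' S'"
      using fills_if_fills_quotient[OF L Z(3,2) _ ZJ gS long] J(2) True by blast
    then show ?thesis by (rule structured_if_fills_group[OF gS])
  next
    case False
    have KHG: "intermediate K H G" and LH: "L \<subseteq> H" using L H by (auto simp: intermediate_def)
    interpret KH: weighted_subquotient K H A by (rule below[OF KHG])
    interpret HG: weighted_subquotient H G A by (rule above[OF KHG])
    have "outside ?g H S = outside ?g H (S - Z) + outside ?g H Z"
      unfolding outside_def using Z(1) by (metis filter_union_mset subset_mset.diff_add)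
    then have "size (outside ?g H S) \<le> (ncosets H G - 2) + size Z"
      using out size_mset_mono[OF outside_subset[of ?g H Z]] by simp
    moreover have "ncosets K L \<le> ncosets K H" using KH.ncosets_mono LH by blast
    ultimately have "size (outside ?g H S) + 3 \<le> ncosets H G + ncosets K H"
      using Z(2) HG.index_ge_2[OF False] by linarith
    moreover have "structured A K H (inside ?g H S)"
      if "ncosets K H + dav A K H \<le> size (inside ?g H S) + 1"
      by (rule subgroups[where \<beta>' = \<beta>', OF KHG False _ that]) (simp add: inside_def)
    ultimately show ?thesis by (intro structured_if_structured_inside[OF KHG False gS _ _ long])
  qed
qed

lemma structured_if_many_crossing:
  assumes S: "\<forall>s\<in>#S. shifted_dilate A \<beta> s \<subseteq> G" and long: "ncosets K G + dav A K G \<le> size S + 1"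
    and M: "intermediate K M G" "M \<noteq> K"
    "ncosets K M \<le> size {#t \<in># S. \<not> in_coset K (dilate A t) \<and> in_coset M (dilate A t)#} + 1"
    and quotients: "\<And>L S'. \<lbrakk>intermediate K L G; L \<noteq> K; \<forall>s\<in>#S'. shifted_dilate A \<beta> s \<subseteq> G;
      ncosets L G + dav A L G \<le> size S' + 1\<rbrakk> \<Longrightarrow> structured A L G S'"
    and subgroups: "\<And>L \<beta>' S'. \<lbrakk>intermediate K L G; L \<noteq> G; \<forall>s\<in>#S'. shifted_dilate A \<beta>' s \<subseteq> L;
      ncosets K L + dav A K L \<le> size S' + 1\<rbrakk> \<Longrightarrow> structured A K L S'"
  shows "structured A K G S"
proof -
  have "\<forall>t\<in>#S. dilate A t \<noteq> {}" using weights_nonempty by (simp add: dilate_def)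
  then obtain L Z z where L: "intermediate K L G" "L \<noteq> K" and Z: "Z \<subseteq># S" "size Z + 1 = ncosets K L"
    "(\<Sum>t\<in>#Z. dilate A t) + K = z +o L"
    by (rule crossing_sets_fill_coset[OF _ M])
  interpret KL: weighted_subquotient K L A by (rule below[OF L(1)])
  have size_S: "size S = size (S - Z) + size Z" using Z(1)
    by (metis size_union subset_mset.diff_add)
  have "structured A L G (S - Z)"
  proof (rule quotients[OF L])
    show "\<forall>s\<in>#S - Z. shifted_dilate A \<beta> s \<subseteq> G" using S in_diffD by metis
    show "ncosets L G + dav A L G \<le> size (S - Z) + 1"
      using long size_S Z(2) index_add_le[OF L(1)] dav_tower[OF L(1)] KL.dav_pos by linarith
  qed
  then show ?thesis by (rule structured_if_structured_quotient[OF S long L(1) Z _ subgroups])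
qed

lemma in_coset_dilate_exists:
  assumes S: "\<forall>s\<in>#S. shifted_dilate A \<beta> s \<subseteq> G" and long: "ncosets K G + dav A K G \<le> size S + 1"
    and few: "size (inside (shifted_dilate A \<beta>) K S) < dav A K G"
    and few_crossing: "G \<noteq> K \<Longrightarrow>
      size {#t \<in># S. \<not> in_coset K (dilate A t) \<and> in_coset G (dilate A t)#} + 2 \<le> ncosets K G"
  obtains t where "t \<in># S" "in_coset K (dilate A t)"
proof (cases "\<exists>t\<in>#S. in_coset K (dilate A t)")
  case False
  have "in_coset G (dilate A t)" if "t \<in># S" for t
    using S that unfolding in_coset_def shifted_dilate_def elt_plus_subset_swap by blast
  then have "{#t \<in># S. \<not> in_coset K (dilate A t) \<and> in_coset G (dilate A t)#} = S"
    using False by (auto simp: filter_mset_eq_conv)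
  moreover have "G \<noteq> K"
  proof
    assume "G = K"
    then have "inside (shifted_dilate A \<beta>) K S = S" using S
      by (simp add: inside_def filter_mset_eq_conv)
    then show False using few long index_pos by simp
  qed
  ultimately have "size S + 2 \<le> ncosets K G" using few_crossing by simp
  then show thesis using long by simp
qed (use that in blast)

lemma most_populated_shift:
  assumes "t \<in># S" "in_coset K (dilate A t)"
  obtains \<beta> \<alpha> where "\<alpha> \<in># S" "shifted_dilate A \<beta> \<alpha> \<subseteq> K"
    "\<forall>\<gamma>. size (inside (shifted_dilate A \<gamma>) K S) \<le> size (inside (shifted_dilate A \<beta>) K S)"
proof -
  let ?size = "\<lambda>\<gamma>. size (inside (shifted_dilate A \<gamma>) K S)"
  obtain \<beta> where greatest: "\<forall>\<gamma>. ?size \<gamma> \<le> ?size \<beta>"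
    using ex_has_greatest_nat[of "\<lambda>_. True" 0 ?size "Suc (size S)"]
    by (auto simp: less_Suc_eq_le intro: size_mset_mono inside_subset)
  obtain x where "dilate A t \<subseteq> x +o K" using assms(2) unfolding in_coset_def by blast
  then have "inside (shifted_dilate A x) K S \<noteq> {#}"
    using assms(1) by (auto simp: inside_def shifted_dilate_def elt_plus_subset_swap)
  then have "inside (shifted_dilate A \<beta>) K S \<noteq> {#}" using spec[OF greatest, of x] by auto
  then show thesis using that greatest by (auto simp: inside_def)
qed

lemma structured_if_few_crossing:
  assumes S: "\<forall>s\<in>#S. shifted_dilate A \<beta> s \<subseteq> G" and long: "ncosets K G + dav A K G \<le> size S + 1"
    and few: "\<And>\<beta>'. size (inside (shifted_dilate A \<beta>') K S) < dav A K G"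
    and few_crossing: "\<And>L. intermediate K L G \<Longrightarrow> L \<noteq> K \<Longrightarrow>
      size {#t \<in># S. \<not> in_coset K (dilate A t) \<and> in_coset L (dilate A t)#} + 2 \<le> ncosets K L"
    and subgroups: "\<And>L \<beta>' S'. \<lbrakk>intermediate K L G; L \<noteq> G; \<forall>s\<in>#S'. shifted_dilate A \<beta>' s \<subseteq> L;
      ncosets K L + dav A K L \<le> size S' + 1\<rbrakk> \<Longrightarrow> structured A K L S'"
  shows "structured A K G S"
proof -
  obtain t where "t \<in># S" "in_coset K (dilate A t)"
    by (rule in_coset_dilate_exists[OF S long few few_crossing[OF intermediate_upper]])
  then obtain \<beta>' \<alpha> where \<alpha>: "\<alpha> \<in># S" "shifted_dilate A \<beta>' \<alpha> \<subseteq> K"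
    and greatest:
      "\<forall>\<gamma>. size (inside (shifted_dilate A \<gamma>) K S) \<le> size (inside (shifted_dilate A \<beta>') K S)"
    by (rule most_populated_shift)
  let ?g = "shifted_dilate A \<beta>'"
  have gS: "\<forall>s\<in>#S. ?g s \<subseteq> G" using shifted_dilates_subset[OF S \<alpha>(1)] \<alpha>(2) lower_subset_upper
    by blast
  show ?thesis
  proof (cases "\<exists>L. intermediate K L G \<and> L \<noteq> G \<and> size (outside ?g L S) + 1 < ncosets L G")
    case True
    then obtain L where L: "intermediate K L G" "L \<noteq> G" "size (outside ?g L S) + 1 < ncosets L G"
      by blast
    interpret KL: subquotient K L by (rule subquotient_below[OF L(1)])
    have "structured A K L (inside ?g L S)" if "ncosets K L + dav A K L \<le> size (inside ?g L S) + 1"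
      by (rule subgroups[where \<beta>' = \<beta>', OF L(1,2) _ that]) (simp add: inside_def)
    moreover have "size (outside ?g L S) + 3 \<le> ncosets L G + ncosets K L"
      using L(3) KL.index_pos by linarith
    ultimately show ?thesis by (intro structured_if_structured_inside[OF L(1,2) gS _ _ long])
  next
    case False
    have g: "\<forall>s\<in>#S. ?g s \<noteq> {} \<and> ?g s \<subseteq> G" using gS shifted_dilate_nonempty by blast
    have outside: "ncosets L G \<le> size (outside ?g L S) + 1" if "intermediate K L G" "L \<noteq> G" for L
      using False that by (meson not_le)
    have "?g t \<subseteq> x +o K \<longleftrightarrow> shifted_dilate A (x + \<beta>') t \<subseteq> K" for t x
      by (simp add: shifted_dilate_def set_plus_rearrange2 flip: elt_plus_subset_swap)
    then have multiplicity: "size {#t \<in># S. ?g t \<subseteq> x +o K#} \<le> size (inside ?g K S)" for x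
      using spec[OF greatest, of "x + \<beta>'"] by (simp add: inside_def)
    have bound: "zero_sum_bound K ?g (set_mset S) (dav A K G)"
      using zero_sum_bound_subset[OF zero_sum_bound_shifted_dilate[OF \<alpha>(2)]] gS by blast
    obtain S' where "S' \<subseteq># S" "size S' + 1 = ncosets K G + dav A K G"
      "sums_of_length ?g (ncosets K G) S' + K = G"
      using sums_of_index_length_full_subfamily[OF g outside multiplicity _ bound few long]
        few_crossing by (auto simp: in_coset_shifted_dilate)
    then have "fills A K G \<beta>' S'" using gS set_mset_mono unfolding fills_def by blast
    then show ?thesis by (rule structured_if_fills_group[OF gS \<open>S' \<subseteq># S\<close>])
  qed
qed

end

theorem structured_exists:
  assumes "weighted_subquotient K G A" "\<forall>s\<in>#S. shifted_dilate A \<beta> s \<subseteq> G"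
    and "ncosets K G + dav A K G \<le> size S + 1"
  shows "structured A K G S"
  using assms
proof (induction "ncosets K G" arbitrary: K G S \<beta> rule: less_induct)
  case less
  interpret weighted_subquotient K G A by fact
  have quotients: "structured A L G S'"
    if L: "intermediate K L G" "L \<noteq> K" and S': "\<forall>s\<in>#S'. shifted_dilate A \<beta> s \<subseteq> G"
      "ncosets L G + dav A L G \<le> size S' + 1" for L S'
  proof (rule less.hyps[OF _ above[OF L(1)] S'])
    interpret KL: subquotient K L by (rule subquotient_below[OF L(1)])
    show "ncosets L G < ncosets K G" using index_add_le[OF L(1)] KL.index_ge_2 L(2) by auto
  qed
  have subgroups: "structured A K L S'"
    if L: "intermediate K L G" "L \<noteq> G" and S': "\<forall>s\<in>#S'. shifted_dilate A \<beta>' s \<subseteq> L"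
      "ncosets K L + dav A K L \<le> size S' + 1" for L \<beta>' S'
    by (rule less.hyps[OF index_strict_mono[OF L] below[OF L(1)] S'])
  consider (many_inside) \<beta>' where "dav A K G \<le> size (inside (shifted_dilate A \<beta>') K S)"
    | (many_crossing) M where "intermediate K M G" "M \<noteq> K"
        "ncosets K M \<le> size {#t \<in># S. \<not> in_coset K (dilate A t) \<and> in_coset M (dilate A t)#} + 1"
    | (few) "\<And>\<beta>'. size (inside (shifted_dilate A \<beta>') K S) < dav A K G"
        "\<And>L. intermediate K L G \<Longrightarrow> L \<noteq> K \<Longrightarrow>
          size {#t \<in># S. \<not> in_coset K (dilate A t) \<and> in_coset L (dilate A t)#} + 2 \<le> ncosets K L"
    by (metis add_2_eq_Suc' Suc_eq_plus1 Suc_leI not_le)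
  then show ?case
  proof cases
    case many_inside
    then show ?thesis by (rule structured_if_many_inside[OF less.prems(2) _ less.prems(3)])
  next
    case many_crossing
    then show ?thesis
      by (rule structured_if_many_crossing[OF less.prems(2,3) _ _ _ quotients subgroups])
  next
    case few
    then show ?thesis by (rule structured_if_few_crossing[OF less.prems(2,3) _ _ subgroups])
  qed
qed

subsection \<open>The decomposition of weighted sums\<close>

locale weighted_decomposition = weighted_subquotient K G A for K G :: "'v::comm_ring_1 set" and A +
  fixes n :: nat and S :: "'v multiset" and H :: "'v set" and \<beta> :: 'v and S' S'' S0 :: "'v multiset"
  assumes H: "intermediate K H G"
    and submultisets: "S' \<subseteq># S" "S'' \<subseteq># S'" "S0 \<subseteq># S" "(S - S') + S'' \<subseteq># S0"
    and shifted_dilates: "\<forall>s\<in>#S'. shifted_dilate A \<beta> s \<subseteq> H"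
    and size_removed: "size (S - S') \<le> ncosets H G - 2"
    and size_S'': "size S'' + 1 = ncosets K H + dav A K H"
    and size_S0: "size S0 + 2 = ncosets K H + size (S - S') + dav A K H + dav A H G"
    and sums_S'':
      "sums_of_length (dilate A) (ncosets K H) S'' + K = (of_nat (ncosets K H) * \<beta>) +o H"
    and sums_S: "sums_of_length (dilate A) n S + K =
      (of_nat n * \<beta>) +o (subsums (shifted_dilate A \<beta>) (S - S') + H)"
    and sums_S0: "sums_of_length (dilate A) (ncosets K H + size (S - S')) S0 + K =
      (of_nat (ncosets K H + size (S - S')) * \<beta>) +o (subsums (shifted_dilate A \<beta>) (S - S') + H)"

context weighted_subquotient
begin

lemma sums_of_length_dilate:
  "sums_of_length (dilate A) n S = (of_nat n * \<beta>) +o sums_of_length (shifted_dilate A \<beta>) n S"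
proof -
  have "sums_of_length (shifted_dilate A \<beta>) n S =
      (of_nat n * (- \<beta>)) +o sums_of_length (dilate A) n S"
    unfolding shifted_dilate_def by (rule sums_of_length_elt_plus)
  then show ?thesis by (simp add: set_plus_rearrange2)
qed

theorem weighted_decomposition_exists:
  assumes S: "\<forall>s\<in>#S. shifted_dilate A \<gamma> s \<subseteq> G"
    and n: "ncosets K G \<le> n" and long: "n + dav A K G \<le> size S + 1"
  obtains H \<beta> S' S'' S0 where "weighted_decomposition K G A n S H \<beta> S' S'' S0"
proof -
  have "structured A K G S"
    using structured_exists[OF weighted_subquotient_axioms S] n long by simp
  then obtain H \<beta> J where H: "intermediate K H G" and J: "J \<subseteq># S" "fills A K H \<beta> J"
    and out: "size (outside (shifted_dilate A \<beta>) H S) \<le> ncosets H G - 2"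
    unfolding structured_def by blast
  interpret KH: weighted_subquotient K H A by (rule below[OF H])
  interpret HG: weighted_subquotient H G A by (rule above[OF H])
  let ?f = "shifted_dilate A \<beta>"
  define R where "R = outside ?f H S"
  define I where "I = inside ?f H S"
  have SRI: "S = R + I" by (simp add: R_def I_def outside_plus_inside)
  have fJ: "\<forall>s\<in>#J. ?f s \<subseteq> H" and size_J: "size J + 1 = ncosets K H + dav A K H"
    and full_J: "sums_of_length ?f (ncosets K H) J + K = H"
    using J(2) by (simp_all add: fills_def)
  have JI: "J \<subseteq># I" unfolding I_def by (rule subset_insideI[OF J(1) fJ])
  have short: "ncosets K H + size R \<le> n"
    using out n index_add_le[OF H] index_tower[OF H] HG.index_pos unfolding R_def
    by (cases "ncosets H G = 1") auto
  note sizes = long size_J short dav_tower[OF H] KH.dav_pos HG.dav_pos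
  have "dav A H G - 1 \<le> size (I - J)" using sizes by (simp add: SRI size_Diff_submset[OF JI])
  then obtain J' where J': "J' \<subseteq># I - J" "size J' = dav A H G - 1" by (rule submultiset_of_size)
  have JJ': "J + J' \<subseteq># I" using J'(1) subset_mset.le_diff_conv2[OF JI] by (simp add: add.commute)
  have fR: "\<forall>s\<in>#R. ?f s \<subseteq> G"
    using fills_shifted_dilates_subset[OF H J(2,1) S] by (simp add: SRI)
  have fI: "\<forall>s\<in>#I. ?f s \<subseteq> H" by (simp add: I_def inside_def)
  have "sums_of_length ?f n (R + I) + K = subsums ?f R + H"
    by (rule sums_of_length_if_fills[OF H J(2) JI fI fR short]) (use sizes in \<open>simp add: SRI\<close>)
  moreover have "sums_of_length ?f (ncosets K H + size R) (R + (J + J')) + K = subsums ?f R + H"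
    by (rule sums_of_length_if_fills[OF H J(2) _ _ fR])
       (use fI set_mset_mono[OF JJ'] J'(2) sizes in auto)
  moreover have "sums_of_length (dilate A) m T + K = (of_nat m * \<beta>) +o (sums_of_length ?f m T + K)"
    for m T
    by (simp add: sums_of_length_dilate[of m T \<beta>] set_plus_rearrange3)
  moreover have "S - I = R" "I \<subseteq># S" "R + (J + J') \<subseteq># S" using JJ' by (simp_all add: SRI)
  ultimately have "weighted_decomposition K G A n S H \<beta> I J (R + (J + J'))"
    using H JI JJ' fI out size_J J'(2) full_J sizes
    by unfold_locales (simp_all add: SRI[symmetric] R_def[symmetric])
  then show thesis by (rule that)
qed

end

subsection \<open>Presentations of abelian groups\<close>

lemma image_mset_lift:
  assumes "finite I" "image_mset s (mset_set I) = image_mset \<phi> N"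
  obtains x where "N = image_mset x (mset_set I)" "\<forall>i\<in>I. \<phi> (x i) = s i"
proof -
  have "\<exists>x. N = image_mset x (mset_set I) \<and> (\<forall>i\<in>I. \<phi> (x i) = s i)"
    using assms
  proof (induction I arbitrary: N)
    case (insert j I)
    then have "image_mset \<phi> N = add_mset (s j) (image_mset s (mset_set I))" by simp
    then obtain N' y where N: "N = add_mset y N'" "\<phi> y = s j"
      "image_mset \<phi> N' = image_mset s (mset_set I)"
      using msed_map_invR by metis
    then obtain x where x: "N' = image_mset x (mset_set I)" "\<forall>i\<in>I. \<phi> (x i) = s i"
      using insert.IH[of N'] by auto
    define x' where "x' = x(j := y)"
    have x': "x' j = y" "\<forall>i\<in>I. x' i = x i" using insert.hyps by (auto simp: x'_def)
    then have "image_mset x' (mset_set I) = image_mset x (mset_set I)"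
      using insert.hyps by (intro image_mset_cong) auto
    then show ?case using insert.hyps N x x' by (intro exI[of _ x']) auto
  qed simp
  then show thesis using that by blast
qed

lemma multiset_indexing:
  assumes "finite I" "card I = size N"
  obtains x where "N = image_mset x (mset_set I)"
  using image_mset_lift[OF assms(1), of "\<lambda>_. ()" "\<lambda>_. ()" N] assms(2)
  by (auto simp: image_mset_const_eq)

lemma sum_dilates_indexed:
  assumes "finite I"
  shows "(\<Sum>s\<in>#image_mset x (mset_set I). dilate A s) =
    {\<Sum>i\<in>I. of_int (a i) * x i | a. \<forall>i\<in>I. a i \<in> A}"
proof -
  have "(\<Sum>s\<in>#image_mset x (mset_set I). dilate A s) = (\<Sum>i\<in>I. dilate A (x i))"
    by (simp add: sum_unfold_sum_mset multiset.map_comp comp_def)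
  also have "\<dots> = {\<Sum>i\<in>I. y i | y. \<forall>i\<in>I. y i \<in> dilate A (x i)}" by (rule set_sum_alt[OF assms])
  also have "\<dots> = {\<Sum>i\<in>I. of_int (a i) * x i | a. \<forall>i\<in>I. a i \<in> A}"
  proof (intro equalityI subsetI)
    fix w assume "w \<in> {\<Sum>i\<in>I. y i | y. \<forall>i\<in>I. y i \<in> dilate A (x i)}"
    then obtain y where y: "w = (\<Sum>i\<in>I. y i)" "\<forall>i\<in>I. \<exists>a. a \<in> A \<and> y i = of_int a * x i"
      unfolding dilate_def by blast
    from bchoice[OF y(2)] obtain a where "\<forall>i\<in>I. a i \<in> A \<and> y i = of_int (a i) * x i" by blast
    then show "w \<in> {\<Sum>i\<in>I. of_int (a i) * x i | a. \<forall>i\<in>I. a i \<in> A}" using y(1) by auto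
  qed (auto simp: dilate_def)
  finally show ?thesis .
qed

locale presentation = comm_group M + X: add_subgroup X
  for M (structure) and X :: "'v::comm_ring_1 set" +
  fixes \<phi>
  assumes surj: "\<phi> ` X = carrier M"
    and hom: "\<And>x y. x \<in> X \<Longrightarrow> y \<in> X \<Longrightarrow> \<phi> (x + y) = \<phi> x \<otimes> \<phi> y"
begin

definition ker :: "'v set" where "ker = {x \<in> X. \<phi> x = \<one>}"

definition preimage :: "'a set \<Rightarrow> 'v set" where "preimage H = {x \<in> X. \<phi> x \<in> H}"

lemma closed: "x \<in> X \<Longrightarrow> \<phi> x \<in> carrier M"
  using surj by blast

lemma hom_zero: "\<phi> 0 = \<one>"
  using hom[of 0 0] closed[of 0] X.zero_mem by (metis add_0 l_cancel_one')

lemma hom_minus: "x \<in> X \<Longrightarrow> \<phi> (- x) = inv \<phi> x"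
  using hom[of "- x" x] X.minus_mem closed hom_zero by (metis inv_equality left_minus)

lemma hom_diff: "x \<in> X \<Longrightarrow> y \<in> X \<Longrightarrow> \<phi> (x - y) = \<phi> x \<otimes> inv \<phi> y"
  using hom[of x "- y"] X.minus_mem hom_minus by simp

lemma of_int_mem: "x \<in> X \<Longrightarrow> of_int a * x \<in> X"
  by (rule add_subgroup_of_int[OF X.add_subgroup_axioms])

lemma hom_of_nat: "x \<in> X \<Longrightarrow> \<phi> (of_nat n * x) = \<phi> x [^] n"
proof (induction n)
  case (Suc n)
  have "of_nat n * x \<in> X" using of_int_mem[OF Suc.prems, of "int n"] by simp
  then have "\<phi> (of_nat n * x + x) = \<phi> x [^] n \<otimes> \<phi> x" using hom Suc by simp
  then show ?case by (simp add: algebra_simps)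
qed (simp add: hom_zero)

lemma hom_of_int:
  assumes "x \<in> X"
  shows "\<phi> (of_int a * x) = \<phi> x [^] a"
proof (cases a rule: int_cases2)
  case (nonneg n)
  then show ?thesis using hom_of_nat[OF assms] by (simp add: int_pow_int)
next
  case (nonpos n)
  have "of_nat n * x \<in> X" using of_int_mem[OF assms, of "int n"] by simp
  then show ?thesis
    using nonpos hom_minus hom_of_nat[OF assms] int_pow_neg_int[OF closed[OF assms]] by simp
qed

lemma hom_sum:
  assumes "finite I" "\<forall>i\<in>I. x i \<in> X"
  shows "(\<Sum>i\<in>I. x i) \<in> X \<and> \<phi> (\<Sum>i\<in>I. x i) = (\<Otimes>i\<in>I. \<phi> (x i))"
  using assms
proof (induction I)
  case (insert j I)
  then have "(\<Otimes>i\<in>insert j I. \<phi> (x i)) = \<phi> (x j) \<otimes> (\<Otimes>i\<in>I. \<phi> (x i))"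
    using closed by (intro finprod_insert) auto
  then show ?case using insert X.add_mem hom by simp
qed (simp add: hom_zero X.zero_mem)

lemma add_subgroup_ker: "add_subgroup ker"
  using X.zero_mem X.diff_mem hom_zero hom_diff by unfold_locales (simp_all add: ker_def)

lemma diff_mem_preimage_iff:
  assumes H: "subgroup H M" and xy: "x \<in> X" "y \<in> X"
  shows "x - y \<in> preimage H \<longleftrightarrow> \<phi> x \<in> \<phi> y <# H"
proof -
  interpret H: normal H M using H by (rule subgroup_imp_normal)
  have "\<phi> x \<in> \<phi> y <# H \<longleftrightarrow> \<phi> x \<otimes> inv \<phi> y \<in> H"
    using H.rcos_module[OF is_group] H.coset_eq xy closed by simp
  then show ?thesis using xy X.diff_mem hom_diff by (simp add: preimage_def)
qed

lemma diff_mem_ker_iff: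
  assumes "x \<in> X" "y \<in> X"
  shows "x - y \<in> ker \<longleftrightarrow> \<phi> x = \<phi> y"
proof -
  have "\<phi> x \<otimes> inv \<phi> y = \<one> \<longleftrightarrow> \<phi> x = \<phi> y"
    using assms closed inv_equality[of "\<phi> x" "inv \<phi> y"] by auto
  then show ?thesis using assms X.diff_mem hom_diff by (simp add: ker_def)
qed

lemma image_plus_ker:
  assumes "Y \<subseteq> X"
  shows "\<phi> ` (Y + ker) = \<phi> ` Y"
proof
  interpret ker: add_subgroup ker by (rule add_subgroup_ker)
  show "\<phi> ` (Y + ker) \<subseteq> \<phi> ` Y"
  proof
    fix z assume "z \<in> \<phi> ` (Y + ker)"
    then obtain y k where "y \<in> Y" "k \<in> ker" "z = \<phi> (y + k)" by (auto elim: set_plus_elim)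
    then show "z \<in> \<phi> ` Y" using assms hom[of y k] closed[of y] by (auto simp: ker_def)
  qed
  show "\<phi> ` Y \<subseteq> \<phi> ` (Y + ker)" by (intro image_mono ker.subset_plus)
qed

lemma card_image_eq_ncosets:
  assumes "Y \<subseteq> X"
  shows "card (\<phi> ` Y) = ncosets ker Y"
proof -
  let ?fibre = "\<lambda>z. {x \<in> X. \<phi> x = z}"
  have "x +o ker = ?fibre (\<phi> x)" if "x \<in> Y" for x
  proof -
    have "x \<in> X" using assms that by blast
    have "y - x \<in> ker \<longleftrightarrow> y \<in> X \<and> \<phi> y = \<phi> x" for y
      using diff_mem_ker_iff[of y x] X.add_mem[of "y - x" x] \<open>x \<in> X\<close> by (auto simp: ker_def)
    then show ?thesis by (simp add: set_eq_iff flip: set_minus_plus)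
  qed
  then have "cosets ker Y = ?fibre ` \<phi> ` Y" by (auto simp: cosets_def image_image)
  moreover have "inj_on ?fibre (\<phi> ` Y)" using assms by (force simp: inj_on_def)
  ultimately show ?thesis by (simp add: ncosets_def card_image)
qed

lemma order_eq_index: "order M = ncosets ker X"
  using card_image_eq_ncosets[OF order_refl] surj by (simp add: order_def)

lemma subquotient_ker:
  assumes "finite (carrier M)"
  shows "subquotient ker X"
proof -
  have "ncosets ker X \<noteq> 0"
    using assms order_eq_index one_closed by (metis card_eq_0_iff empty_iff order_def)
  then have "finite (cosets ker X)" unfolding ncosets_def
    by (rule card_ge_0_finite[OF neq0_conv[THEN iffD1]])
  then show ?thesis
    unfolding subquotient_def subquotient_axioms_def
    using add_subgroup_ker X.add_subgroup_axioms by (auto simp: ker_def)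
qed

lemma image_sum_dilates:
  assumes N: "N = image_mset x (mset_set I)" "finite I" "set_mset N \<subseteq> X"
  shows "\<phi> ` (\<Sum>s\<in>#N. dilate A s) = {\<Otimes>i\<in>I. \<phi> (x i) [^] a i | a :: 'i \<Rightarrow> int. \<forall>i\<in>I. a i \<in> A}"
proof -
  have x: "\<forall>i\<in>I. x i \<in> X" using N by auto
  have "\<phi> (\<Sum>i\<in>I. of_int (a i) * x i) = (\<Otimes>i\<in>I. \<phi> (x i) [^] a i)" for a
  proof -
    have "\<phi> (\<Sum>i\<in>I. of_int (a i) * x i) = (\<Otimes>i\<in>I. \<phi> (of_int (a i) * x i))"
      using hom_sum[OF N(2), of "\<lambda>i. of_int (a i) * x i"] x of_int_mem by blast
    also have "\<dots> = (\<Otimes>i\<in>I. \<phi> (x i) [^] a i)"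
      using x closed hom_of_int by (intro finprod_cong') auto
    finally show ?thesis .
  qed
  then show ?thesis
    unfolding N(1) sum_dilates_indexed[OF N(2)] by (simp add: setcompr_eq_image image_image)
qed

theorem wsums_of_length_eq:
  assumes S: "set_mset S \<subseteq> X"
  shows "wsums_of_length M A k (image_mset \<phi> S) = \<phi> ` sums_of_length (dilate A) k S"
proof (intro equalityI subsetI)
  fix z assume "z \<in> wsums_of_length M A k (image_mset \<phi> S)"
  then obtain s a where z: "z = (\<Otimes>i\<in>{1..k}. s i [^] a i)" and a: "\<forall>i\<in>{1..k}. a i \<in> A"
    and s: "image_mset s (mset_set {1..k}) \<subseteq># image_mset \<phi> S"
    unfolding wsums_of_length_def by blast
  obtain N where N: "N \<subseteq># S" "image_mset s (mset_set {1..k}) = image_mset \<phi> N"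
    using s by (rule submultiset_image_msetE)
  obtain x where x: "N = image_mset x (mset_set {1..k})" "\<forall>i\<in>{1..k}. \<phi> (x i) = s i"
    using image_mset_lift[OF _ N(2)] by blast
  have NX: "set_mset N \<subseteq> X" using S set_mset_mono[OF N(1)] by blast
  have "z = (\<Otimes>i\<in>{1..k}. \<phi> (x i) [^] a i)"
    unfolding z using x NX closed by (intro finprod_cong') auto
  then have "z \<in> \<phi> ` (\<Sum>s\<in>#N. dilate A s)"
    unfolding image_sum_dilates[OF x(1) finite_atLeastAtMost NX] using a by blast
  moreover have "size N = k" using x(1) by simp
  ultimately show "z \<in> \<phi> ` sums_of_length (dilate A) k S" using N(1) mem_sums_of_length_iff by blast
next
  fix z assume "z \<in> \<phi> ` sums_of_length (dilate A) k S"
  then obtain N where N: "N \<subseteq># S" "size N = k" and z: "z \<in> \<phi> ` (\<Sum>s\<in>#N. dilate A s)"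
    unfolding sums_of_length_def by blast
  obtain x where x: "N = image_mset x (mset_set {1..k})" using multiset_indexing[of "{1..k}" N] N(2)
    by auto
  have NX: "set_mset N \<subseteq> X" using S set_mset_mono[OF N(1)] by blast
  obtain a where "z = (\<Otimes>i\<in>{1..k}. \<phi> (x i) [^] a i)" "\<forall>i\<in>{1..k}. a i \<in> A"
    using z unfolding image_sum_dilates[OF x finite_atLeastAtMost NX] by blast
  moreover have "image_mset (\<lambda>i. \<phi> (x i)) (mset_set {1..k}) \<subseteq># image_mset \<phi> S"
    using image_mset_subseteq_mono[OF N(1), of \<phi>] unfolding x
    by (simp add: multiset.map_comp comp_def)
  ultimately show "z \<in> wsums_of_length M A k (image_mset \<phi> S)"
    unfolding wsums_of_length_def mem_Collect_eq
    by (intro exI[of _ "\<lambda>i. \<phi> (x i)"] exI[of _ a] conjI)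
qed

lemma one_mem_wsums_iff:
  assumes S: "set_mset S \<subseteq> X"
  shows "\<one> \<in> wsums M A (image_mset \<phi> S) \<longleftrightarrow> (\<exists>Z. Z \<subseteq># S \<and> Z \<noteq> {#} \<and> (\<Sum>s\<in>#Z. dilate A s) \<inter> ker \<noteq> {})"
proof -
  have one: "\<one> \<in> \<phi> ` (\<Sum>s\<in>#Z. dilate A s) \<longleftrightarrow> (\<Sum>s\<in>#Z. dilate A s) \<inter> ker \<noteq> {}" if "Z \<subseteq># S" for Z
  proof -
    have "\<forall>s\<in>#Z. dilate A s \<subseteq> X"
      using S set_mset_mono[OF that] dilate_subset[OF X.add_subgroup_axioms] by blast
    then have "(\<Sum>s\<in>#Z. dilate A s) \<subseteq> X" by (rule X.sumset_subset)
    then show ?thesis by (fastforce simp: ker_def image_iff)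
  qed
  have size: "size Z \<in> {1..size S} \<longleftrightarrow> Z \<noteq> {#}" if "Z \<subseteq># S" for Z
    using size_mset_mono[OF that] by (auto simp: Suc_le_eq nonempty_has_size)
  have "\<one> \<in> wsums M A (image_mset \<phi> S) \<longleftrightarrow>
      (\<exists>k\<in>{1..size S}. \<exists>Z. Z \<subseteq># S \<and> size Z = k \<and> \<one> \<in> \<phi> ` (\<Sum>s\<in>#Z. dilate A s))"
    by (auto simp: wsums_def wsums_of_length_eq[OF S] sums_of_length_def)
  also have "\<dots> \<longleftrightarrow> (\<exists>Z. Z \<subseteq># S \<and> Z \<noteq> {#} \<and> \<one> \<in> \<phi> ` (\<Sum>s\<in>#Z. dilate A s))"
    using size by (metis (no_types, lifting))
  finally show ?thesis using one by blast
qed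

lemma lift_multiset:
  assumes "set_mset S \<subseteq> carrier M"
  obtains T where "set_mset T \<subseteq> X" "S = image_mset \<phi> T"
proof
  have g: "inv_into X \<phi> s \<in> X" "\<phi> (inv_into X \<phi> s) = s" if "s \<in># S" for s
    using that assms surj inv_into_into f_inv_into_f by (metis subsetD)+
  then show "set_mset (image_mset (inv_into X \<phi>) S) \<subseteq> X" by auto
  show "S = image_mset \<phi> (image_mset (inv_into X \<phi>) S)"
    using g by (simp add: multiset.map_comp multiset.map_ident_strong)
qed

theorem davenport_eq_dav: "davenport M A = dav A ker X"
proof -
  have "(\<forall>S. set_mset S \<subseteq> carrier M \<and> size S = l \<longrightarrow> \<one> \<in> wsums M A S) \<longleftrightarrow>
      zero_sum_bound ker (dilate A) X l" for l
  proof
    assume zero_sums: "\<forall>S. set_mset S \<subseteq> carrier M \<and> size S = l \<longrightarrow> \<one> \<in> wsums M A S"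
    show "zero_sum_bound ker (dilate A) X l"
      unfolding zero_sum_bound_def
    proof (intro allI impI)
      fix T assume T: "set_mset T \<subseteq> X \<and> size T = l"
      then have "set_mset (image_mset \<phi> T) \<subseteq> carrier M" using closed by auto
      then have "\<one> \<in> wsums M A (image_mset \<phi> T)" using zero_sums T by simp
      then show "\<exists>Z. Z \<subseteq># T \<and> Z \<noteq> {#} \<and> (\<Sum>s\<in>#Z. dilate A s) \<inter> ker \<noteq> {}"
        using one_mem_wsums_iff[of T A] T by blast
    qed
  next
    assume bound: "zero_sum_bound ker (dilate A) X l"
    show "\<forall>S. set_mset S \<subseteq> carrier M \<and> size S = l \<longrightarrow> \<one> \<in> wsums M A S"
    proof (intro allI impI)
      fix S assume S: "set_mset S \<subseteq> carrier M \<and> size S = l"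
      then obtain T where "set_mset T \<subseteq> X" "S = image_mset \<phi> T" using lift_multiset by blast
      then show "\<one> \<in> wsums M A S"
        using bound S one_mem_wsums_iff[of T A] unfolding zero_sum_bound_def by simp
    qed
  qed
  then show ?thesis by (simp add: davenport_def dav_def)
qed

lemma add_subgroup_preimage:
  assumes "subgroup H M"
  shows "add_subgroup (preimage H)"
proof -
  interpret H: subgroup H M by fact
  show ?thesis
    using X.zero_mem X.diff_mem hom_zero hom_diff by unfold_locales (simp_all add: preimage_def)
qed

lemma subgroup_image:
  assumes "add_subgroup Y" "Y \<subseteq> X"
  shows "subgroup (\<phi> ` Y) M"
proof (rule subgroupI)
  interpret Y: add_subgroup Y by fact
  show "\<phi> ` Y \<subseteq> carrier M" using assms(2) closed by blast
  show "\<phi> ` Y \<noteq> {}" using Y.zero_mem by blast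
  show "inv z \<in> \<phi> ` Y" if z: "z \<in> \<phi> ` Y" for z
  proof -
    obtain x where "x \<in> Y" "z = \<phi> x" using z by blast
    then show ?thesis using hom_minus[of x] Y.minus_mem[of x] assms(2) by (metis imageI subsetD)
  qed
  show "z \<otimes> w \<in> \<phi> ` Y" if zw: "z \<in> \<phi> ` Y" "w \<in> \<phi> ` Y" for z w
  proof -
    obtain x y where "x \<in> Y" "z = \<phi> x" "y \<in> Y" "w = \<phi> y" using zw by blast
    then show ?thesis using hom[of x y] Y.add_mem[of x y] assms(2) by (metis imageI subsetD)
  qed
qed

lemma preimage_image:
  assumes "add_subgroup Y" "ker \<subseteq> Y" "Y \<subseteq> X"
  shows "preimage (\<phi> ` Y) = Y"
proof
  interpret Y: add_subgroup Y by fact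
  show "preimage (\<phi> ` Y) \<subseteq> Y"
  proof
    fix x assume "x \<in> preimage (\<phi> ` Y)"
    then obtain y where y: "x \<in> X" "y \<in> Y" "\<phi> x = \<phi> y" by (auto simp: preimage_def)
    then have "x - y \<in> Y" using diff_mem_ker_iff assms by blast
    then show "x \<in> Y" using Y.add_mem[OF _ y(2)] by force
  qed
qed (use assms(3) in \<open>auto simp: preimage_def\<close>)

lemma presentation_subgroup:
  assumes H: "subgroup H M"
  shows "presentation (M\<lparr>carrier := H\<rparr>) (preimage H) \<phi>"
proof -
  have "comm_group (M\<lparr>carrier := H\<rparr>)"
    using group.group_comm_groupI[OF subgroup.subgroup_is_group[OF H group_axioms]]
      m_comm subgroup.mem_carrier[OF H] by auto
  moreover have "\<phi> ` preimage H = H" using subgroup.subset[OF H] surj by (auto simp: preimage_def)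
  ultimately show ?thesis
    unfolding presentation_def presentation_axioms_def
    using add_subgroup_preimage[OF H] hom by (auto simp: preimage_def)
qed

lemma ker_subgroup:
  assumes H: "subgroup H M"
  shows "presentation.ker (M\<lparr>carrier := H\<rparr>) (preimage H) \<phi> = ker"
  unfolding presentation.ker_def[OF presentation_subgroup[OF H]]
  using subgroup.one_closed[OF H] by (auto simp: ker_def preimage_def)

lemma presentation_quotient:
  assumes H: "subgroup H M"
  shows "presentation (M Mod H) X (\<lambda>x. H #> \<phi> x)"
proof -
  interpret N: normal H M using H by (rule subgroup_imp_normal)
  have "(\<lambda>x. H #> \<phi> x) ` X = carrier (M Mod H)"
    unfolding carrier_FactGroup surj[symmetric] by (simp add: image_image)
  moreover have "H #> \<phi> (x + y) = (H #> \<phi> x) \<otimes>\<^bsub>M Mod H\<^esub> (H #> \<phi> y)" if "x \<in> X" "y \<in> X" for x y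
    using N.rcos_sum[OF closed closed] hom that by simp
  ultimately show ?thesis
    unfolding presentation_def presentation_axioms_def
    using abelian_FactGroup[OF H] X.add_subgroup_axioms by blast
qed

lemma ker_quotient:
  assumes H: "subgroup H M"
  shows "presentation.ker (M Mod H) X (\<lambda>x. H #> \<phi> x) = preimage H"
  unfolding presentation.ker_def[OF presentation_quotient[OF H]]
  using coset_join1[OF _ closed H] coset_join2[OF closed H] by (auto simp: preimage_def)

lemma image_elt_plus: "v \<in> X \<Longrightarrow> Y \<subseteq> X \<Longrightarrow> \<phi> ` (v +o Y) = \<phi> v <# \<phi> ` Y"
  using hom by (auto simp: elt_set_plus_def l_coset_def image_iff) (metis subsetD)+

lemma image_set_plus: "Y \<subseteq> X \<Longrightarrow> Z \<subseteq> X \<Longrightarrow> \<phi> ` (Y + Z) = \<phi> ` Y <#> \<phi> ` Z"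
  using hom by (auto simp: set_plus_def set_mult_def image_iff) (metis subsetD)+

end

theorem presentation_by_integer_functions:
  fixes M :: "('a, 'b) monoid_scheme" (structure)
  assumes "comm_group M" and fin: "finite (carrier M)"
  shows "presentation M (UNIV :: ('a \<Rightarrow> int) set) (\<lambda>f. \<Otimes>x\<in>carrier M. x [^] f x)"
proof -
  interpret comm_group M by fact
  let ?\<phi> = "\<lambda>f :: 'a \<Rightarrow> int. \<Otimes>x\<in>carrier M. x [^] f x"
  have closed: "?\<phi> f \<in> carrier M" for f by (rule finprod_closed) auto
  have "x \<in> range ?\<phi>" if x: "x \<in> carrier M" for x
  proof -
    have "?\<phi> (\<lambda>y. if y = x then 1 else 0) = (\<Otimes>y\<in>carrier M. if y = x then y else \<one>)"
      by (rule finprod_cong') auto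
    also have "\<dots> = x" using finprod_singleton_swap[OF x fin, of "\<lambda>y. y"] by simp
    finally show ?thesis by (intro range_eqI[OF sym])
  qed
  then have "range ?\<phi> = carrier M" using closed by auto
  moreover have "?\<phi> (f + g) = ?\<phi> f \<otimes> ?\<phi> g" for f g
  proof -
    have "?\<phi> (f + g) = (\<Otimes>x\<in>carrier M. x [^] f x \<otimes> x [^] g x)"
      by (rule finprod_cong') (auto simp: int_pow_mult)
    also have "\<dots> = ?\<phi> f \<otimes> ?\<phi> g" by (rule finprod_multf) auto
    finally show ?thesis .
  qed
  ultimately show ?thesis by unfold_locales auto
qed

locale presented_decomposition = presentation M UNIV \<phi> +
  weighted_decomposition "presentation.ker M UNIV \<phi>"
    "presentation.preimage UNIV \<phi> G" A n S H \<beta> S' S'' S0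
  for M (structure) and \<phi> :: "'v::comm_ring_1 \<Rightarrow> 'a" and G A n S H \<beta> S' S'' S0 +
  assumes G: "subgroup G M"
begin

lemma image_mset_removed: "image_mset \<phi> S - image_mset \<phi> S' = image_mset \<phi> (S - S')"
  by (rule image_mset_Diff[OF submultisets(1), symmetric])

lemma image_submultisets:
  "image_mset \<phi> S' \<subseteq># image_mset \<phi> S" "image_mset \<phi> S'' \<subseteq># image_mset \<phi> S'"
  "image_mset \<phi> S0 \<subseteq># image_mset \<phi> S"
  "image_mset \<phi> (S - S') + image_mset \<phi> S'' \<subseteq># image_mset \<phi> S0"
  using submultisets image_mset_subseteq_mono[of _ _ \<phi>]
  by (simp_all flip: image_mset_union)

lemma size_retained: "size S = size S' + size (S - S')"
  using submultisets(1) by (metis size_union subset_mset.add_diff_inverse)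

lemma H_between: "add_subgroup H" "ker \<subseteq> H" "H \<subseteq> preimage G"
  using H by (simp_all add: intermediate_def)

lemma subgroup_image_H: "subgroup (\<phi> ` H) M"
  by (rule subgroup_image[OF H_between(1)]) simp

lemma subgroup_image_H_in_G: "subgroup (\<phi> ` H) (M\<lparr>carrier := G\<rparr>)"
  using H_between(3) by (intro subgroup_incl[OF subgroup_image_H G]) (auto simp: preimage_def)

lemma preimage_image_H: "preimage (\<phi> ` H) = H"
  by (rule preimage_image[OF H_between(1,2)]) simp

lemma card_image_H: "card (\<phi> ` H) = ncosets ker H"
  by (rule card_image_eq_ncosets) simp

lemma davenport_G: "davenport (M\<lparr>carrier := G\<rparr>) A = dav A ker (preimage G)"
  using presentation.davenport_eq_dav[OF presentation_subgroup[OF G]] ker_subgroup[OF G] by simp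

lemma davenport_image_H: "davenport (M\<lparr>carrier := \<phi> ` H\<rparr>) A = dav A ker H"
  using presentation.davenport_eq_dav[OF presentation_subgroup[OF subgroup_image_H]]
    ker_subgroup[OF subgroup_image_H] by (simp add: preimage_image_H)

lemma order_quotient: "order (M\<lparr>carrier := G\<rparr> Mod \<phi> ` H) = ncosets H (preimage G)"
  and davenport_quotient: "davenport (M\<lparr>carrier := G\<rparr> Mod \<phi> ` H) A = dav A H (preimage G)"
proof -
  interpret PG: presentation "M\<lparr>carrier := G\<rparr>" "preimage G" \<phi> by (rule presentation_subgroup[OF G])
  note Q = PG.presentation_quotient[OF subgroup_image_H_in_G]
  have "PG.preimage (\<phi> ` H) = H"
    unfolding PG.preimage_def using preimage_image_H H_between(3) by (auto simp: preimage_def)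
  note kernel = PG.ker_quotient[OF subgroup_image_H_in_G, unfolded this]
  show "order (M\<lparr>carrier := G\<rparr> Mod \<phi> ` H) = ncosets H (preimage G)"
    using presentation.order_eq_index[OF Q] kernel by simp
  show "davenport (M\<lparr>carrier := G\<rparr> Mod \<phi> ` H) A = dav A H (preimage G)"
    using presentation.davenport_eq_dav[OF Q] kernel by simp
qed

lemma mem_coset_image_H_iff: "\<phi> x \<in> \<phi> y <# \<phi> ` H \<longleftrightarrow> x - y \<in> H"
  using diff_mem_preimage_iff[OF subgroup_image_H, of x y] by (simp add: preimage_image_H)

lemma wsums_eq_image:
  "wsums_of_length M A k (image_mset \<phi> T) = \<phi> ` (sums_of_length (dilate A) k T + ker)"
  using wsums_of_length_eq[of T A k] image_plus_ker by simp

lemma wsums_S'':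
  "\<phi> \<beta> [^] card (\<phi> ` H) <# \<phi> ` H = wsums_of_length M A (card (\<phi> ` H)) (image_mset \<phi> S'')"
  by (simp add: wsums_eq_image card_image_H sums_S'' image_elt_plus hom_of_nat)

lemma wsums_S:
  "wsums_of_length M A n (image_mset \<phi> S) =
    \<phi> \<beta> [^] (int n - int (card (\<phi> ` H)) - int (size (S - S')))
      <# wsums_of_length M A (card (\<phi> ` H) + size (S - S')) (image_mset \<phi> S0)"
proof -
  let ?m = "ncosets ker H + size (S - S')" and ?Y = "subsums (shifted_dilate A \<beta>) (S - S') + H"
  have "(of_nat n * \<beta>) +o ?Y = (of_int (int n - int ?m) * \<beta>) +o ((of_nat ?m * \<beta>) +o ?Y)"
    by (simp add: set_plus_rearrange2 left_diff_distrib distrib_right)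
  then have "sums_of_length (dilate A) n S + ker =
      (of_int (int n - int ?m) * \<beta>) +o (sums_of_length (dilate A) ?m S0 + ker)"
    by (simp only: sums_S sums_S0)
  then show ?thesis
    by (simp add: wsums_eq_image card_image_H image_elt_plus hom_of_int diff_diff_eq
        del: of_int_diff)
qed

lemma wsums_S_periodic:
  "wsums_of_length M A n (image_mset \<phi> S) <#> \<phi> ` H = wsums_of_length M A n (image_mset \<phi> S)"
proof -
  interpret H: add_subgroup H by (rule H_between(1))
  show ?thesis
    by (simp add: wsums_eq_image sums_S set_plus_rearrange3 H.periodic_plus flip: image_set_plus)
qed

lemma pow_mem_wsums_S: "\<phi> \<beta> [^] n \<in> wsums_of_length M A n (image_mset \<phi> S)"
proof -
  interpret H: add_subgroup H by (rule H_between(1))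
  have "0 \<in> subsums (shifted_dilate A \<beta>) (S - S') + H" using zero_mem_subsums H.subset_plus by blast
  then have "of_nat n * \<beta> \<in> sums_of_length (dilate A) n S + ker"
    by (simp add: sums_S flip: set_minus_plus)
  then show ?thesis unfolding wsums_eq_image using hom_of_nat[of \<beta> n] by force
qed

lemma powers_S'_subset_coset: "\<forall>s\<in>#image_mset \<phi> S'. {s [^] a | a. a \<in> A} \<subseteq> \<phi> \<beta> <# \<phi> ` H"
proof -
  have "\<phi> s [^] a \<in> \<phi> \<beta> <# \<phi> ` H" if "s \<in># S'" "a \<in> A" for s a
    using shifted_dilates that mem_coset_image_H_iff[of "of_int a * s" \<beta>]
    by (simp add: hom_of_int shifted_dilate_subset_iff)
  then show ?thesis by auto
qed

lemma S''_nonempty: "S'' \<noteq> {#}"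
proof -
  interpret KH: weighted_subquotient ker H A by (rule below[OF H])
  show ?thesis using size_S'' KH.index_pos KH.dav_pos by auto
qed

lemma coset_of_image_S':
  obtains \<alpha> where "\<alpha> \<in># image_mset \<phi> S" "set_mset (image_mset \<phi> S') \<subseteq> \<alpha> <# \<phi> ` H"
    "set_mset (image_mset \<phi> S'') \<subseteq> \<alpha> <# \<phi> ` H"
proof -
  obtain \<alpha> where "\<alpha> \<in># S''" using S''_nonempty by blast
  then have \<alpha>: "\<alpha> \<in># S'" using mset_subset_eqD[OF submultisets(2)] by blast
  then have "\<alpha> \<in># S" using mset_subset_eqD[OF submultisets(1)] by blast
  have "s - \<alpha> \<in> H" if "s \<in># S'" for s
    using shifted_dilate_subset_iff_diff[OF H_between(1)] shifted_dilates that \<alpha> by blast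
  then have "set_mset (image_mset \<phi> S') \<subseteq> \<phi> \<alpha> <# \<phi> ` H" by (auto simp: mem_coset_image_H_iff)
  then show thesis
    using that[of "\<phi> \<alpha>"] \<open>\<alpha> \<in># S\<close> set_mset_mono[OF image_submultisets(2)] by auto
qed

lemma \<beta>_in_coset:
  assumes "\<forall>s\<in>#S. {\<phi> s [^] a | a. a \<in> A} \<subseteq> \<delta> <# G" "\<delta> \<in> carrier M"
  shows "\<phi> \<beta> \<in> \<delta> <# G"
proof -
  obtain d where d: "\<delta> = \<phi> d" using assms(2) surj by blast
  obtain s where "s \<in># S''" using S''_nonempty by blast
  then have s: "s \<in># S'" using mset_subset_eqD[OF submultisets(2)] by blast
  then have "s \<in># S" using mset_subset_eqD[OF submultisets(1)] by blast
  obtain a where a: "a \<in> A" using weights_nonempty by blast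
  have "\<phi> (of_int a * s) \<in> \<phi> d <# G" using assms(1) \<open>s \<in># S\<close> a by (auto simp: hom_of_int d)
  then have "of_int a * s - d \<in> preimage G" by (simp add: diff_mem_preimage_iff[OF G])
  moreover have "of_int a * s - \<beta> \<in> preimage G"
    using shifted_dilates s a H_between(3) by (auto simp: shifted_dilate_subset_iff)
  ultimately have "(of_int a * s - d) - (of_int a * s - \<beta>) \<in> preimage G" by (rule upper.diff_mem)
  then have "\<beta> - d \<in> preimage G" by simp
  then show ?thesis by (simp add: d diff_mem_preimage_iff[OF G])
qed

end

theorem presented_decomposition_exists:
  fixes M (structure)
  assumes "presentation M UNIV \<phi>" and fin: "finite (carrier M)" and G: "subgroup G M" and
    "Gcd A = 1"
    and \<delta>: "\<delta> \<in> carrier M" and S: "\<forall>s\<in>#S. {\<phi> s [^] a | a. a \<in> A} \<subseteq> \<delta> <# G"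
    and n: "card G \<le> n" and long: "n + davenport (M\<lparr>carrier := G\<rparr>) A \<le> size S + 1"
  obtains H \<beta> S' S'' S0 where "presented_decomposition M \<phi> G A n S H \<beta> S' S'' S0"
proof -
  interpret presentation M UNIV \<phi> by fact
  interpret PG: presentation "M\<lparr>carrier := G\<rparr>" "preimage G" \<phi> by (rule presentation_subgroup[OF G])
  have kernel: "PG.ker = ker" by (rule ker_subgroup[OF G])
  have "finite G" using fin finite_subset[OF subgroup.subset[OF G]] by blast
  then have "subquotient ker (preimage G)" using PG.subquotient_ker kernel by simp
  then interpret weighted_subquotient ker "preimage G" A
    using \<open>Gcd A = 1\<close> by (simp add: weighted_subquotient_def weighted_subquotient_axioms_def)
  obtain d where d: "\<delta> = \<phi> d" using \<delta> surj by blast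
  have "of_int a * s - d \<in> preimage G" if "s \<in># S" "a \<in> A" for s a
    using S that by (auto simp: diff_mem_preimage_iff[OF G] hom_of_int d)
  then have "\<forall>s\<in>#S. shifted_dilate A d s \<subseteq> preimage G" by (simp add: shifted_dilate_subset_iff)
  moreover have "ncosets ker (preimage G) \<le> n" using n PG.order_eq_index kernel
    by (simp add: order_def)
  moreover have "n + dav A ker (preimage G) \<le> size S + 1"
    using long PG.davenport_eq_dav[of A] kernel by simp
  ultimately obtain H \<beta> S' S'' S0 where
    "weighted_decomposition ker (preimage G) A n S H \<beta> S' S'' S0"
    by (rule weighted_decomposition_exists)
  then have "presented_decomposition M \<phi> G A n S H \<beta> S' S'' S0"
    using presentation_axioms G
    by (simp add: presented_decomposition_def presented_decomposition_axioms_def)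
  then show thesis by (rule that)
qed

theorem presented_decomposition_of_multiset:
  fixes M :: "('a, 'b) monoid_scheme" (structure)
  assumes M: "comm_group M" "finite (carrier M)" and G: "subgroup G M" and A: "Gcd A = 1"
    and \<delta>: "\<delta> \<in> carrier M" and S: "set_mset S \<subseteq> carrier M"
    and powers: "\<forall>s\<in>#S. {s [^] a | a. a \<in> A} \<subseteq> \<delta> <# G"
    and n: "card G \<le> n" and long: "n + davenport (M\<lparr>carrier := G\<rparr>) A \<le> size S + 1"
  obtains \<phi> :: "('a \<Rightarrow> int) \<Rightarrow> 'a" and T H \<beta> T' T'' T0
  where "S = image_mset \<phi> T" "presented_decomposition M \<phi> G A n T H \<beta> T' T'' T0"
proof -
  obtain \<phi> :: "('a \<Rightarrow> int) \<Rightarrow> 'a" where \<phi>: "presentation M UNIV \<phi>"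
    using presentation_by_integer_functions[OF M] by blast
  obtain T where T: "S = image_mset \<phi> T" by (rule presentation.lift_multiset[OF \<phi> S])
  have "\<forall>t\<in>#T. {\<phi> t [^] a | a. a \<in> A} \<subseteq> \<delta> <# G" using powers T by simp
  moreover have "n + davenport (M\<lparr>carrier := G\<rparr>) A \<le> size T + 1" using long T by simp
  ultimately obtain H \<beta> T' T'' T0 where "presented_decomposition M \<phi> G A n T H \<beta> T' T'' T0"
    by (rule presented_decomposition_exists[OF \<phi> M(2) G A \<delta> _ n])
  then show thesis by (rule that[OF T])
qed

theorem theorem1p1:
  fixes G0 :: "('a, 'b) monoid_scheme"
    and G :: "'a set" and \<gamma> \<delta> :: 'a and n :: nat
    and A :: "int set" and W :: "int multiset" and S :: "'a multiset"
  assumes "comm_group G0" and "finite (carrier G0)"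
    and "subgroup G G0"
    and "\<gamma> \<in> carrier G0" and "\<delta> \<in> carrier G0"
    and "n \<ge> card G"
    and "A \<noteq> {}" and "Gcd A = 1"
    and "set_mset W = A"
    and "set_mset S \<subseteq> \<gamma> <#\<^bsub>G0\<^esub> G"
    and "\<forall>s \<in> set_mset S. {s [^]\<^bsub>G0\<^esub> a | a. a \<in> A} \<subseteq> \<delta> <#\<^bsub>G0\<^esub> G"
    and "size S \<ge> n + davenport (G0\<lparr>carrier := G\<rparr>) A - 1"
  shows "\<exists>H \<alpha> \<beta> S' S'' S\<^sub>0.
    subgroup H (G0\<lparr>carrier := G\<rparr>) \<and>
    \<alpha> \<in> \<gamma> <#\<^bsub>G0\<^esub> G \<and> \<beta> \<in> \<delta> <#\<^bsub>G0\<^esub> G \<and>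
    S' \<subseteq># S \<and> S'' \<subseteq># S' \<and> S\<^sub>0 \<subseteq># S \<and>
    (let r = size (S - S');
         q = order (G0\<lparr>carrier := G\<rparr> Mod H);
         D\<^sub>G = davenport (G0\<lparr>carrier := G\<rparr>) A;
         D\<^sub>H = davenport (G0\<lparr>carrier := H\<rparr>) A;
         D\<^sub>Q = davenport (G0\<lparr>carrier := G\<rparr> Mod H) A
     in
      (set_mset S' \<subseteq> \<alpha> <#\<^bsub>G0\<^esub> H \<and> set_mset S'' \<subseteq> \<alpha> <#\<^bsub>G0\<^esub> H \<and>
       (\<forall>s \<in> set_mset S'. {s [^]\<^bsub>G0\<^esub> a | a. a \<in> A} \<subseteq> \<beta> <#\<^bsub>G0\<^esub> H)) \<and>
      int (size S') \<ge> min (int (size S)) (int (size S) - (int q - 2)) \<and>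
      size S'' = card H + D\<^sub>H - 1 \<and>
      (\<beta> [^]\<^bsub>G0\<^esub> card H) <#\<^bsub>G0\<^esub> H = wsums_of_length G0 (set_mset W) (card H) S'' \<and>
      (wsums_of_length G0 (set_mset W) n S =
         (\<beta> [^]\<^bsub>G0\<^esub> (int n - int (card H) - int r))
           <#\<^bsub>G0\<^esub> wsums_of_length G0 (set_mset W) (card H + r) S\<^sub>0 \<and>
       wsums_of_length G0 (set_mset W) n S <#>\<^bsub>G0\<^esub> H = wsums_of_length G0 (set_mset W) n S \<and>
       \<beta> [^]\<^bsub>G0\<^esub> n \<in> wsums_of_length G0 (set_mset W) n S) \<and>
      ((S - S') + S'' \<subseteq># S\<^sub>0 \<and>
       size S\<^sub>0 = card H + r + D\<^sub>H + D\<^sub>Q - 2 \<and>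
       card H + r + D\<^sub>H + D\<^sub>Q - 2 \<le> card H + r + D\<^sub>G - 1) \<and>
      int r \<le> max 0 (int q - 2))"
proof -
  have "set_mset S \<subseteq> carrier G0"
    using assms(10) subgroup.subset[OF assms(3)] assms(4)
      group.l_coset_subset_G[OF comm_group.axioms(2)[OF assms(1)]] by blast
  moreover have "n + davenport (G0\<lparr>carrier := G\<rparr>) A \<le> size S + 1" using assms(12) by linarith
  ultimately obtain \<phi> :: "('a \<Rightarrow> int) \<Rightarrow> 'a" and T H \<beta> T' T'' T0 where S: "S = image_mset \<phi> T"
    and "presented_decomposition G0 \<phi> G A n T H \<beta> T' T'' T0"
    by (rule presented_decomposition_of_multiset[OF assms(1-3,8,5) _ assms(11,6)])
  then interpret presented_decomposition G0 \<phi> G A n T H \<beta> T' T'' T0 by blast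
  obtain \<alpha> where "\<alpha> \<in># S" and cosets: "set_mset (image_mset \<phi> T') \<subseteq> \<alpha> <#\<^bsub>G0\<^esub> \<phi> ` H"
    "set_mset (image_mset \<phi> T'') \<subseteq> \<alpha> <#\<^bsub>G0\<^esub> \<phi> ` H"
    unfolding S by (rule coset_of_image_S')
  then have "\<alpha> \<in> \<gamma> <#\<^bsub>G0\<^esub> G" using assms(10) by blast
  have "\<phi> \<beta> \<in> \<delta> <#\<^bsub>G0\<^esub> G" using \<beta>_in_coset assms(5,11) unfolding S by simp
  note sizes = size_retained size_removed size_S'' size_S0 dav_tower[OF H]
    davenport_G davenport_image_H davenport_quotient order_quotient card_image_H
  show ?thesis
    unfolding Let_def assms(9) S
    by (rule exI[of _ "\<phi> ` H"], rule exI[of _ \<alpha>], rule exI[of _ "\<phi> \<beta>"],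
        rule exI[of _ "image_mset \<phi> T'"], rule exI[of _ "image_mset \<phi> T''"],
        rule exI[of _ "image_mset \<phi> T0"], unfold image_mset_removed size_image_mset, intro conjI)
      (fact subgroup_image_H_in_G \<open>\<alpha> \<in> \<gamma> <#\<^bsub>G0\<^esub> G\<close> \<open>\<phi> \<beta> \<in> \<delta> <#\<^bsub>G0\<^esub> G\<close> image_submultisets cosets
        powers_S'_subset_coset wsums_S'' wsums_S wsums_S_periodic pow_mem_wsums_S
        | use sizes in simp)+
qed

end
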